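(* Let $U_0\in H$ and decompose $U_0=U_1+W_0$ with $U_1\in H_u$ and $W_0\perp H_u$. Then $\mathsf D S_1(t)U_1=0$ for all $t\ge0$, and $$S(t)U_0-S_1(t)U_1\rightharpoonup 0\quad\text{weakly in }H\text{ as }t\to\infty.$$ That is, weak solutions of $$\partial_t\dot\varepsilon_{ij}=\tfrac12(\partial_j\dot v_i+\partial_i\dot v_j)-\mathbb B_{(ij)(kl)}\dot\varepsilon_{kl},\qquad \rho\,\partial_t\dot v_i=\partial_j(\mathbb C_{ijkl}\dot\varepsilon_{kl})$$ (with $\dot v_i=0$ on $\partial\Omega_1$, $\mathbb C_{ijkl}\dot\varepsilon_{kl}n_j=0$ on $\partial\Omega_2$) weakly approach weak solutions $(\overline\varepsilon(t),\overline v(t))=S_1(t)U_1$ of the equations of linear elasticity, constrained by $e_{smn}\alpha_{pn}\mathbb C_{pmkl}\overline\varepsilon_{kl}=0$, i.e. of the limit system $$\partial_t\overline\varepsilon_{ij}=\tfrac12(\partial_j\overline v_i+\partial_i\overline v_j),\qquad \rho\,\partial_t\overline v_i=\partial_j(\mathbb C_{ijkl}\overline\varepsilon_{kl}),\qquad 0=e_{smn}\alpha_{pn}\mathbb C_{pmkl}\overline\varepsilon_{kl}\quad\text{in }\Omega,$$ $$\overline v_i=0\ \text{on }\partial\Omega_1,\qquad \mathbb C_{ijkl}\overline\varepsilon_{kl}n_j=0\ \text{on }\partial\Omega_2 .$$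
   Context: Conventions: indices run over $1,2,3$, repeated indices are summed, $e_{ijk}$ is the permutation symbol, $\partial_j=\partial/\partial x_j$; $A_{\ldots(ij)\ldots}=\frac12(A_{\ldots ij\ldots}+A_{\ldots ji\ldots})$. Domain: $\Omega\subset\mathbb R^3$ is open, bounded, connected, with $C^1$ boundary $\partial\Omega$ and outward unit normal $n$. $\partial\Omega_1,\partial\Omega_2\subset\partial\Omega$ are fixed disjoint measurable subsets whose union is $\partial\Omega$ up to a set of surface measure zero. Coefficients: $\rho>0$ is a constant. $\mathbb C_{ijkl}$ is real, continuous on $\overline\Omega$, with $\mathbb C_{ijkl}=\mathbb C_{jikl}=\mathbb C_{ijlk}=\mathbb C_{klij}$ and $\mathbb C_{ijkl}\varepsilon_{ij}\varepsilon_{kl}\ge a_0\varepsilon_{ij}\varepsilon_{ij}$ for all symmetric $\varepsilon$, with a constant $a_0>0$. $\alpha_{ij}$ is a real time-independent tensor field, continuous on $\overline\Omega$, of the form $\alpha_{ir}=e_{rjk}\partial_j\omega^0_{ik}$ for a skew-symmetric tensor field $\omega^0$ (a stress-free base state). Put $$\mathbb B_{ijkl}=e_{sjr}\alpha_{ir}\,e_{smn}\alpha_{pn}\,\mathbb C_{pmkl}.$$ Spaces: $H^0(\Omega)$ is the space of square integrable fields $\varepsilon:\Omega\to\mathbb R^{3\times3}_{sym}$; $L^2(\Omega)$ is the space of square integrable $v:\Omega\to\mathbb R^3$; $H^1(\Omega)$ is the usual Sobolev space of $\mathbb R^3$-valued fields; $\widehat H^1(\Omega)=\{v\in H^1(\Omega):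 v=0\text{ a.e. on }\partial\Omega_1\}$. $H=H^0(\Omega)\times L^2(\Omega)$ is a Hilbert space with inner product $$\langle(\varepsilon,v),(\bar\varepsilon,\bar v)\rangle_H=\int_\Omega \mathbb C_{ijkl}\varepsilon_{kl}\bar\varepsilon_{ij}+\rho v_i\bar v_i\,dx.$$ Operators: for $U=(\varepsilon,v)$, $$AU=\Big(\partial_{(j}v_{i)}-\mathbb B_{(ij)(kl)}\varepsilon_{kl},\ \tfrac1\rho\partial_j(\mathbb C_{ijkl}\varepsilon_{kl})\Big),\qquad A_1U=\Big(\partial_{(j}v_{i)},\ \tfrac1\rho\partial_j(\mathbb C_{ijkl}\varepsilon_{kl})\Big),$$ $$D(A)=D(A_1)=\{(\varepsilon,v)\in H: v\in\widehat H^1(\Omega),\ \partial_j(\mathbb C_{ijkl}\varepsilon_{kl})\in L^2(\Omega),\ \mathbb C_{ijkl}\varepsilon_{kl}n_j=0\text{ on }\partial\Omega_2\},$$ where the condition on $\partial\Omega_2$ is understood in the weak (trace) sense $\int_\Omega \partial_j\bar v_i\,\mathbb C_{ijkl}\varepsilon_{kl}+\bar v_i\,\partial_j(\mathbb C_{ijkl}\varepsilon_{kl})\,dx=0$ for all $\bar v\in\widehat H^1(\Omega)$. $A$ generates a $C^0$ semigroup of contractions $S(t)$ on $H$, and $A_1$ generates a $C^0$ semigroup of unitary operators $S_1(t)$ on $H$ (the evolution of linear elasticity). The weak solutions of the two evolution systems with data $U_0$, $U_1$ are $S(t)U_0$ and $S_1(t)U_1$ respectively. The operator $\mathsf D$ is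 $(\mathsf DU)_s=e_{smn}\alpha_{pn}\mathbb C_{pmkl}\varepsilon_{kl}$ for $U=(\varepsilon,v)\in H$. Isometric subspace: $H_u=\{U_1\in H:\ \|S(t)U_1\|_H=\|U_1\|_H=\|S^*(t)U_1\|_H\ \text{for all }t\ge0\}$, a closed subspace of $H$ ($S^*(t)$ is the adjoint of $S(t)$). *)

theory Defs
  imports "HOL-Analysis.Analysis"
begin

(* Indices are the elements 1, 2, 3 of the type 3. *)

definition perm_symbol :: "3 \<Rightarrow> 3 \<Rightarrow> 3 \<Rightarrow> real" where
  "perm_symbol i j k =
    (if (i, j, k) \<in> {(1, 2, 3), (2, 3, 1), (3, 1, 2)} then 1
     else if (i, j, k) \<in> {(3, 2, 1), (1, 3, 2), (2, 1, 3)} then - 1 else 0)"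

definition partial :: "3 \<Rightarrow> (real^3 \<Rightarrow> 'b::real_normed_vector) \<Rightarrow> real^3 \<Rightarrow> 'b" where
  "partial j f x = frechet_derivative f (at x) (axis j 1)"

(* k times continuously differentiable on the whole space *)
primrec Ck :: "nat \<Rightarrow> ('a::euclidean_space \<Rightarrow> 'b::real_normed_vector) \<Rightarrow> bool" where
  "Ck 0 f \<longleftrightarrow> continuous_on UNIV f"
| "Ck (Suc k) f \<longleftrightarrow> (\<forall>x. f differentiable (at x)) \<and>
     (\<forall>b\<in>Basis. Ck k (\<lambda>x. frechet_derivative f (at x) b))"

definition smooth :: "('a::euclidean_space \<Rightarrow> 'b::real_normed_vector) \<Rightarrow> bool" where
  "smooth f \<longleftrightarrow> (\<forall>k. Ck k f)"

definition test_function :: "(real^3) set \<Rightarrow> (real^3 \<Rightarrow> real) \<Rightarrow> bool" where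
  "test_function \<Omega> \<phi> \<longleftrightarrow> smooth \<phi> \<and> compact (closure {x. \<phi> x \<noteq> 0}) \<and> closure {x. \<phi> x \<noteq> 0} \<subseteq> \<Omega>"

(* Near each boundary point, up to an orthogonal change of coordinates, the set is the strict
   epigraph of a C^1 function of the first two coordinates. *)
definition C1_boundary :: "(real^3) set \<Rightarrow> bool" where
  "C1_boundary \<Omega> \<longleftrightarrow>
    (\<forall>p\<in>frontier \<Omega>. \<exists>r>0. \<exists>Q :: real^3 \<Rightarrow> real^3. \<exists>\<gamma> :: real^2 \<Rightarrow> real.
       orthogonal_transformation Q \<and> Ck 1 \<gamma> \<and>
       \<Omega> \<inter> ball p r = {x \<in> ball p r. \<gamma> (vector [Q x $ 1, Q x $ 2]) < Q x $ 3})"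

(* Surface measure: the two-dimensional Hausdorff outer measure, normalised so as to give the
   usual area of surfaces, on its Caratheodory-measurable sets. *)
definition hausdorff2_pre :: "real \<Rightarrow> (real^3) set \<Rightarrow> ennreal" where
  "hausdorff2_pre \<delta> A =
    (INF U \<in> {U :: nat \<Rightarrow> (real^3) set. A \<subseteq> (\<Union>i. U i) \<and> (\<forall>i. bounded (U i) \<and> diameter (U i) \<le> \<delta>)}.
       (\<Sum>i. ennreal (pi / 4 * (diameter (U i))\<^sup>2)))"

definition hausdorff2 :: "(real^3) set \<Rightarrow> ennreal" where
  "hausdorff2 A = (SUP \<delta>\<in>{0<..}. hausdorff2_pre \<delta> A)"

definition surface_measure :: "(real^3) measure" where
  "surface_measure =
     measure_of UNIV (lambda_system UNIV (Pow UNIV) hausdorff2) hausdorff2"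

definition domain_with_boundary_parts ::
    "(real^3) set \<Rightarrow> (real^3) set \<Rightarrow> (real^3) set \<Rightarrow> bool" where
  "domain_with_boundary_parts \<Omega> \<Gamma>1 \<Gamma>2 \<longleftrightarrow>
     open \<Omega> \<and> bounded \<Omega> \<and> connected \<Omega> \<and> C1_boundary \<Omega> \<and>
     \<Gamma>1 \<subseteq> frontier \<Omega> \<and> \<Gamma>2 \<subseteq> frontier \<Omega> \<and>
     \<Gamma>1 \<in> sets surface_measure \<and> \<Gamma>2 \<in> sets surface_measure \<and> \<Gamma>1 \<inter> \<Gamma>2 = {} \<and>
     frontier \<Omega> - (\<Gamma>1 \<union> \<Gamma>2) \<in> null_sets surface_measure"

(* Elements of the L^2-type spaces are represented by functions; equality in these spaces is
   equality almost everywhere on \<Omega>, and values outside \<Omega> are irrelevant. *)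
definition L2 :: "(real^3) set \<Rightarrow> (real^3 \<Rightarrow> 'b::euclidean_space) set" where
  "L2 \<Omega> = {f. f \<in> borel_measurable (lebesgue_on \<Omega>) \<and>
              integrable (lebesgue_on \<Omega>) (\<lambda>x. (norm (f x))\<^sup>2)}"

definition L2_norm_on :: "(real^3) set \<Rightarrow> (real^3 \<Rightarrow> 'b::euclidean_space) \<Rightarrow> real" where
  "L2_norm_on \<Omega> f = sqrt (\<integral>x. (norm (f x))\<^sup>2 \<partial>lebesgue_on \<Omega>)"

definition H0 :: "(real^3) set \<Rightarrow> (real^3 \<Rightarrow> real^3^3) set" where
  "H0 \<Omega> = {\<epsilon> \<in> L2 \<Omega>. \<forall>x\<in>\<Omega>. transpose (\<epsilon> x) = \<epsilon> x}"

(* G $ i $ j is the weak partial derivative of v $ i in direction j. *)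
definition is_weak_grad ::
    "(real^3) set \<Rightarrow> (real^3 \<Rightarrow> real^3) \<Rightarrow> (real^3 \<Rightarrow> real^3^3) \<Rightarrow> bool" where
  "is_weak_grad \<Omega> v G \<longleftrightarrow>
    (\<forall>\<phi>. test_function \<Omega> \<phi> \<longrightarrow> (\<forall>i j.
       (\<integral>x. v x $ i * partial j \<phi> x \<partial>lebesgue_on \<Omega>) = - (\<integral>x. G x $ i $ j * \<phi> x \<partial>lebesgue_on \<Omega>)))"

definition H1 :: "(real^3) set \<Rightarrow> (real^3 \<Rightarrow> real^3) set" where
  "H1 \<Omega> = {v \<in> L2 \<Omega>. \<exists>G\<in>L2 \<Omega>. is_weak_grad \<Omega> v G}"

definition weak_grad :: "(real^3) set \<Rightarrow> (real^3 \<Rightarrow> real^3) \<Rightarrow> real^3 \<Rightarrow> real^3^3" where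
  "weak_grad \<Omega> v = (SOME G. G \<in> L2 \<Omega> \<and> is_weak_grad \<Omega> v G)"

definition is_weak_div ::
    "(real^3) set \<Rightarrow> (real^3 \<Rightarrow> real^3^3) \<Rightarrow> (real^3 \<Rightarrow> real^3) \<Rightarrow> bool" where
  "is_weak_div \<Omega> \<sigma> f \<longleftrightarrow>
    (\<forall>\<phi>. test_function \<Omega> \<phi> \<longrightarrow> (\<forall>i.
       (\<integral>x. (\<Sum>j\<in>UNIV. \<sigma> x $ i $ j * partial j \<phi> x) \<partial>lebesgue_on \<Omega>) = - (\<integral>x. f x $ i * \<phi> x \<partial>lebesgue_on \<Omega>)))"

definition weak_div :: "(real^3) set \<Rightarrow> (real^3 \<Rightarrow> real^3^3) \<Rightarrow> real^3 \<Rightarrow> real^3" where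
  "weak_div \<Omega> \<sigma> = (SOME f. f \<in> L2 \<Omega> \<and> is_weak_div \<Omega> \<sigma> f)"

(* \<tau> is the trace of v: the trace operator is the continuous extension to H^1 of the restriction
   to the boundary, defined first for functions smooth up to the boundary. *)
definition is_trace ::
    "(real^3) set \<Rightarrow> (real^3 \<Rightarrow> real^3) \<Rightarrow> (real^3 \<Rightarrow> real^3) \<Rightarrow> bool" where
  "is_trace \<Omega> v \<tau> \<longleftrightarrow>
     \<tau> \<in> borel_measurable (restrict_space surface_measure (frontier \<Omega>)) \<and>
     (\<exists>\<phi> :: nat \<Rightarrow> real^3 \<Rightarrow> real^3. (\<forall>n. smooth (\<phi> n)) \<and>
        (\<lambda>n. L2_norm_on \<Omega> (\<lambda>x. \<phi> n x - v x)) \<longlonglongrightarrow> 0 \<and>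
        (\<lambda>n. L2_norm_on \<Omega> (\<lambda>x. (\<chi> i j. partial j (\<phi> n) x $ i) - weak_grad \<Omega> v x)) \<longlonglongrightarrow> 0 \<and>
        (\<lambda>n. \<integral>\<^sup>+x. ennreal ((norm (\<phi> n x - \<tau> x))\<^sup>2)
              \<partial>restrict_space surface_measure (frontier \<Omega>)) \<longlonglongrightarrow> 0)"

definition H1_hat :: "(real^3) set \<Rightarrow> (real^3) set \<Rightarrow> (real^3 \<Rightarrow> real^3) set" where
  "H1_hat \<Omega> \<Gamma>1 =
    {v \<in> H1 \<Omega>. \<exists>\<tau>. is_trace \<Omega> v \<tau> \<and> (AE x in surface_measure. x \<in> \<Gamma>1 \<longrightarrow> \<tau> x = 0)}"

type_synonym tensor4 = "real^3 \<Rightarrow> 3 \<Rightarrow> 3 \<Rightarrow> 3 \<Rightarrow> 3 \<Rightarrow> real"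

definition elasticity_tensor :: "(real^3) set \<Rightarrow> real \<Rightarrow> tensor4 \<Rightarrow> bool" where
  "elasticity_tensor \<Omega> a0 C \<longleftrightarrow>
     (\<forall>i j k l. continuous_on (closure \<Omega>) (\<lambda>x. C x i j k l)) \<and>
     (\<forall>x\<in>closure \<Omega>. \<forall>i j k l.
        C x i j k l = C x j i k l \<and> C x i j k l = C x i j l k \<and> C x i j k l = C x k l i j) \<and>
     (\<forall>x\<in>closure \<Omega>. \<forall>e :: real^3^3. transpose e = e \<longrightarrow>
        (\<Sum>i\<in>UNIV. \<Sum>j\<in>UNIV. \<Sum>k\<in>UNIV. \<Sum>l\<in>UNIV. C x i j k l * e $ i $ j * e $ k $ l)
          \<ge> a0 * (\<Sum>i\<in>UNIV. \<Sum>j\<in>UNIV. e $ i $ j * e $ i $ j))"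

definition stress_free_base_state ::
    "(real^3) set \<Rightarrow> (real^3 \<Rightarrow> real^3^3) \<Rightarrow> (real^3 \<Rightarrow> real^3^3) \<Rightarrow> bool" where
  "stress_free_base_state \<Omega> \<omega>0 \<alpha> \<longleftrightarrow>
     continuous_on (closure \<Omega>) \<alpha> \<and>
     (\<forall>x\<in>\<Omega>. transpose (\<omega>0 x) = - \<omega>0 x \<and> \<omega>0 differentiable (at x) \<and>
        (\<forall>i r. \<alpha> x $ i $ r =
           (\<Sum>j\<in>UNIV. \<Sum>k\<in>UNIV. perm_symbol r j k * partial j (\<lambda>y. \<omega>0 y $ i $ k) x)))"

definition B_tensor :: "(real^3 \<Rightarrow> real^3^3) \<Rightarrow> tensor4 \<Rightarrow> tensor4" where
  "B_tensor \<alpha> C x i j k l =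
     (\<Sum>s\<in>UNIV. \<Sum>r\<in>UNIV. \<Sum>m\<in>UNIV. \<Sum>n\<in>UNIV. \<Sum>p\<in>UNIV.
        perm_symbol s j r * \<alpha> x $ i $ r * perm_symbol s m n * \<alpha> x $ p $ n * C x p m k l)"

(* symmetrisation in the first and in the second pair of indices *)
definition sym_pairs :: "tensor4 \<Rightarrow> tensor4" where
  "sym_pairs T x i j k l = (T x i j k l + T x j i k l + T x i j l k + T x j i l k) / 4"

definition ddot :: "tensor4 \<Rightarrow> (real^3 \<Rightarrow> real^3^3) \<Rightarrow> real^3 \<Rightarrow> real^3^3" where
  "ddot T \<epsilon> x = (\<chi> i j. \<Sum>k\<in>UNIV. \<Sum>l\<in>UNIV. T x i j k l * \<epsilon> x $ k $ l)"

(* A pair (\<epsilon>, v) of fields is represented by the single field x \<mapsto> (\<epsilon> x, v x). *)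
type_synonym state = "real^3 \<Rightarrow> (real^3^3) \<times> (real^3)"

definition H :: "(real^3) set \<Rightarrow> state set" where
  "H \<Omega> = {U. (\<lambda>x. fst (U x)) \<in> H0 \<Omega> \<and> (\<lambda>x. snd (U x)) \<in> L2 \<Omega>}"

definition inner_H :: "(real^3) set \<Rightarrow> real \<Rightarrow> tensor4 \<Rightarrow> state \<Rightarrow> state \<Rightarrow> real" where
  "inner_H \<Omega> \<rho> C U V =
     (\<integral>x. (\<Sum>i\<in>UNIV. \<Sum>j\<in>UNIV. \<Sum>k\<in>UNIV. \<Sum>l\<in>UNIV.
              C x i j k l * fst (U x) $ k $ l * fst (V x) $ i $ j)
           + (\<Sum>i\<in>UNIV. \<rho> * snd (U x) $ i * snd (V x) $ i) \<partial>lebesgue_on \<Omega>)"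

definition norm_H :: "(real^3) set \<Rightarrow> real \<Rightarrow> tensor4 \<Rightarrow> state \<Rightarrow> real" where
  "norm_H \<Omega> \<rho> C U = sqrt (inner_H \<Omega> \<rho> C U U)"

definition eq_H :: "(real^3) set \<Rightarrow> state \<Rightarrow> state \<Rightarrow> bool" where
  "eq_H \<Omega> U V \<longleftrightarrow> (AE x in lebesgue_on \<Omega>. U x = V x)"

(* The traction condition on the second boundary part is the stated weak (trace) condition, so
   that this boundary part enters only as the complement of \<Gamma>1. *)
definition dom_A :: "(real^3) set \<Rightarrow> (real^3) set \<Rightarrow> tensor4 \<Rightarrow> state set" where
  "dom_A \<Omega> \<Gamma>1 C =
    {U \<in> H \<Omega>. (\<lambda>x. snd (U x)) \<in> H1_hat \<Omega> \<Gamma>1 \<and>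
       (let \<sigma> = ddot C (\<lambda>x. fst (U x)) in
          (\<exists>f\<in>L2 \<Omega>. is_weak_div \<Omega> \<sigma> f) \<and>
          (\<forall>w\<in>H1_hat \<Omega> \<Gamma>1.
             (\<integral>x. (\<Sum>i\<in>UNIV. \<Sum>j\<in>UNIV. weak_grad \<Omega> w x $ i $ j * \<sigma> x $ i $ j)
                   + (\<Sum>i\<in>UNIV. w x $ i * weak_div \<Omega> \<sigma> x $ i) \<partial>lebesgue_on \<Omega>) = 0))}"

definition op_A1 :: "(real^3) set \<Rightarrow> real \<Rightarrow> tensor4 \<Rightarrow> state \<Rightarrow> state" where
  "op_A1 \<Omega> \<rho> C U x =
     ((\<chi> i j. (weak_grad \<Omega> (\<lambda>x. snd (U x)) x $ i $ j + weak_grad \<Omega> (\<lambda>x. snd (U x)) x $ j $ i) / 2),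
      (1 / \<rho>) *\<^sub>R weak_div \<Omega> (ddot C (\<lambda>x. fst (U x))) x)"

definition op_A ::
    "(real^3) set \<Rightarrow> real \<Rightarrow> tensor4 \<Rightarrow> (real^3 \<Rightarrow> real^3^3) \<Rightarrow> state \<Rightarrow> state" where
  "op_A \<Omega> \<rho> C \<alpha> U x =
     ((\<chi> i j. (weak_grad \<Omega> (\<lambda>x. snd (U x)) x $ i $ j + weak_grad \<Omega> (\<lambda>x. snd (U x)) x $ j $ i) / 2)
        - ddot (sym_pairs (B_tensor \<alpha> C)) (\<lambda>x. fst (U x)) x,
      (1 / \<rho>) *\<^sub>R weak_div \<Omega> (ddot C (\<lambda>x. fst (U x))) x)"

definition op_D :: "tensor4 \<Rightarrow> (real^3 \<Rightarrow> real^3^3) \<Rightarrow> state \<Rightarrow> real^3 \<Rightarrow> real^3" where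
  "op_D C \<alpha> U x =
     (\<chi> s. \<Sum>m\<in>UNIV. \<Sum>n\<in>UNIV. \<Sum>p\<in>UNIV. \<Sum>k\<in>UNIV. \<Sum>l\<in>UNIV.
        perm_symbol s m n * \<alpha> x $ p $ n * C x p m k l * fst (U x) $ k $ l)"

(* The first clause says that T acts on classes of almost everywhere equal fields. *)
definition bounded_operator_H ::
    "(real^3) set \<Rightarrow> real \<Rightarrow> tensor4 \<Rightarrow> (state \<Rightarrow> state) \<Rightarrow> bool" where
  "bounded_operator_H \<Omega> \<rho> C T \<longleftrightarrow>
     (\<forall>U\<in>H \<Omega>. \<forall>V\<in>H \<Omega>. eq_H \<Omega> U V \<longrightarrow> eq_H \<Omega> (T U) (T V)) \<and>
     (\<forall>U\<in>H \<Omega>. T U \<in> H \<Omega>) \<and>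
     (\<forall>U\<in>H \<Omega>. \<forall>V\<in>H \<Omega>. \<forall>a b.
        eq_H \<Omega> (T (\<lambda>x. a *\<^sub>R U x + b *\<^sub>R V x)) (\<lambda>x. a *\<^sub>R T U x + b *\<^sub>R T V x)) \<and>
     (\<exists>K. \<forall>U\<in>H \<Omega>. norm_H \<Omega> \<rho> C (T U) \<le> K * norm_H \<Omega> \<rho> C U)"

definition C0_semigroup ::
    "(real^3) set \<Rightarrow> real \<Rightarrow> tensor4 \<Rightarrow> (real \<Rightarrow> state \<Rightarrow> state) \<Rightarrow> bool" where
  "C0_semigroup \<Omega> \<rho> C S \<longleftrightarrow>
     (\<forall>t\<ge>0. bounded_operator_H \<Omega> \<rho> C (S t)) \<and>
     (\<forall>U\<in>H \<Omega>. eq_H \<Omega> (S 0 U) U) \<and>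
     (\<forall>s\<ge>0. \<forall>t\<ge>0. \<forall>U\<in>H \<Omega>. eq_H \<Omega> (S (s + t) U) (S s (S t U))) \<and>
     (\<forall>U\<in>H \<Omega>. ((\<lambda>t. norm_H \<Omega> \<rho> C (\<lambda>x. S t U x - U x)) \<longlongrightarrow> 0) (at_right 0))"

(* The infinitesimal generator of S is A with domain exactly D. *)
definition has_generator ::
    "(real^3) set \<Rightarrow> real \<Rightarrow> tensor4 \<Rightarrow> (real \<Rightarrow> state \<Rightarrow> state) \<Rightarrow>
     (state \<Rightarrow> state) \<Rightarrow> state set \<Rightarrow> bool" where
  "has_generator \<Omega> \<rho> C S A D \<longleftrightarrow>
     D = {U \<in> H \<Omega>. \<exists>F\<in>H \<Omega>.
            ((\<lambda>h. norm_H \<Omega> \<rho> C (\<lambda>x. (1 / h) *\<^sub>R (S h U x - U x) - F x)) \<longlongrightarrow> 0) (at_right 0)} \<and>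
     (\<forall>U\<in>D. A U \<in> H \<Omega> \<and>
        ((\<lambda>h. norm_H \<Omega> \<rho> C (\<lambda>x. (1 / h) *\<^sub>R (S h U x - U x) - A U x)) \<longlongrightarrow> 0) (at_right 0))"

definition contraction_H :: "(real^3) set \<Rightarrow> real \<Rightarrow> tensor4 \<Rightarrow> (state \<Rightarrow> state) \<Rightarrow> bool" where
  "contraction_H \<Omega> \<rho> C T \<longleftrightarrow> (\<forall>U\<in>H \<Omega>. norm_H \<Omega> \<rho> C (T U) \<le> norm_H \<Omega> \<rho> C U)"

definition unitary_H :: "(real^3) set \<Rightarrow> real \<Rightarrow> tensor4 \<Rightarrow> (state \<Rightarrow> state) \<Rightarrow> bool" where
  "unitary_H \<Omega> \<rho> C T \<longleftrightarrow>
     (\<forall>U\<in>H \<Omega>. \<forall>V\<in>H \<Omega>. inner_H \<Omega> \<rho> C (T U) (T V) = inner_H \<Omega> \<rho> C U V) \<and>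
     (\<forall>V\<in>H \<Omega>. \<exists>U\<in>H \<Omega>. eq_H \<Omega> (T U) V)"

(* For bounded T the choice exists by the Riesz theorem, uniquely up to equality a.e. *)
definition adjoint_H ::
    "(real^3) set \<Rightarrow> real \<Rightarrow> tensor4 \<Rightarrow> (state \<Rightarrow> state) \<Rightarrow> state \<Rightarrow> state" where
  "adjoint_H \<Omega> \<rho> C T V =
     (SOME W. W \<in> H \<Omega> \<and> (\<forall>U\<in>H \<Omega>. inner_H \<Omega> \<rho> C (T U) V = inner_H \<Omega> \<rho> C U W))"

definition isometric_subspace ::
    "(real^3) set \<Rightarrow> real \<Rightarrow> tensor4 \<Rightarrow> (real \<Rightarrow> state \<Rightarrow> state) \<Rightarrow> state set" where
  "isometric_subspace \<Omega> \<rho> C S =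
     {U \<in> H \<Omega>. \<forall>t\<ge>0. norm_H \<Omega> \<rho> C (S t U) = norm_H \<Omega> \<rho> C U \<and>
                       norm_H \<Omega> \<rho> C U = norm_H \<Omega> \<rho> C (adjoint_H \<Omega> \<rho> C (S t) U)}"

definition weakly_to_zero_H ::
    "(real^3) set \<Rightarrow> real \<Rightarrow> tensor4 \<Rightarrow> (real \<Rightarrow> state) \<Rightarrow> bool" where
  "weakly_to_zero_H \<Omega> \<rho> C u \<longleftrightarrow>
     (\<forall>V\<in>H \<Omega>. ((\<lambda>t. inner_H \<Omega> \<rho> C (u t) V) \<longlongrightarrow> 0) at_top)"

end

theory Submission
  imports Defs "HOL-Library.Function_Algebras"
begin

text \<open>
  The two generators differ on their common domain by a zeroth order term, \<open>A = A1 - B\<close>. The tensor of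
  the damping \<open>B\<close> is built so that \<open>\<langle>B U, V\<rangle> = \<integral> D U \<bullet> D V\<close> in the energy inner product, where
  \<open>D\<close> is the constraint operator (lemma \<open>inner_H_damping\<close>). So \<open>B\<close> is symmetric and
  \<open>\<langle>B U, U\<rangle> = 0\<close> forces \<open>D U = 0\<close> and then \<open>B U = 0\<close>. The proof combines two facts about
  contraction semigroups on a Hilbert space.

  The first is the decomposition of Foguel (theorem \<open>weakly_to_zero_orthogonal_to_unitary_part\<close>):
  if \<open>w\<close> is orthogonal to the subspace on which all \<open>S t\<close> and all adjoints are isometric, then
  \<open>S t w\<close> tends weakly to zero. Since \<open>t \<mapsto> \<parallel>S t w\<parallel>\<close> decreases to a limit, \<open>S s\<close> is
  asymptotically isometric along the orbit, so \<open>(S s)\<^sup>* (S s) - 1\<close> and \<open>(S s) (S s)\<^sup>* - 1\<close> map the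
  orbit to vectors that tend to zero in norm. Hence the closed subspace of those test vectors \<open>v\<close>
  with \<open>\<langle>S t w, v\<rangle> \<rightarrow> 0\<close> contains the ranges of these self-adjoint operators. A vector orthogonal
  to these ranges lies in the unitary subspace, which is invariant under the adjoints, and therefore
  is itself an admissible test vector; so only zero is orthogonal to the space of test vectors. This
  avoids weak sequential compactness.

  The second (theorem \<open>isometric_part_undamped\<close>) says that on the subspace where \<open>S\<close> is isometric
  the damping is invisible: \<open>B u = 0\<close> and \<open>S t u = S1 t u\<close>. If such a \<open>u\<close> lies in the domain,
  differentiating the constant \<open>\<parallel>S t u\<parallel>\<^sup>2\<close> gives \<open>\<langle>A u, u\<rangle> = 0\<close>; as \<open>A1\<close> is skew this is
  \<open>\<langle>B u, u\<rangle> = 0\<close>. Thus \<open>A = A1\<close> along the orbit of \<open>u\<close>, so \<open>\<langle>S t u, S1 t u\<rangle>\<close> is constant and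
  the two orbits coincide. The time averages \<open>1/h \<integral>\<^bsub>0\<^esub>\<^bsup>h\<^esup> S s u ds\<close> of a vector of the isometric
  subspace stay in that subspace, lie in the domain and converge to \<open>u\<close>, which removes the
  assumption that \<open>u\<close> lies in the domain.

  The statement follows by applying the second fact to \<open>U1\<close> and \<open>S t U1\<close>, and the first to \<open>W0\<close>.

  The elements of the energy space are functions, not classes of functions, so its inner product is
  only positive semidefinite. The abstract part is therefore developed for a complete space with a
  semi-inner product; completeness of the energy space is the Riesz-Fischer theorem.
\<close>

section \<open>Complete spaces with a semi-inner product\<close>

lemma zero_if_quadratic_nonneg:
  fixes b c :: real
  assumes nonneg: "\<And>t. 0 \<le> t\<^sup>2 * c - 2 * t * b" and c: "c \<ge> 0"
  shows "b = 0"
proof (rule ccontr)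
  assume "b \<noteq> 0"
  define u where "u = b / (c + 1)"
  have b: "b = u * (c + 1)" and "u \<noteq> 0"
    using c \<open>b \<noteq> 0\<close> by (auto simp: u_def)
  have "u\<^sup>2 * c - 2 * u * b = - (u\<^sup>2 * (c + 2))"
    unfolding b by (simp add: algebra_simps power2_eq_square)
  also have "\<dots> < 0"
    using c \<open>u \<noteq> 0\<close> by simp
  finally show False
    using nonneg[of u] by simp
qed

text \<open>
  Vectors at distance zero need not be equal. This is how a space of square integrable functions
  presents itself when almost everywhere equal functions are not identified.
\<close>

locale semi_hilbert =
  fixes H :: "'a::real_vector set" and ip :: "'a \<Rightarrow> 'a \<Rightarrow> real"
  assumes subspace_H: "subspace H"
    and ip_commute: "x \<in> H \<Longrightarrow> y \<in> H \<Longrightarrow> ip x y = ip y x"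
    and ip_add_left: "x \<in> H \<Longrightarrow> y \<in> H \<Longrightarrow> z \<in> H \<Longrightarrow> ip (x + y) z = ip x z + ip y z"
    and ip_scale_left: "x \<in> H \<Longrightarrow> z \<in> H \<Longrightarrow> ip (c *\<^sub>R x) z = c * ip x z"
    and ip_ge_zero: "x \<in> H \<Longrightarrow> 0 \<le> ip x x"
    and complete_H: "\<And>X. (\<And>n. X n \<in> H) \<Longrightarrow>
      (\<And>e. e > 0 \<Longrightarrow> \<exists>N. \<forall>m\<ge>N. \<forall>n\<ge>N. ip (X m - X n) (X m - X n) < e) \<Longrightarrow>
      \<exists>L\<in>H. (\<lambda>n. ip (X n - L) (X n - L)) \<longlonglongrightarrow> 0"
begin

definition nrm :: "'a \<Rightarrow> real" where
  "nrm x = sqrt (ip x x)"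

text \<open>
  Equality in the quotient Hilbert space, in the form in which it is used: vectors that have the same
  inner products can be exchanged inside every inner product.
\<close>

definition weq :: "'a \<Rightarrow> 'a \<Rightarrow> bool" (infix "\<simeq>" 50) where
  "x \<simeq> y \<longleftrightarrow> (\<forall>v\<in>H. ip x v = ip y v)"

lemma H_zero [simp]: "0 \<in> H"
  and H_add [simp]: "x \<in> H \<Longrightarrow> y \<in> H \<Longrightarrow> x + y \<in> H"
  and H_diff [simp]: "x \<in> H \<Longrightarrow> y \<in> H \<Longrightarrow> x - y \<in> H"
  and H_scale [simp]: "x \<in> H \<Longrightarrow> c *\<^sub>R x \<in> H"
  using subspace_H by (auto intro: subspace_0 subspace_add subspace_diff subspace_scale)

lemma H_uminus [simp]: "x \<in> H \<Longrightarrow> - x \<in> H"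
  using H_scale[of x "-1"] by simp

lemma ip_diff_left: "x \<in> H \<Longrightarrow> y \<in> H \<Longrightarrow> z \<in> H \<Longrightarrow> ip (x - y) z = ip x z - ip y z"
  using ip_add_left[of x "- 1 *\<^sub>R y" z] ip_scale_left[of y z "-1"] by simp

lemma ip_add_right: "x \<in> H \<Longrightarrow> y \<in> H \<Longrightarrow> z \<in> H \<Longrightarrow> ip z (x + y) = ip z x + ip z y"
  by (simp add: ip_commute[of z] ip_add_left)

lemma ip_diff_right: "x \<in> H \<Longrightarrow> y \<in> H \<Longrightarrow> z \<in> H \<Longrightarrow> ip z (x - y) = ip z x - ip z y"
  by (simp add: ip_commute[of z] ip_diff_left)

lemma ip_scale_right: "x \<in> H \<Longrightarrow> z \<in> H \<Longrightarrow> ip z (c *\<^sub>R x) = c * ip z x"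
  by (simp add: ip_commute[of z] ip_scale_left)

lemmas ip_linear = ip_add_left ip_diff_left ip_scale_left ip_add_right ip_diff_right ip_scale_right

lemma ip_zero_left [simp]: "x \<in> H \<Longrightarrow> ip 0 x = 0"
  and ip_zero_right [simp]: "x \<in> H \<Longrightarrow> ip x 0 = 0"
  using ip_scale_left[of 0 x 0] ip_scale_right[of 0 x 0] by auto

lemma nrm_ge_zero [simp]: "x \<in> H \<Longrightarrow> 0 \<le> nrm x"
  by (simp add: nrm_def ip_ge_zero)

lemma nrm_squared: "x \<in> H \<Longrightarrow> (nrm x)\<^sup>2 = ip x x"
  by (simp add: nrm_def ip_ge_zero)

lemma Cauchy_Schwarz:
  assumes x: "x \<in> H" and y: "y \<in> H"
  shows "\<bar>ip x y\<bar> \<le> nrm x * nrm y"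
proof -
  have quad: "0 \<le> ip x x - 2 * t * ip x y + t\<^sup>2 * ip y y" for t
    using ip_ge_zero[of "x - t *\<^sub>R y"] x y ip_commute[OF x y]
    by (simp add: ip_linear algebra_simps power2_eq_square)
  have "(ip x y)\<^sup>2 \<le> ip x x * ip y y"
  proof (cases "ip y y = 0")
    case True
    have "ip x y = 0"
    proof (rule ccontr)
      assume "ip x y \<noteq> 0"
      then show False
        using quad[of "(ip x x + 1) / (2 * ip x y)"] True by simp
    qed
    then show ?thesis
      using True by simp
  next
    case False
    then have "ip y y > 0"
      using ip_ge_zero[OF y] by simp
    then show ?thesis
      using quad[of "ip x y / ip y y"] by (simp add: field_simps power2_eq_square)
  qed
  then have "sqrt ((ip x y)\<^sup>2) \<le> sqrt (ip x x * ip y y)"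
    by (rule real_sqrt_le_mono)
  then show ?thesis
    by (simp add: nrm_def real_sqrt_mult)
qed

lemma nrm_scale: "x \<in> H \<Longrightarrow> nrm (c *\<^sub>R x) = \<bar>c\<bar> * nrm x"
  by (simp add: nrm_def ip_linear real_sqrt_mult mult.assoc[symmetric])

lemma nrm_triangle:
  assumes "x \<in> H" "y \<in> H"
  shows "nrm (x + y) \<le> nrm x + nrm y"
proof (rule power2_le_imp_le)
  have "(nrm (x + y))\<^sup>2 = (nrm x)\<^sup>2 + 2 * ip x y + (nrm y)\<^sup>2"
    using assms by (simp add: nrm_squared ip_linear ip_commute[of y x])
  also have "\<dots> \<le> (nrm x + nrm y)\<^sup>2"
    using Cauchy_Schwarz[OF assms] by (simp add: power2_sum)
  finally show "(nrm (x + y))\<^sup>2 \<le> (nrm x + nrm y)\<^sup>2" .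
qed (use assms in simp)

lemma nrm_minus_commute: "x \<in> H \<Longrightarrow> y \<in> H \<Longrightarrow> nrm (x - y) = nrm (y - x)"
  using nrm_scale[of "x - y" "-1"] by simp

lemma nrm_triangle_diff:
  assumes "x \<in> H" "y \<in> H" "z \<in> H"
  shows "nrm (x - z) \<le> nrm (x - y) + nrm (y - z)"
  using nrm_triangle[of "x - y" "y - z"] assms by simp

text \<open>
  Norm estimates for vectors that are known only through their inner products, such as time averages
  of an orbit, are obtained by testing with the vector itself.
\<close>

lemma nrm_le_if_weakly_bounded:
  assumes x: "x \<in> H" and bound: "\<And>v. v \<in> H \<Longrightarrow> ip x v \<le> K * nrm v"
    and K: "K \<ge> 0"
  shows "nrm x \<le> K"
proof (cases "nrm x = 0")
  case False
  then have "nrm x > 0"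
    using nrm_ge_zero[OF x] by linarith
  moreover have "nrm x * nrm x \<le> K * nrm x"
    using bound[OF x] nrm_squared[OF x] by (simp add: power2_eq_square)
  ultimately show ?thesis
    by simp
qed (use K in simp)

lemma weq_iff_nrm:
  assumes "x \<in> H" "y \<in> H"
  shows "x \<simeq> y \<longleftrightarrow> nrm (x - y) = 0"
proof
  assume "x \<simeq> y"
  then have "ip (x - y) (x - y) = 0"
    using assms by (simp add: weq_def ip_diff_left)
  then show "nrm (x - y) = 0"
    by (simp add: nrm_def)
next
  assume z: "nrm (x - y) = 0"
  show "x \<simeq> y"
    unfolding weq_def
  proof
    fix v assume "v \<in> H"
    then show "ip x v = ip y v"
      using Cauchy_Schwarz[of "x - y" v] assms z by (simp add: ip_diff_left)
  qed
qed

lemma weqD: "x \<simeq> y \<Longrightarrow> v \<in> H \<Longrightarrow> ip x v = ip y v"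
  by (simp add: weq_def)

lemma weq_refl [simp]: "x \<simeq> x"
  and weq_sym: "x \<simeq> y \<Longrightarrow> y \<simeq> x"
  and weq_trans [trans]: "x \<simeq> y \<Longrightarrow> y \<simeq> z \<Longrightarrow> x \<simeq> z"
  by (auto simp: weq_def)

lemma weqD_right: "x \<simeq> y \<Longrightarrow> x \<in> H \<Longrightarrow> y \<in> H \<Longrightarrow> v \<in> H \<Longrightarrow> ip v x = ip v y"
  by (simp add: weq_def ip_commute[of v])

lemma weq_nrm: "x \<simeq> y \<Longrightarrow> x \<in> H \<Longrightarrow> y \<in> H \<Longrightarrow> nrm x = nrm y"
  unfolding nrm_def using weqD[of x y x] weqD_right[of x y y] by simp

lemma weq_diff:
  "x \<simeq> x' \<Longrightarrow> y \<simeq> y' \<Longrightarrow> x \<in> H \<Longrightarrow> y \<in> H \<Longrightarrow> x' \<in> H \<Longrightarrow> y' \<in> H \<Longrightarrow> x - y \<simeq> x' - y'"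
  by (simp add: weq_def ip_linear)

lemma weq_if_arbitrarily_close:
  assumes "x \<in> H" "y \<in> H" and "\<And>e. e > 0 \<Longrightarrow> nrm (x - y) \<le> e"
  shows "x \<simeq> y"
  using assms weq_iff_nrm field_le_epsilon[of "nrm (x - y)" 0] nrm_ge_zero[of "x - y"]
  by (simp add: order_antisym)

lemma ip_tendsto_left:
  assumes "eventually (\<lambda>t. X t \<in> H) F" "x \<in> H" "v \<in> H"
    and lim: "((\<lambda>t. nrm (X t - x)) \<longlongrightarrow> 0) F"
  shows "((\<lambda>t. ip (X t) v) \<longlongrightarrow> ip x v) F"
proof -
  have "((\<lambda>t. ip (X t) v - ip x v) \<longlongrightarrow> 0) F"
  proof (rule Lim_null_comparison)
    show "\<forall>\<^sub>F t in F. norm (ip (X t) v - ip x v) \<le> nrm (X t - x) * nrm v"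
      using assms(1)
    proof eventually_elim
      case (elim t)
      then show ?case
        using Cauchy_Schwarz[of "X t - x" v] assms(2,3) by (simp add: ip_diff_left)
    qed
    show "((\<lambda>t. nrm (X t - x) * nrm v) \<longlongrightarrow> 0) F"
      using tendsto_mult_right[OF lim, of "nrm v"] by (simp add: mult.commute)
  qed
  then show ?thesis
    by (rule LIM_zero_cancel)
qed


text \<open>
  The projection theorem for a subspace that need not be closed: a minimising sequence \<open>p\<close> for the
  distance from \<open>v\<close> to \<open>P\<close> is Cauchy by the parallelogram law, and minimality makes the remainder
  \<open>r\<close> orthogonal to \<open>P\<close>.
\<close>

lemma orthogonal_remainder:
  assumes P: "subspace P" "P \<subseteq> H" and v: "v \<in> H"
  obtains p r where "\<And>n::nat. p n \<in> P" "r \<in> H" "\<And>y. y \<in> P \<Longrightarrow> ip r y = 0"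
    "(\<lambda>n. nrm (v - r - p n)) \<longlonglongrightarrow> 0"
proof -
  define Q where "Q y = ip (v - y) (v - y)" for y
  define d where "d = (INF y\<in>P. Q y)"
  have PH: "y \<in> P \<Longrightarrow> y \<in> H" for y
    using P by auto
  have bdd: "bdd_below (Q ` P)"
    by (rule bdd_belowI2[of _ 0]) (use PH v in \<open>simp add: Q_def ip_ge_zero\<close>)
  have d_le: "d \<le> Q y" if "y \<in> P" for y
    unfolding d_def by (rule cINF_lower[OF bdd that])
  have "\<exists>y\<in>P. Q y < d + 1 / Suc n" for n
  proof -
    have "Inf (Q ` P) < d + 1 / Suc n"
      by (simp add: d_def)
    then show ?thesis
      using cInf_lessD[of "Q ` P"] subspace_0[OF P(1)] by fastforce
  qed
  then obtain p where p: "\<And>n. p n \<in> P" and pd: "\<And>n. Q (p n) < d + 1 / Suc n"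
    by metis
  have pH [simp]: "p n \<in> H" for n
    using p PH by blast
  \<comment> \<open>Parallelogram law: the midpoint of two near-minimisers lies in \<open>P\<close>, so it cannot be closer than \<open>d\<close>.\<close>
  have cauchy: "ip (p m - p n) (p m - p n) \<le> 2 / Suc m + 2 / Suc n" for m n
  proof -
    have "(1/2) *\<^sub>R (p m + p n) \<in> P"
      using P(1) p by (intro subspace_scale subspace_add)
    then have "d \<le> Q ((1/2) *\<^sub>R (p m + p n))"
      by (rule d_le)
    moreover have "ip (p m - p n) (p m - p n) = 2 * Q (p m) + 2 * Q (p n) - 4 * Q ((1/2) *\<^sub>R (p m + p n))"
      using v by (simp add: Q_def ip_linear ip_commute[of v "p m"] ip_commute[of v "p n"]
          ip_commute[of "p n" "p m"] algebra_simps)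
    ultimately show ?thesis
      using pd[of m] pd[of n] by simp
  qed
  have "\<exists>L\<in>H. (\<lambda>n. ip (p n - L) (p n - L)) \<longlonglongrightarrow> 0"
  proof (rule complete_H)
    fix e :: real assume "e > 0"
    then obtain N where N: "1 / Suc N < e / 4"
      using reals_Archimedean[of "e/4"] by (auto simp: inverse_eq_divide)
    show "\<exists>N. \<forall>m\<ge>N. \<forall>n\<ge>N. ip (p m - p n) (p m - p n) < e"
    proof (intro exI[of _ N] allI impI)
      fix m n assume "m \<ge> N" "n \<ge> N"
      then have "1 / Suc m \<le> 1 / Suc N" "1 / Suc n \<le> 1 / Suc N"
        by (auto simp: field_simps)
      then show "ip (p m - p n) (p m - p n) < e"
        using cauchy[of m n] N by simp
    qed
  qed simp
  then obtain L where L: "L \<in> H" and lim: "(\<lambda>n. ip (p n - L) (p n - L)) \<longlonglongrightarrow> 0"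
    by blast
  have lim': "(\<lambda>n. nrm (p n - L)) \<longlonglongrightarrow> 0"
    using tendsto_real_sqrt[OF lim] by (simp add: nrm_def)
  show thesis
  proof (rule that[of p "v - L"])
    show "ip (v - L) y = 0" if y: "y \<in> P" for y
    proof (rule zero_if_quadratic_nonneg)
      have yH [simp]: "y \<in> H"
        using y PH by blast
      fix t :: real
      have lim_ip: "(\<lambda>n. ip (p n) y) \<longlonglongrightarrow> ip L y"
        by (rule ip_tendsto_left) (use L lim' in auto)
      \<comment> \<open>Compare the near-minimiser with its perturbation by \<open>t y\<close> and let \<open>n\<close> tend to infinity.\<close>
      have le: "d \<le> d + 1 / Suc n - 2 * t * (ip v y - ip (p n) y) + t\<^sup>2 * ip y y" for n
      proof -
        have "p n + t *\<^sub>R y \<in> P"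
          using P(1) p y by (intro subspace_scale subspace_add)
        then have "d \<le> Q (p n + t *\<^sub>R y)"
          by (rule d_le)
        also have "\<dots> = Q (p n) - 2 * t * (ip v y - ip (p n) y) + t\<^sup>2 * ip y y"
          using v by (simp add: Q_def ip_linear ip_commute[of v "p n"] ip_commute[of y "p n"] ip_commute[of y v] power2_eq_square algebra_simps)
        finally show ?thesis
          using pd[of n] by simp
      qed
      have "d \<le> d + 0 - 2 * t * (ip v y - ip L y) + t\<^sup>2 * ip y y"
      proof (rule Lim_bounded2)
        show "(\<lambda>n. d + 1 / Suc n - 2 * t * (ip v y - ip (p n) y) + t\<^sup>2 * ip y y)
            \<longlonglongrightarrow> d + 0 - 2 * t * (ip v y - ip L y) + t\<^sup>2 * ip y y"
          by (intro tendsto_intros lim_ip LIMSEQ_Suc[OF lim_1_over_n])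
      qed (use le in auto)
      then show "0 \<le> t\<^sup>2 * ip y y - 2 * t * ip (v - L) y"
        using v L by (simp add: ip_diff_left)
      show "ip y y \<ge> 0"
        by (rule ip_ge_zero) simp
    qed
    show "(\<lambda>n. nrm (v - (v - L) - p n)) \<longlonglongrightarrow> 0"
      using lim' L by (simp add: nrm_minus_commute)
  qed (use p v L in auto)
qed

text \<open>
  A vector outside the kernel of \<open>f\<close> has a remainder \<open>r\<close> orthogonal to the kernel, on which \<open>f\<close>
  takes the same value by boundedness; a multiple of \<open>r\<close> represents \<open>f\<close>.
\<close>

theorem Riesz_representation:
  assumes add: "\<And>x y. x \<in> H \<Longrightarrow> y \<in> H \<Longrightarrow> f (x + y) = f x + f y"
    and scale: "\<And>c x. x \<in> H \<Longrightarrow> f (c *\<^sub>R x) = c * f x"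
    and bound: "\<And>x. x \<in> H \<Longrightarrow> \<bar>f x\<bar> \<le> K * nrm x"
  obtains w where "w \<in> H" "\<And>x. x \<in> H \<Longrightarrow> ip w x = f x"
proof (cases "\<forall>x\<in>H. f x = 0")
  case True
  then show ?thesis
    using that[of 0] by simp
next
  case False
  then obtain v where v: "v \<in> H" "f v \<noteq> 0"
    by blast
  define P where "P = {x \<in> H. f x = 0}"
  have f0: "f 0 = 0"
    using scale[of 0 0] by simp
  have P: "subspace P" "P \<subseteq> H"
    by (auto simp: P_def subspace_def add scale f0)
  have diff: "f (x - y) = f x - f y" if "x \<in> H" "y \<in> H" for x y
    using add[of x "-1 *\<^sub>R y"] scale[of y "-1"] that by simp
  obtain p r where p: "\<And>n::nat. p n \<in> P" and r: "r \<in> H" and orth: "\<And>y. y \<in> P \<Longrightarrow> ip r y = 0"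
    and lim: "(\<lambda>n. nrm (v - r - p n)) \<longlonglongrightarrow> 0"
    using orthogonal_remainder[OF P v(1)] by metis
  have "\<bar>f v - f r\<bar> \<le> K * nrm (v - r - p n)" for n
    using bound[of "v - r - p n"] p[of n] v r by (simp add: diff P_def)
  then have "\<bar>f v - f r\<bar> \<le> K * 0"
    by (intro Lim_bounded2[OF tendsto_mult_left[OF lim], of 0]) auto
  then have fr: "f r \<noteq> 0"
    using v(2) by simp
  then have "nrm r \<noteq> 0"
    using bound[OF r] by auto
  then have rr: "ip r r \<noteq> 0"
    using nrm_squared[OF r] by auto
  show ?thesis
  proof (rule that[of "(f r / ip r r) *\<^sub>R r"])
    fix x assume x: "x \<in> H"
    have "f r *\<^sub>R x - f x *\<^sub>R r \<in> P"
      using x r by (simp add: P_def diff scale)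
    from orth[OF this] have "f r * ip r x = f x * ip r r"
      using x r by (simp add: ip_linear)
    then show "ip ((f r / ip r r) *\<^sub>R r) x = f x"
      using x r rr by (simp add: ip_linear field_simps)
  qed (use r in simp)
qed

section \<open>Contractions and their adjoints\<close>

text \<open>
  Linearity is required only up to vectors of norm zero, which is all that an operator on
  representatives can satisfy.
\<close>

definition contraction :: "('a \<Rightarrow> 'a) \<Rightarrow> bool" where
  "contraction T \<longleftrightarrow> (\<forall>x\<in>H. T x \<in> H \<and> nrm (T x) \<le> nrm x) \<and>
    (\<forall>x\<in>H. \<forall>y\<in>H. \<forall>a b. T (a *\<^sub>R x + b *\<^sub>R y) \<simeq> a *\<^sub>R T x + b *\<^sub>R T y)"

definition is_adjoint :: "('a \<Rightarrow> 'a) \<Rightarrow> ('a \<Rightarrow> 'a) \<Rightarrow> bool" where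
  "is_adjoint T T' \<longleftrightarrow> (\<forall>x\<in>H. T' x \<in> H \<and> (\<forall>u\<in>H. ip (T u) x = ip u (T' x)))"

lemma contraction_in_H: "contraction T \<Longrightarrow> x \<in> H \<Longrightarrow> T x \<in> H"
  and contraction_nrm: "contraction T \<Longrightarrow> x \<in> H \<Longrightarrow> nrm (T x) \<le> nrm x"
  by (auto simp: contraction_def)

lemma contraction_diff:
  assumes "contraction T" "x \<in> H" "y \<in> H"
  shows "T (x - y) \<simeq> T x - T y"
proof -
  have "T (1 *\<^sub>R x + (- 1) *\<^sub>R y) \<simeq> 1 *\<^sub>R T x + (- 1) *\<^sub>R T y"
    using assms unfolding contraction_def by blast
  then show ?thesis
    by simp
qed

lemma contraction_scale:
  assumes "contraction T" "x \<in> H"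
  shows "T (c *\<^sub>R x) \<simeq> c *\<^sub>R T x"
proof -
  have "T (c *\<^sub>R x + 0 *\<^sub>R x) \<simeq> c *\<^sub>R T x + 0 *\<^sub>R T x"
    using assms unfolding contraction_def by blast
  then show ?thesis
    by simp
qed

lemma contraction_add:
  assumes "contraction T" "x \<in> H" "y \<in> H"
  shows "T (x + y) \<simeq> T x + T y"
proof -
  have "T (1 *\<^sub>R x + 1 *\<^sub>R y) \<simeq> 1 *\<^sub>R T x + 1 *\<^sub>R T y"
    using assms unfolding contraction_def by blast
  then show ?thesis
    by simp
qed

lemma contraction_dist:
  assumes "contraction T" "x \<in> H" "y \<in> H"
  shows "nrm (T x - T y) \<le> nrm (x - y)"
proof -
  have "nrm (T x - T y) = nrm (T (x - y))"
    using weq_nrm[OF contraction_diff[OF assms]] assms by (simp add: contraction_in_H)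
  then show ?thesis
    using assms by (simp add: contraction_nrm)
qed

lemma contraction_cong:
  assumes "contraction T" "x \<in> H" "y \<in> H" "x \<simeq> y"
  shows "T x \<simeq> T y"
  using contraction_dist[OF assms(1-3)] assms nrm_ge_zero[of "T x - T y"]
  by (simp add: weq_iff_nrm contraction_in_H order_antisym)

lemma adjoint_in_H: "is_adjoint T T' \<Longrightarrow> x \<in> H \<Longrightarrow> T' x \<in> H"
  and adjoint_ip: "is_adjoint T T' \<Longrightarrow> x \<in> H \<Longrightarrow> u \<in> H \<Longrightarrow> ip (T u) x = ip u (T' x)"
  by (auto simp: is_adjoint_def)

lemma adjoint_exists:
  assumes T: "contraction T" and x: "x \<in> H"
  shows "\<exists>w\<in>H. \<forall>u\<in>H. ip (T u) x = ip u w"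
proof -
  obtain w where w: "w \<in> H" "\<And>u. u \<in> H \<Longrightarrow> ip w u = ip (T u) x"
  proof (rule Riesz_representation[of "\<lambda>u. ip (T u) x" "nrm x"])
    show "ip (T (u + v)) x = ip (T u) x + ip (T v) x" if "u \<in> H" "v \<in> H" for u v
      using weqD[OF contraction_add[OF T that] x] that T x by (simp add: ip_linear contraction_in_H)
    show "ip (T (c *\<^sub>R u)) x = c * ip (T u) x" if "u \<in> H" for c u
      using weqD[OF contraction_scale[OF T that] x] that T x by (simp add: ip_linear contraction_in_H)
    show "\<bar>ip (T u) x\<bar> \<le> nrm x * nrm u" if "u \<in> H" for u
    proof -
      have "\<bar>ip (T u) x\<bar> \<le> nrm (T u) * nrm x"
        using that x T by (intro Cauchy_Schwarz) (auto simp: contraction_in_H)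
      also have "\<dots> \<le> nrm u * nrm x"
        using that x T by (intro mult_right_mono) (auto simp: contraction_nrm)
      finally show ?thesis
        by (simp add: mult.commute)
    qed
  qed blast
  then show ?thesis
    using ip_commute by (metis)
qed

lemma contraction_adjoint:
  assumes T: "contraction T" and adj: "is_adjoint T T'"
  shows "contraction T'"
  unfolding contraction_def
proof (intro conjI ballI allI)
  fix x assume x: "x \<in> H"
  then show T'x: "T' x \<in> H"
    using adj by (rule adjoint_in_H[rotated])
  show "nrm (T' x) \<le> nrm x"
  proof (rule nrm_le_if_weakly_bounded[OF T'x])
    fix v assume v: "v \<in> H"
    have "ip (T' x) v = ip (T v) x"
      using adjoint_ip[OF adj x v] ip_commute[OF T'x v] by simp
    also have "\<dots> \<le> nrm (T v) * nrm x"
      using Cauchy_Schwarz[of "T v" x] x v T by (simp add: contraction_in_H)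
    also have "\<dots> \<le> nrm v * nrm x"
      using v x T by (intro mult_right_mono) (auto simp: contraction_nrm)
    finally show "ip (T' x) v \<le> nrm x * nrm v"
      by (simp add: mult.commute)
  qed (use x in simp)
next
  fix x y a b assume xy: "x \<in> H" "y \<in> H"
  have H': "T' x \<in> H" "T' y \<in> H" "T' (a *\<^sub>R x + b *\<^sub>R y) \<in> H"
    using xy adj by (auto intro: adjoint_in_H)
  show "T' (a *\<^sub>R x + b *\<^sub>R y) \<simeq> a *\<^sub>R T' x + b *\<^sub>R T' y"
    unfolding weq_def
  proof
    fix v assume v: "v \<in> H"
    then show "ip (T' (a *\<^sub>R x + b *\<^sub>R y)) v = ip (a *\<^sub>R T' x + b *\<^sub>R T' y) v"
      using xy H' T v
      by (simp add: ip_commute[where y = v] ip_linear contraction_in_H flip: adjoint_ip[OF adj])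

  qed
qed

lemma is_adjoint_sym:
  assumes "contraction T" "is_adjoint T T'"
  shows "is_adjoint T' T"
  using assms by (simp add: is_adjoint_def contraction_in_H ip_commute)

text \<open>
  Expand the square and use that the adjoint is a contraction as well. The estimate is quantitative
  because it is applied along an orbit that is isometric only in the limit.
\<close>

lemma isometry_defect:
  assumes T: "contraction T" and adj: "is_adjoint T T'" and x: "x \<in> H"
  shows "(nrm (T' (T x) - x))\<^sup>2 \<le> (nrm x)\<^sup>2 - (nrm (T x))\<^sup>2"
proof -
  have H': "T x \<in> H" "T' (T x) \<in> H"
    using assms by (auto intro: contraction_in_H adjoint_in_H)
  have "(nrm (T' (T x) - x))\<^sup>2 = (nrm (T' (T x)))\<^sup>2 - 2 * ip x (T' (T x)) + (nrm x)\<^sup>2"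
    using H' x by (simp add: nrm_squared ip_linear ip_commute[of "T' (T x)" x])
  also have "ip x (T' (T x)) = (nrm (T x))\<^sup>2"
    using adjoint_ip[OF adj H'(1) x] H' by (simp add: nrm_squared)
  also have "(nrm (T' (T x)))\<^sup>2 \<le> (nrm (T x))\<^sup>2"
    using contraction_nrm[OF contraction_adjoint[OF T adj] H'(1)] H' by (intro power_mono) auto
  finally show ?thesis
    by simp
qed

lemma isometric_iff:
  assumes T: "contraction T" and adj: "is_adjoint T T'" and x: "x \<in> H"
  shows "nrm (T x) = nrm x \<longleftrightarrow> T' (T x) \<simeq> x"
proof
  have H': "T x \<in> H" "T' (T x) \<in> H"
    using assms by (auto intro: contraction_in_H adjoint_in_H)
  {
    assume "nrm (T x) = nrm x"
    then show "T' (T x) \<simeq> x"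
      using isometry_defect[OF assms] H' x by (simp add: weq_iff_nrm)
  next
    assume "T' (T x) \<simeq> x"
    then have "ip x x = ip (T' (T x)) x"
      using x by (simp add: weqD)
    also have "\<dots> = ip (T x) (T x)"
      using adjoint_ip[OF adj H'(1) x] ip_commute[OF H'(2) x] by simp
    finally show "nrm (T x) = nrm x"
      by (simp add: nrm_def)
  }
qed

end

section \<open>Semigroups of contractions\<close>

text \<open>
  Only right derivatives are at hand when a generator is defined by difference quotients with
  positive increments. For each \<open>e > 0\<close>, the last point up to which \<open>\<bar>f t - f a\<bar> \<le> e (t - a)\<close> holds
  must be \<open>b\<close>, since the right derivative would carry the estimate beyond any earlier point.
\<close>

lemma constant_if_right_derivative_zero:
  fixes f :: "real \<Rightarrow> real"
  assumes ab: "a \<le> b" and cont: "continuous_on {a..b} f"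
    and deriv: "\<And>t. a \<le> t \<Longrightarrow> t < b \<Longrightarrow> ((\<lambda>h. (f (t + h) - f t) / h) \<longlongrightarrow> 0) (at_right 0)"
  shows "f b = f a"
proof -
  have "\<bar>f b - f a\<bar> \<le> e * (b - a)" if e: "e > 0" for e
  proof (rule ccontr)
    define g where "g t = \<bar>f t - f a\<bar> - e * (t - a)" for t
    assume "\<not> ?thesis"
    then have gb: "g b > 0"
      by (simp add: g_def)
    define W where "W = {t \<in> {a..b}. g t \<le> 0}"
    have "continuous_on {a..b} g"
      unfolding g_def by (intro continuous_intros cont)
    then have "closed W"
      using continuous_closed_preimage[of "{a..b}" g "{..0}"]
      by (simp add: W_def vimage_def Int_def)
    moreover have "a \<in> W" "bdd_above W"
      using ab by (auto simp: W_def g_def intro: bdd_aboveI[of _ b])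
    ultimately have SW: "Sup W \<in> W"
      by (intro closed_contains_Sup) auto
    define c where "c = Sup W"
    have c: "a \<le> c" "c < b" "g c \<le> 0"
      using SW gb by (auto simp: W_def c_def less_le)
    have "\<forall>\<^sub>F h in at_right 0. \<bar>(f (c + h) - f c) / h\<bar> < e"
      using tendstoD[OF deriv[OF c(1,2)] e] by simp
    moreover have "\<forall>\<^sub>F h in at_right 0. h < b - c \<and> (0::real) < h"
      using c by (auto simp: eventually_at_right_less intro!: eventually_conj eventually_at_right_real[THEN eventually_mono])
    ultimately have "\<forall>\<^sub>F h in at_right 0. \<bar>(f (c + h) - f c) / h\<bar> < e \<and> h < b - c \<and> 0 < h"
      by eventually_elim auto
    then obtain h where h: "\<bar>(f (c + h) - f c) / h\<bar> < e" "h < b - c" "0 < h"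
      using eventually_happens'[OF trivial_limit_at_right_real] by blast
    then have "\<bar>f (c + h) - f c\<bar> \<le> e * h"
      by (simp add: abs_divide field_simps)
    then have "g (c + h) \<le> 0"
      using c(3) by (simp add: g_def algebra_simps)
    then have "c + h \<in> W"
      using c h by (simp add: W_def)
    then have "c + h \<le> c"
      unfolding c_def by (rule cSup_upper) fact
    then show False
      using h by simp
  qed
  then have "\<bar>f b - f a\<bar> \<le> 0"
  proof -
    have "((\<lambda>e. e * (b - a)) \<longlongrightarrow> 0 * (b - a)) (at_right (0::real))"
      by (intro tendsto_intros)
    then show ?thesis
      by (intro tendsto_lowerbound[where F = "at_right (0::real)"])
        (use \<open>\<And>e. e > 0 \<Longrightarrow> \<bar>f b - f a\<bar> \<le> e * (b - a)\<close> in \<open>auto simp: eventually_at_right_less eventually_at_filter\<close>)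
  qed
  then show ?thesis
    by simp
qed

context semi_hilbert
begin

lemma ip_tendsto:
  assumes X: "eventually (\<lambda>t. X t \<in> H) F" "x \<in> H" "((\<lambda>t. nrm (X t - x)) \<longlongrightarrow> 0) F"
    and Y: "eventually (\<lambda>t. Y t \<in> H) F" "y \<in> H" "((\<lambda>t. nrm (Y t - y)) \<longlongrightarrow> 0) F"
  shows "((\<lambda>t. ip (X t) (Y t)) \<longlongrightarrow> ip x y) F"
proof -
  have "((\<lambda>t. ip (X t) (Y t) - ip x y) \<longlongrightarrow> 0) F"
  proof (rule Lim_null_comparison)
    show "\<forall>\<^sub>F t in F. norm (ip (X t) (Y t) - ip x y) \<le>
        nrm (X t - x) * nrm (Y t - y) + nrm (X t - x) * nrm y + nrm x * nrm (Y t - y)"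
      using X(1) Y(1)
    proof eventually_elim
      case (elim t)
      then have "ip (X t) (Y t) - ip x y = ip (X t - x) (Y t - y) + ip (X t - x) y + ip x (Y t - y)"
        using X(2) Y(2) by (simp add: ip_linear)
      then show ?case
        using Cauchy_Schwarz[of "X t - x" "Y t - y"] Cauchy_Schwarz[of "X t - x" y]
          Cauchy_Schwarz[of x "Y t - y"] X(2) Y(2) elim by simp
    qed
    show "((\<lambda>t. nrm (X t - x) * nrm (Y t - y) + nrm (X t - x) * nrm y + nrm x * nrm (Y t - y)) \<longlongrightarrow> 0) F"
      using X(3) Y(3) by (auto intro!: tendsto_eq_intros)
  qed
  then show ?thesis
    by (rule LIM_zero_cancel)
qed

end

locale contraction_semigroup = semi_hilbert +
  fixes S :: "real \<Rightarrow> 'a \<Rightarrow> 'a"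
  assumes contraction_S: "t \<ge> 0 \<Longrightarrow> contraction (S t)"
    and S_zero: "x \<in> H \<Longrightarrow> S 0 x \<simeq> x"
    and S_add: "s \<ge> 0 \<Longrightarrow> t \<ge> 0 \<Longrightarrow> x \<in> H \<Longrightarrow> S (s + t) x \<simeq> S s (S t x)"
    and S_continuous: "x \<in> H \<Longrightarrow> ((\<lambda>t. nrm (S t x - x)) \<longlongrightarrow> 0) (at_right 0)"
begin

text \<open>
  The adjoint of \<open>S t\<close>, chosen vector by vector; it is determined up to vectors of norm zero.
\<close>

definition Sa :: "real \<Rightarrow> 'a \<Rightarrow> 'a" where
  "Sa t x = (SOME w. w \<in> H \<and> (\<forall>u\<in>H. ip (S t u) x = ip u w))"

text \<open>
  Two subspaces have to be distinguished: on the first only the semigroup is isometric, on the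
  second also its adjoint. The first suffices to identify \<open>S\<close> with the undamped semigroup, the
  second is what weak convergence requires.
\<close>

definition isometric_part :: "'a set" where
  "isometric_part = {u \<in> H. \<forall>t\<ge>0. nrm (S t u) = nrm u}"

definition unitary_part :: "'a set" where
  "unitary_part = {u \<in> H. \<forall>t\<ge>0. nrm (S t u) = nrm u \<and> nrm u = nrm (Sa t u)}"

lemma adjoint_Sa: "t \<ge> 0 \<Longrightarrow> is_adjoint (S t) (Sa t)"
  unfolding is_adjoint_def Sa_def
  using someI_ex[OF adjoint_exists[OF contraction_S, unfolded Bex_def]] by blast

lemma contraction_Sa: "t \<ge> 0 \<Longrightarrow> contraction (Sa t)"
  using contraction_adjoint contraction_S adjoint_Sa by blast

lemma S_in_H [simp]: "t \<ge> 0 \<Longrightarrow> x \<in> H \<Longrightarrow> S t x \<in> H"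
  and Sa_in_H [simp]: "t \<ge> 0 \<Longrightarrow> x \<in> H \<Longrightarrow> Sa t x \<in> H"
  by (auto intro: contraction_in_H contraction_S contraction_Sa)

lemma ip_S: "t \<ge> 0 \<Longrightarrow> x \<in> H \<Longrightarrow> y \<in> H \<Longrightarrow> ip (S t x) y = ip x (Sa t y)"
  by (rule adjoint_ip[OF adjoint_Sa])

lemma ip_Sa: "t \<ge> 0 \<Longrightarrow> x \<in> H \<Longrightarrow> y \<in> H \<Longrightarrow> ip (Sa t x) y = ip x (S t y)"
  by (simp add: ip_S ip_commute[of _ "S t y"] ip_commute[of _ y])

lemma Sa_add:
  assumes "s \<ge> 0" "t \<ge> 0" "x \<in> H"
  shows "Sa (s + t) x \<simeq> Sa t (Sa s x)"
  unfolding weq_def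
proof
  fix v assume v: "v \<in> H"
  then show "ip (Sa (s + t) x) v = ip (Sa t (Sa s x)) v"
    using assms weqD_right[OF S_add[of s t v], of x] by (simp add: ip_Sa)
qed

lemma nrm_S_add:
  assumes "s \<ge> 0" "t \<ge> 0" "x \<in> H"
  shows "nrm (S (s + t) x) = nrm (S s (S t x))"
  using weq_nrm[OF S_add] assms by simp

lemma nrm_Sa_add:
  assumes "s \<ge> 0" "t \<ge> 0" "x \<in> H"
  shows "nrm (Sa (s + t) x) = nrm (Sa t (Sa s x))"
  using weq_nrm[OF Sa_add] assms by simp

lemma nrm_S_antimono:
  assumes "0 \<le> s" "s \<le> t" "x \<in> H"
  shows "nrm (S t x) \<le> nrm (S s x)"
  using nrm_S_add[of "t - s" s x] contraction_nrm[OF contraction_S, of "t - s" "S s x"] assms by simp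

section \<open>Weak convergence to zero away from the unitary part\<close>

text \<open>
  The norms along the orbit decrease to a limit, so the loss over a time span of fixed length \<open>s\<close>
  vanishes.
\<close>

lemma norm_loss_tendsto_zero:
  assumes s: "s \<ge> 0" and x: "x \<in> H"
  shows "((\<lambda>t. (nrm (S t x))\<^sup>2 - (nrm (S (s + t) x))\<^sup>2) \<longlongrightarrow> 0) at_top"
proof (rule tendstoI)
  fix e :: real assume e: "e > 0"
  define E where "E t = (nrm (S t x))\<^sup>2" for t
  have anti: "E t' \<le> E t" if "0 \<le> t" "t \<le> t'" for t t'
    unfolding E_def using that x by (intro power_mono nrm_S_antimono) auto
  have bdd: "bdd_below (E ` {0..})"
    by (rule bdd_belowI2[of _ 0]) (simp add: E_def)
  obtain t0 where t0: "t0 \<ge> 0" "E t0 < (INF t\<in>{0..}. E t) + e"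
    using cInf_lessD[of "E ` {0..}" "(INF t\<in>{0..}. E t) + e"] e by auto
  show "\<forall>\<^sub>F t in at_top. dist ((nrm (S t x))\<^sup>2 - (nrm (S (s + t) x))\<^sup>2) 0 < e"
    using eventually_ge_at_top[of t0]
  proof eventually_elim
    case (elim t)
    have "(INF t\<in>{0..}. E t) \<le> E (s + t)"
      using s t0 elim by (intro cINF_lower bdd) auto
    moreover have "E t \<le> E t0" "E (s + t) \<le> E t"
      using anti s t0 elim by auto
    ultimately show ?case
      using t0 by (simp add: E_def dist_real_def)
  qed
qed

lemma adjoint_after_S_tendsto:
  assumes s: "s \<ge> 0" and x: "x \<in> H"
  shows "((\<lambda>t. nrm (Sa s (S s (S t x)) - S t x)) \<longlongrightarrow> 0) at_top"
proof -
  have "((\<lambda>t. (nrm (Sa s (S s (S t x)) - S t x))\<^sup>2) \<longlongrightarrow> 0) at_top"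
  proof (rule Lim_null_comparison[OF _ norm_loss_tendsto_zero[OF assms]])
    show "\<forall>\<^sub>F t in at_top. norm ((nrm (Sa s (S s (S t x)) - S t x))\<^sup>2) \<le>
        (nrm (S t x))\<^sup>2 - (nrm (S (s + t) x))\<^sup>2"
      using eventually_ge_at_top[of 0]
      by eventually_elim
        (use s x isometry_defect[OF contraction_S adjoint_Sa] nrm_S_add in \<open>simp\<close>)
  qed
  from tendsto_real_sqrt[OF this] show ?thesis
    by (simp add: tendsto_rabs_zero_iff)
qed

text \<open>
  With \<open>y = S (t - s) x\<close> the vector in question is the image of \<open>(S s)\<^sup>* (S s) y - y\<close> under the
  contraction \<open>S s\<close>, so the previous lemma applies at time \<open>t - s\<close>.
\<close>

lemma S_after_adjoint_tendsto:
  assumes s: "s \<ge> 0" and x: "x \<in> H"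
  shows "((\<lambda>t. nrm (S s (Sa s (S t x)) - S t x)) \<longlongrightarrow> 0) at_top"
proof (rule Lim_null_comparison)
  have "filterlim (\<lambda>t. t - s) at_top at_top"
    using filterlim_tendsto_add_at_top[OF tendsto_const[of "- s"] filterlim_ident] by simp
  from filterlim_compose[OF adjoint_after_S_tendsto[OF assms] this]
  show "((\<lambda>t. nrm (Sa s (S s (S (t - s) x)) - S (t - s) x)) \<longlongrightarrow> 0) at_top" .
  show "\<forall>\<^sub>F t in at_top. norm (nrm (S s (Sa s (S t x)) - S t x)) \<le>
      nrm (Sa s (S s (S (t - s) x)) - S (t - s) x)"
    using eventually_ge_at_top[of s]
  proof eventually_elim
    case (elim t)
    define y where "y = S (t - s) x"
    have y: "y \<in> H" "S t x \<simeq> S s y"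
      using S_add[of s "t - s" x] elim s x by (auto simp: y_def)
    have "S s (Sa s (S t x)) \<simeq> S s (Sa s (S s y))"
      using y s x elim by (intro contraction_cong[OF contraction_S] contraction_cong[OF contraction_Sa]) auto
    then have "nrm (S s (Sa s (S t x)) - S t x) = nrm (S s (Sa s (S s y)) - S s y)"
      using y s x elim by (intro weq_nrm weq_diff) auto
    also have "\<dots> \<le> nrm (Sa s (S s y) - y)"
      using y s by (intro contraction_dist contraction_S) auto
    finally show ?case
      using y s x elim by (simp flip: y_def)
  qed
qed

lemma unitary_partD:
  assumes "u \<in> unitary_part"
  shows "u \<in> H" "t \<ge> 0 \<Longrightarrow> S t (Sa t u) \<simeq> u"
proof -
  show u: "u \<in> H"
    using assms by (simp add: unitary_part_def)
  show "S t (Sa t u) \<simeq> u" if t: "t \<ge> 0"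
    using isometric_iff[OF contraction_Sa[OF t] is_adjoint_sym[OF contraction_S[OF t] adjoint_Sa[OF t]] u]
      assms t by (simp add: unitary_part_def)
qed

lemma unitary_partI:
  assumes u: "u \<in> H" and "\<And>t. t \<ge> 0 \<Longrightarrow> Sa t (S t u) \<simeq> u" "\<And>t. t \<ge> 0 \<Longrightarrow> S t (Sa t u) \<simeq> u"
  shows "u \<in> unitary_part"
  using assms isometric_iff[OF contraction_S adjoint_Sa u]
    isometric_iff[OF contraction_Sa is_adjoint_sym[OF contraction_S adjoint_Sa] u]
  by (simp add: unitary_part_def)

text \<open>
  The isometry of \<open>S s\<close> on \<open>(S t)\<^sup>* r\<close> comes from cancelling \<open>S\<close> against its adjoint: if \<open>s \<le> t\<close>,
  write \<open>(S t)\<^sup>* r = (S s)\<^sup>* y\<close> and cancel \<open>S s (S s)\<^sup>*\<close>; if \<open>s > t\<close>, cancel \<open>S t (S t)\<^sup>*\<close> and let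
  the rest \<open>S (s - t)\<close> act on \<open>r\<close>.
\<close>

lemma unitary_part_Sa:
  assumes r: "r \<in> unitary_part" and t: "t \<ge> 0"
  shows "Sa t r \<in> unitary_part"
proof -
  have rH [simp]: "r \<in> H"
    using r by (simp add: unitary_part_def)
  have nSa: "nrm (Sa s r) = nrm r" if "s \<ge> 0" for s
    using r that by (simp add: unitary_part_def)
  have "nrm (S s (Sa t r)) = nrm r" if s: "s \<ge> 0" for s
  proof (cases "s \<le> t")
    case True
    define y where "y = Sa (t - s) r"
    have y: "y \<in> H" "Sa t r \<simeq> Sa s y" "nrm y = nrm r"
      using Sa_add[of "t - s" s r] True s by (auto simp: y_def nSa)
    have "nrm (Sa s y) = nrm y"
      using weq_nrm[OF y(2)] y s t by (simp add: nSa)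
    then have "S s (Sa s y) \<simeq> y"
      using isometric_iff[OF contraction_Sa is_adjoint_sym[OF contraction_S adjoint_Sa] y(1)] s by simp
    moreover have "S s (Sa t r) \<simeq> S s (Sa s y)"
      using y s t by (intro contraction_cong[OF contraction_S]) auto
    ultimately have "S s (Sa t r) \<simeq> y"
      by (rule weq_trans[rotated])
    from weq_nrm[OF this] show ?thesis
      using y s t by simp
  next
    case False
    have "S s (Sa t r) \<simeq> S (s - t) (S t (Sa t r))"
      using S_add[of "s - t" t "Sa t r"] False t by simp
    also have "\<dots> \<simeq> S (s - t) r"
      using unitary_partD(2)[OF r t] False t by (intro contraction_cong[OF contraction_S]) auto
    finally have "nrm (S s (Sa t r)) = nrm (S (s - t) r)"
      by (rule weq_nrm) (use False t s in auto)
    then show ?thesis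
      using r False by (simp add: unitary_part_def)
  qed
  moreover have "nrm (Sa s (Sa t r)) = nrm r" if s: "s \<ge> 0" for s
    using nrm_Sa_add[OF t s rH] nSa[of "t + s"] s t by simp
  ultimately show ?thesis
    using t by (simp add: unitary_part_def nSa)
qed

text \<open>
  Let \<open>P\<close> be the space of test vectors \<open>v\<close> with \<open>\<langle>S t w, v\<rangle> \<rightarrow> 0\<close>. The remainder \<open>r\<close> of a vector
  with respect to \<open>P\<close> is orthogonal to the ranges of \<open>(S s)\<^sup>* (S s) - 1\<close> and \<open>(S s) (S s)\<^sup>* - 1\<close>, hence
  unitary, hence itself in \<open>P\<close> by the orthogonality of \<open>w\<close>; so it is null and \<open>P\<close> is dense. As the
  orbit is bounded, \<open>P\<close> is everything.
\<close>

theorem weakly_to_zero_orthogonal_to_unitary_part: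
  assumes w: "w \<in> H" and orth: "\<And>u. u \<in> unitary_part \<Longrightarrow> ip w u = 0" and v: "v \<in> H"
  shows "((\<lambda>t. ip (S t w) v) \<longlongrightarrow> 0) at_top"
proof -
  define P where "P = {v \<in> H. ((\<lambda>t. ip (S t w) v) \<longlongrightarrow> 0) at_top}"
  have ev0: "\<forall>\<^sub>F t in at_top. t \<ge> (0::real)"
    by (rule eventually_ge_at_top)
  have "subspace P"
    unfolding subspace_def
  proof (intro conjI ballI allI)
    show "0 \<in> P"
      using w by (auto simp: P_def intro!: tendsto_eventually eventually_mono[OF ev0])
  next
    fix x y assume "x \<in> P" "y \<in> P"
    then have x: "x \<in> H" "((\<lambda>t. ip (S t w) x) \<longlongrightarrow> 0) at_top" and y: "y \<in> H" "((\<lambda>t. ip (S t w) y) \<longlongrightarrow> 0) at_top"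
      by (auto simp: P_def)
    from tendsto_add_zero[OF x(2) y(2)] have "((\<lambda>t. ip (S t w) (x + y)) \<longlongrightarrow> 0) at_top"
      by (rule Lim_transform_eventually)
        (use x y w in \<open>auto intro!: eventually_mono[OF ev0] simp: ip_linear\<close>)
    then show "x + y \<in> P"
      using x y by (simp add: P_def)
  next
    fix c x assume "x \<in> P"
    then have x: "x \<in> H" "((\<lambda>t. ip (S t w) x) \<longlongrightarrow> 0) at_top"
      by (auto simp: P_def)
    from tendsto_mult_right_zero[OF x(2), of c] have "((\<lambda>t. ip (S t w) (c *\<^sub>R x)) \<longlongrightarrow> 0) at_top"
      by (rule Lim_transform_eventually)
        (use x w in \<open>auto intro!: eventually_mono[OF ev0] simp: ip_linear\<close>)
    then show "c *\<^sub>R x \<in> P"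
      using x by (simp add: P_def)
  qed
  have PH: "P \<subseteq> H"
    by (auto simp: P_def)
  obtain p r where p: "\<And>n::nat. p n \<in> P" and r: "r \<in> H" and r_orth: "\<And>y. y \<in> P \<Longrightarrow> ip r y = 0"
    and lim: "(\<lambda>n. nrm (v - r - p n)) \<longlonglongrightarrow> 0"
    using orthogonal_remainder[OF \<open>subspace P\<close> PH v] by metis
  have small: "((\<lambda>t. ip (X t) y) \<longlongrightarrow> 0) at_top"
    if "((\<lambda>t. nrm (X t)) \<longlongrightarrow> 0) at_top" "\<And>t. t \<ge> 0 \<Longrightarrow> X t \<in> H" "y \<in> H"
    for X :: "real \<Rightarrow> 'a" and y
  proof -
    have "\<forall>\<^sub>F t in at_top. X t \<in> H"
      using ev0 by eventually_elim (use that in simp)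
    from ip_tendsto_left[OF this, of 0 y] show ?thesis
      using that by simp
  qed
  have "Sa s (S s y) - y \<in> P" if s: "s \<ge> 0" and y: "y \<in> H" for s y
  proof -
    have "((\<lambda>t. ip (Sa s (S s (S t w)) - S t w) y) \<longlongrightarrow> 0) at_top"
      using s y w by (intro small adjoint_after_S_tendsto) auto
    then have "((\<lambda>t. ip (S t w) (Sa s (S s y) - y)) \<longlongrightarrow> 0) at_top"
      by (rule Lim_transform_eventually)
        (use s y w in \<open>auto intro!: eventually_mono[OF ev0] simp: ip_linear ip_Sa\<close>,
         use s y w ip_S in \<open>simp\<close>)
    then show ?thesis
      using s y by (simp add: P_def)
  qed
  then have "Sa s (S s r) \<simeq> r" if s: "s \<ge> 0" for s
    unfolding weq_def using r_orth s r by (fastforce simp: ip_linear ip_Sa ip_S)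
  moreover have "S s (Sa s y) - y \<in> P" if s: "s \<ge> 0" and y: "y \<in> H" for s y
  proof -
    have "((\<lambda>t. ip (S s (Sa s (S t w)) - S t w) y) \<longlongrightarrow> 0) at_top"
      using s y w by (intro small S_after_adjoint_tendsto) auto
    then have "((\<lambda>t. ip (S t w) (S s (Sa s y) - y)) \<longlongrightarrow> 0) at_top"
      by (rule Lim_transform_eventually)
        (use s y w in \<open>auto intro!: eventually_mono[OF ev0] simp: ip_linear ip_S ip_Sa\<close>)
    then show ?thesis
      using s y by (simp add: P_def)
  qed
  then have "S s (Sa s r) \<simeq> r" if s: "s \<ge> 0" for s
    unfolding weq_def using r_orth s r by (fastforce simp: ip_linear ip_Sa ip_S)
  ultimately have r_unitary: "r \<in> unitary_part"
    using r by (intro unitary_partI)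
  \<comment> \<open>\<open>\<langle>S t w, r\<rangle> = \<langle>w, (S t)\<^sup>* r\<rangle>\<close> vanishes, because \<open>(S t)\<^sup>* r\<close> is again unitary.\<close>
  have "r \<in> P"
    using r w orth[OF unitary_part_Sa[OF r_unitary]]
    by (auto simp: P_def ip_S intro!: tendsto_eventually eventually_mono[OF ev0])
  then have "nrm r = 0"
    using r_orth[of r] by (simp add: nrm_def)
  show ?thesis
  proof (rule tendstoI)
    fix e :: real assume e: "e > 0"
    define K where "K = nrm w + 1"
    have K: "K > 0"
      using w by (simp add: K_def add_nonneg_pos)
    then obtain n where n: "nrm (v - r - p n) < e / (2 * K)"
      using order_tendstoD(2)[OF lim, of "e / (2 * K)"] e by (auto dest: eventually_happens)
    have pn: "p n \<in> H"
      using p PH by blast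
    have "\<forall>\<^sub>F t in at_top. \<bar>ip (S t w) (p n)\<bar> < e / 2"
      using p[of n] tendstoD[of "\<lambda>t. ip (S t w) (p n)" 0 at_top "e / 2"] e by (simp add: P_def)
    with ev0 show "\<forall>\<^sub>F t in at_top. dist (ip (S t w) v) 0 < e"
    proof eventually_elim
      case (elim t)
      then have tw: "S t w \<in> H"
        using w by simp
      have "ip (S t w) v = ip (S t w) (v - r - p n) + ip (S t w) r + ip (S t w) (p n)"
        using tw v r pn by (simp add: ip_linear)
      moreover have "\<bar>ip (S t w) r\<bar> \<le> 0"
        using Cauchy_Schwarz[OF tw r] \<open>nrm r = 0\<close> by simp
      moreover have "\<bar>ip (S t w) (v - r - p n)\<bar> \<le> e / 2"
      proof -
        have "\<bar>ip (S t w) (v - r - p n)\<bar> \<le> nrm (S t w) * nrm (v - r - p n)"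
          using tw v r pn by (intro Cauchy_Schwarz) auto
        also have "\<dots> \<le> K * (e / (2 * K))"
          using contraction_nrm[OF contraction_S w, of t] elim n tw v r pn K
          by (intro mult_mono) (auto simp: K_def)
        finally show ?thesis
          using K by simp
      qed
      ultimately show ?case
        using elim(2) by (simp add: dist_real_def)
    qed
  qed
qed

end

section \<open>Generators and time averages of orbits\<close>

context semi_hilbert
begin

definition difference_quotient_limit :: "(real \<Rightarrow> 'a \<Rightarrow> 'a) \<Rightarrow> 'a \<Rightarrow> 'a \<Rightarrow> bool" where
  "difference_quotient_limit S x f \<longleftrightarrow>
    ((\<lambda>h. nrm ((1 / h) *\<^sub>R (S h x - x) - f)) \<longlongrightarrow> 0) (at_right 0)"

definition is_generator :: "(real \<Rightarrow> 'a \<Rightarrow> 'a) \<Rightarrow> ('a \<Rightarrow> 'a) \<Rightarrow> 'a set \<Rightarrow> bool" where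
  "is_generator S A D \<longleftrightarrow> D = {x \<in> H. \<exists>f\<in>H. difference_quotient_limit S x f} \<and>
    (\<forall>x\<in>D. A x \<in> H \<and> difference_quotient_limit S x (A x))"

end

lemma eventually_at_right_pos: "\<forall>\<^sub>F h in at_right (0::real). h > 0"
  by (simp add: eventually_at_filter)

context contraction_semigroup
begin

text \<open>
  Contractivity turns right continuity at time zero into uniform continuity of the whole orbit, with
  the same modulus.
\<close>

lemma S_modulus:
  assumes x: "x \<in> H" and e: "e > 0"
  obtains d where "d > 0" "\<And>s t. s \<ge> 0 \<Longrightarrow> t \<ge> 0 \<Longrightarrow> \<bar>s - t\<bar> < d \<Longrightarrow> nrm (S s x - S t x) \<le> e"
proof -
  have "\<forall>\<^sub>F t in at_right 0. nrm (S t x - x) < e"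
    using order_tendstoD(2)[OF S_continuous[OF x] e] .
  then obtain d where d: "d > 0" "\<And>t. t > 0 \<Longrightarrow> t < d \<Longrightarrow> nrm (S t x - x) < e"
    unfolding eventually_at_right_field by auto
  have le: "nrm (S t x - S s x) \<le> e" if "s \<ge> 0" "s \<le> t" "t - s < d" for s t
  proof (cases "s = t")
    case True
    then show ?thesis
      using e by (simp add: nrm_def)
  next
    case False
    have "S t x \<simeq> S s (S (t - s) x)"
      using S_add[of s "t - s" x] that x by simp
    then have "S t x - S s x \<simeq> S s (S (t - s) x) - S s x"
      using that x by (intro weq_diff) auto
    then have "nrm (S t x - S s x) = nrm (S s (S (t - s) x) - S s x)"
      by (rule weq_nrm) (use that x in auto)
    also have "\<dots> \<le> nrm (S (t - s) x - x)"
      using that x by (intro contraction_dist contraction_S) auto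
    also have "\<dots> \<le> e"
      using d(2)[of "t - s"] that False by simp
    finally show ?thesis .
  qed
  show thesis
  proof (rule that[OF d(1)])
    fix s t :: real assume st: "s \<ge> 0" "t \<ge> 0" "\<bar>s - t\<bar> < d"
    then show "nrm (S s x - S t x) \<le> e"
      using le[of s t] le[of t s] nrm_minus_commute[of "S s x" "S t x"] x by (cases "s \<le> t") auto
  qed
qed

lemma continuous_ip_S:
  assumes x: "x \<in> H" and v: "v \<in> H"
  shows "continuous_on {0..} (\<lambda>s. ip (S s x) v)"
  unfolding continuous_on_iff
proof (intro ballI allI impI)
  fix s e :: real assume s: "s \<in> {0..}" and e: "e > 0"
  define e' where "e' = e / (2 * (nrm v + 1))"
  have nv: "nrm v \<ge> 0"
    using v by simp
  have e': "e' > 0"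
    using e nv by (simp add: e'_def)
  obtain d where d: "d > 0" "\<And>s t. s \<ge> 0 \<Longrightarrow> t \<ge> 0 \<Longrightarrow> \<bar>s - t\<bar> < d \<Longrightarrow> nrm (S s x - S t x) \<le> e'"
    using S_modulus[OF x e'] by metis
  have "dist (ip (S t x) v) (ip (S s x) v) < e" if t: "t \<in> {0..}" "dist t s < d" for t
  proof -
    have "\<bar>ip (S t x - S s x) v\<bar> \<le> nrm (S t x - S s x) * nrm v"
      using s t x v by (intro Cauchy_Schwarz) auto
    also have "\<dots> \<le> e' * nrm v"
      using d(2)[of t s] s t nv by (intro mult_right_mono) (auto simp: dist_real_def)
    also have "\<dots> < e' * (2 * (nrm v + 1))"
      using e' nv by (intro mult_strict_left_mono) auto
    also have "\<dots> = e"
      using nv by (simp add: e'_def)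
    finally show ?thesis
      using s t x v by (simp add: dist_real_def ip_linear)
  qed
  then show "\<exists>d>0. \<forall>t\<in>{0..}. dist t s < d \<longrightarrow> dist (ip (S t x) v) (ip (S s x) v) < e"
    using d(1) by blast
qed

lemma ip_S_integrable: "x \<in> H \<Longrightarrow> v \<in> H \<Longrightarrow> a \<ge> 0 \<Longrightarrow> (\<lambda>s. ip (S s x) v) integrable_on {a..b}"
  by (intro integrable_continuous_real continuous_on_subset[OF continuous_ip_S]) auto

text \<open>
  The average of the orbit of \<open>u\<close> over \<open>[0, h]\<close>, defined weakly through the Riesz representation so that
  only integrals of real functions occur.
\<close>

lemma time_average_exists:
  assumes u: "u \<in> H" and h: "h > 0"
  obtains y where "y \<in> H" "\<And>v. v \<in> H \<Longrightarrow> ip y v = integral {0..h} (\<lambda>s. ip (S s u) v) / h"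
proof (rule Riesz_representation[of "\<lambda>v. integral {0..h} (\<lambda>s. ip (S s u) v) / h" "nrm u"])
  show "integral {0..h} (\<lambda>s. ip (S s u) (v + w)) / h =
      integral {0..h} (\<lambda>s. ip (S s u) v) / h + integral {0..h} (\<lambda>s. ip (S s u) w) / h"
    if "v \<in> H" "w \<in> H" for v w
  proof -
    have "integral {0..h} (\<lambda>s. ip (S s u) (v + w)) = integral {0..h} (\<lambda>s. ip (S s u) v + ip (S s u) w)"
      using that u by (intro integral_cong) (simp add: ip_linear)
    also have "\<dots> = integral {0..h} (\<lambda>s. ip (S s u) v) + integral {0..h} (\<lambda>s. ip (S s u) w)"
      using that u by (intro integral_add ip_S_integrable) auto
    finally show ?thesis
      by (simp add: add_divide_distrib)
  qed
  show "integral {0..h} (\<lambda>s. ip (S s u) (c *\<^sub>R v)) / h = c * (integral {0..h} (\<lambda>s. ip (S s u) v) / h)"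
    if "v \<in> H" for c v
  proof -
    have "integral {0..h} (\<lambda>s. ip (S s u) (c *\<^sub>R v)) = integral {0..h} (\<lambda>s. c * ip (S s u) v)"
      using that u by (intro integral_cong) (simp add: ip_linear)
    then show ?thesis
      by simp
  qed
  show "\<bar>integral {0..h} (\<lambda>s. ip (S s u) v) / h\<bar> \<le> nrm u * nrm v" if v: "v \<in> H" for v
  proof -
    have "norm (integral {0..h} (\<lambda>s. ip (S s u) v)) \<le> nrm u * nrm v * (h - 0)"
    proof (rule integral_bound)
      show "continuous_on {0..h} (\<lambda>s. ip (S s u) v)"
        using continuous_ip_S[OF u v] by (rule continuous_on_subset) auto
      fix s assume "s \<in> {0..h}"
      then have s: "s \<ge> 0"
        by simp
      have "\<bar>ip (S s u) v\<bar> \<le> nrm (S s u) * nrm v"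
        using s u v by (intro Cauchy_Schwarz) auto
      also have "\<dots> \<le> nrm u * nrm v"
        using s u v by (intro mult_right_mono contraction_nrm contraction_S) auto
      finally show "norm (ip (S s u) v) \<le> nrm u * nrm v"
        by simp
    qed (use h in simp)
    then show ?thesis
      using h by (simp add: abs_divide field_simps)
  qed
qed (use that in blast)

lemma time_average_close:
  assumes u: "u \<in> H" and h: "h > 0" and y: "y \<in> H"
    and avg: "\<And>v. v \<in> H \<Longrightarrow> ip y v = integral {0..h} (\<lambda>s. ip (S s u) v) / h"
    and close: "\<And>s. 0 \<le> s \<Longrightarrow> s \<le> h \<Longrightarrow> nrm (S s u - u) \<le> e"
  shows "nrm (y - u) \<le> e"
proof (rule nrm_le_if_weakly_bounded)
  have "nrm (S 0 u - u) \<ge> 0"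
    using u by simp
  then show "e \<ge> 0"
    using close[of 0] h by simp
  fix v assume v: "v \<in> H"
  have "norm (integral {0..h} (\<lambda>s. ip (S s u) v - ip u v)) \<le> e * nrm v * (h - 0)"
  proof (rule integral_bound)
    show "continuous_on {0..h} (\<lambda>s. ip (S s u) v - ip u v)"
      by (intro continuous_intros continuous_on_subset[OF continuous_ip_S[OF u v]]) auto
    fix s assume s: "s \<in> {0..h}"
    have "\<bar>ip (S s u - u) v\<bar> \<le> nrm (S s u - u) * nrm v"
      using s u v by (intro Cauchy_Schwarz) auto
    also have "\<dots> \<le> e * nrm v"
      using s v close[of s] by (intro mult_right_mono) auto
    finally show "norm (ip (S s u) v - ip u v) \<le> e * nrm v"
      using s u v by (simp add: ip_linear)
  qed (use h in simp)
  moreover have "integral {0..h} (\<lambda>s. ip (S s u) v - ip u v) = integral {0..h} (\<lambda>s. ip (S s u) v) - h * ip u v"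
    using h Henstock_Kurzweil_Integration.integral_diff[OF ip_S_integrable[OF u v, of 0 h] integrable_const_ivl[of "ip u v"]]
    by simp
  moreover have "h * ip (y - u) v = integral {0..h} (\<lambda>s. ip (S s u) v) - h * ip u v"
    using u v y h by (simp add: ip_linear avg right_diff_distrib)
  ultimately have "h * ip (y - u) v \<le> h * (e * nrm v)"
    by (simp add: mult.commute)
  then show "ip (y - u) v \<le> e * nrm v"
    using h by simp
qed (use u y in simp)

text \<open>
  Weakly, \<open>h (S \<tau> y - y)\<close> is the integral of the orbit over \<open>[h, h + \<tau>]\<close> minus its integral over
  \<open>[0, \<tau>]\<close>. By uniform continuity of the orbit these are \<open>\<tau> S h u\<close> and \<open>\<tau> u\<close> up to an error of
  order \<open>\<tau> \<epsilon>\<close>, uniformly in the unit test vector; so averages lie in the domain of the generator.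
\<close>

lemma time_average_derivative:
  assumes u: "u \<in> H" and h: "h > 0" and y: "y \<in> H"
    and avg: "\<And>v. v \<in> H \<Longrightarrow> ip y v = integral {0..h} (\<lambda>s. ip (S s u) v) / h"
  shows "difference_quotient_limit S y ((1 / h) *\<^sub>R (S h u - u))"
  unfolding difference_quotient_limit_def
proof (rule tendstoI)
  fix e :: real assume e: "e > 0"
  \<comment> \<open>The two integrals contribute an error of \<open>\<epsilon> / h\<close> each, which leaves a total below \<open>e\<close>.\<close>
  define \<epsilon> where "\<epsilon> = e * h / 3"
  have \<epsilon>: "\<epsilon> > 0"
    using e h by (simp add: \<epsilon>_def)
  obtain d where d: "d > 0" "\<And>s t. s \<ge> 0 \<Longrightarrow> t \<ge> 0 \<Longrightarrow> \<bar>s - t\<bar> < d \<Longrightarrow> nrm (S s u - S t u) \<le> \<epsilon>"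
    using S_modulus[OF u \<epsilon>] by metis
  have "nrm ((1 / \<tau>) *\<^sub>R (S \<tau> y - y) - (1 / h) *\<^sub>R (S h u - u)) \<le> 2 * \<epsilon> / h" if \<tau>: "0 < \<tau>" "\<tau> < d" for \<tau>
  proof (rule nrm_le_if_weakly_bounded)
    fix v assume v: "v \<in> H"
    define \<phi> where "\<phi> s = ip (S s u) v" for s
    have cont: "continuous_on {a..b} \<phi>" if "a \<ge> 0" for a b
      unfolding \<phi>_def using that by (intro continuous_on_subset[OF continuous_ip_S[OF u v]]) auto
    have int: "\<phi> integrable_on {a..b}" if "a \<ge> 0" for a b
      using cont[OF that] by (rule integrable_continuous_real)
    have local_bound: "\<bar>integral {a..a + \<tau>} \<phi> - \<tau> * \<phi> a\<bar> \<le> \<epsilon> * nrm v * \<tau>" if a: "a \<ge> 0" for a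
    proof -
      have "norm (integral {a..a + \<tau>} (\<lambda>s. \<phi> s - \<phi> a)) \<le> \<epsilon> * nrm v * (a + \<tau> - a)"
      proof (rule integral_bound)
        show "continuous_on {a..a + \<tau>} (\<lambda>s. \<phi> s - \<phi> a)"
          by (intro continuous_intros cont a)
        fix s assume s: "s \<in> {a..a + \<tau>}"
        have "\<bar>ip (S s u - S a u) v\<bar> \<le> nrm (S s u - S a u) * nrm v"
          using s a u v by (intro Cauchy_Schwarz) auto
        also have "\<dots> \<le> \<epsilon> * nrm v"
          using s a v \<tau> d(2)[of s a] by (intro mult_right_mono) auto
        finally show "norm (\<phi> s - \<phi> a) \<le> \<epsilon> * nrm v"
          using s a u v by (simp add: ip_linear \<phi>_def)
      qed (use \<tau> in simp)
      moreover have "integral {a..a + \<tau>} (\<lambda>s. \<phi> s - \<phi> a) = integral {a..a + \<tau>} \<phi> - \<tau> * \<phi> a"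
        using \<tau> Henstock_Kurzweil_Integration.integral_diff[OF int[OF a, of "a + \<tau>"] integrable_const_ivl[of "\<phi> a"]] by simp
      ultimately show ?thesis
        by simp
    qed
    have "ip (S \<tau> y) v = integral {0..h} (\<lambda>s. ip (S s u) (Sa \<tau> v)) / h"
      using avg[of "Sa \<tau> v"] \<tau> y v by (simp add: ip_S)
    also have "integral {0..h} (\<lambda>s. ip (S s u) (Sa \<tau> v)) = integral {0..h} (\<lambda>s. \<phi> (s + \<tau>))"
    proof (rule integral_cong)
      fix s assume s: "s \<in> {0..h}"
      have "ip (S (\<tau> + s) u) v = ip (S \<tau> (S s u)) v"
        using s \<tau> u v by (intro weqD[OF S_add]) auto
      then show "ip (S s u) (Sa \<tau> v) = \<phi> (s + \<tau>)"
        using s \<tau> u v by (simp add: \<phi>_def ip_S add.commute)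
    qed
    also have "\<dots> = integral {\<tau>..h + \<tau>} \<phi>"
      using integral_shift[of 0 \<tau> h \<phi>] cont[of \<tau> "h + \<tau>"] \<tau> by (simp add: o_def)
    also have "\<dots> = integral {0..h} \<phi> + integral {h..h + \<tau>} \<phi> - integral {0..\<tau>} \<phi>"
      using Henstock_Kurzweil_Integration.integral_combine[of 0 \<tau> "h + \<tau>" \<phi>]
        Henstock_Kurzweil_Integration.integral_combine[of 0 h "h + \<tau>" \<phi>] int[of 0 "h + \<tau>"] \<tau> h
      by simp
    finally have "h * (ip (S \<tau> y) v - ip y v) = integral {h..h + \<tau>} \<phi> - integral {0..\<tau>} \<phi>"
      using avg[OF v, folded \<phi>_def] h by (simp add: field_simps)
    then have "h * (ip (S \<tau> y) v - ip y v) - \<tau> * (\<phi> h - \<phi> 0) \<le> 2 * \<epsilon> * nrm v * \<tau>"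
      using local_bound[of 0] local_bound[of h] h by (simp add: algebra_simps)
    then have "(h * (ip (S \<tau> y) v - ip y v) - \<tau> * (\<phi> h - \<phi> 0)) / (\<tau> * h) \<le> 2 * \<epsilon> * nrm v * \<tau> / (\<tau> * h)"
      using \<tau> h by (intro divide_right_mono) auto
    moreover have "(h * (ip (S \<tau> y) v - ip y v) - \<tau> * (\<phi> h - \<phi> 0)) / (\<tau> * h) =
        (ip (S \<tau> y) v - ip y v) / \<tau> - (\<phi> h - \<phi> 0) / h"
      using \<tau> h by (simp add: diff_divide_distrib)
    moreover have "\<phi> 0 = ip u v"
      unfolding \<phi>_def by (rule weqD[OF S_zero[OF u] v])
    ultimately show "ip ((1 / \<tau>) *\<^sub>R (S \<tau> y - y) - (1 / h) *\<^sub>R (S h u - u)) v \<le> 2 * \<epsilon> / h * nrm v"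
      using \<tau> h u v y by (simp add: ip_linear \<phi>_def mult.commute)
  qed (use \<tau> h y u \<epsilon> in simp_all)
  moreover have "2 * \<epsilon> / h < e"
    using e h by (simp add: \<epsilon>_def)
  ultimately have less: "nrm ((1 / \<tau>) *\<^sub>R (S \<tau> y - y) - (1 / h) *\<^sub>R (S h u - u)) < e"
    if "0 < \<tau>" "\<tau> < d" for \<tau>
    using that by (meson le_less_trans)
  show "\<forall>\<^sub>F \<tau> in at_right 0. dist (nrm ((1 / \<tau>) *\<^sub>R (S \<tau> y - y) - (1 / h) *\<^sub>R (S h u - u))) 0 < e"
    unfolding eventually_at_right_field
    using d(1) less y u h by (intro exI[of _ d]) simp
qed

lemma isometric_part_subset: "u \<in> isometric_part \<Longrightarrow> u \<in> H"
  by (simp add: isometric_part_def)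

lemma isometric_part_S:
  assumes "u \<in> isometric_part" "s \<ge> 0"
  shows "S s u \<in> isometric_part"
  using assms nrm_S_add by (simp add: isometric_part_def flip: nrm_S_add)

lemma isometric_part_iff:
  "u \<in> isometric_part \<longleftrightarrow> u \<in> H \<and> (\<forall>t\<ge>0. Sa t (S t u) \<simeq> u)"
  using isometric_iff[OF contraction_S adjoint_Sa] by (auto simp: isometric_part_def)

text \<open>
  Isometry of \<open>S t\<close> on a vector means that \<open>(S t)\<^sup>* (S t)\<close> fixes it, a linear condition, which
  therefore passes to averages.
\<close>

lemma time_average_isometric:
  assumes u: "u \<in> isometric_part" and y: "y \<in> H"
    and avg: "\<And>v. v \<in> H \<Longrightarrow> ip y v = integral {0..h} (\<lambda>s. ip (S s u) v) / h"
  shows "y \<in> isometric_part"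
  unfolding isometric_part_iff weq_def
proof (intro conjI allI impI ballI)
  fix t v assume t: "t \<ge> (0::real)" and v: "v \<in> H"
  have uH: "u \<in> H"
    using u by (rule isometric_part_subset)
  have "ip (Sa t (S t y)) v = ip y (Sa t (S t v))"
    using t y v by (simp add: ip_S ip_Sa)
  also have "\<dots> = integral {0..h} (\<lambda>s. ip (S s u) (Sa t (S t v))) / h"
    using t v by (intro avg) simp
  also have "integral {0..h} (\<lambda>s. ip (S s u) (Sa t (S t v))) = integral {0..h} (\<lambda>s. ip (S s u) v)"
  proof (rule integral_cong)
    fix s assume "s \<in> {0..h}"
    then have s: "s \<ge> 0"
      by simp
    have "ip (Sa t (S t (S s u))) v = ip (S s u) v"
      using isometric_part_S[OF u s] t v by (simp add: isometric_part_iff weq_def)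
    then show "ip (S s u) (Sa t (S t v)) = ip (S s u) v"
      using s t v uH by (simp add: ip_S ip_Sa)
  qed
  also have "\<dots> / h = ip y v"
    using avg[OF v] by simp
  finally show "ip (Sa t (S t y)) v = ip y v" .
qed (rule y)

text \<open>
  The domain of the generator is dense within the isometric part, not only in the whole space, so that
  energy conservation can be differentiated at the approximating vectors themselves.
\<close>

lemma isometric_part_approx:
  assumes u: "u \<in> isometric_part" and e: "e > 0"
  obtains y f where "y \<in> isometric_part" "f \<in> H" "difference_quotient_limit S y f" "nrm (y - u) \<le> e"
proof -
  have uH: "u \<in> H"
    using u by (rule isometric_part_subset)
  obtain d where d: "d > 0" "\<And>s t. s \<ge> 0 \<Longrightarrow> t \<ge> 0 \<Longrightarrow> \<bar>s - t\<bar> < d \<Longrightarrow> nrm (S s u - S t u) \<le> e"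
    using S_modulus[OF uH e] by metis
  define h where "h = d / 2"
  have h: "h > 0"
    using d by (simp add: h_def)
  have close: "nrm (S s u - u) \<le> e" if "0 \<le> s" "s \<le> h" for s
  proof -
    have "nrm (S s u - u) = nrm (S s u - S 0 u)"
      using that uH S_zero[OF uH] weq_sym by (intro weq_nrm weq_diff) auto
    then show ?thesis
      using d(2)[of s 0] d(1) that by (simp add: h_def)
  qed
  obtain y where y: "y \<in> H" "\<And>v. v \<in> H \<Longrightarrow> ip y v = integral {0..h} (\<lambda>s. ip (S s u) v) / h"
    using time_average_exists[OF uH h] by metis
  show thesis
    using that[OF time_average_isometric[OF u y] _ time_average_derivative[OF uH h y]
        time_average_close[OF uH h y close]] uH h by simp
qed

lemma difference_quotient_limit_S:
  assumes y: "y \<in> H" and f: "f \<in> H" and lim: "difference_quotient_limit S y f" and s: "s \<ge> 0"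
  shows "difference_quotient_limit S (S s y) (S s f)"
  unfolding difference_quotient_limit_def
proof (rule Lim_null_comparison)
  show "((\<lambda>h. nrm ((1 / h) *\<^sub>R (S h y - y) - f)) \<longlongrightarrow> 0) (at_right 0)"
    using lim by (simp add: difference_quotient_limit_def)
  show "\<forall>\<^sub>F h in at_right 0. norm (nrm ((1 / h) *\<^sub>R (S h (S s y) - S s y) - S s f))
      \<le> nrm ((1 / h) *\<^sub>R (S h y - y) - f)"
    using eventually_at_right_pos
  proof eventually_elim
    case (elim h)
    have comm: "S h (S s y) \<simeq> S s (S h y)"
      using S_add[of h s y] S_add[of s h y] elim s y weq_sym weq_trans by (metis add.commute less_imp_le)
    have lin: "S s ((1 / h) *\<^sub>R (S h y - y)) \<simeq> (1 / h) *\<^sub>R (S s (S h y) - S s y)"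
    proof -
      have "S s ((1 / h) *\<^sub>R (S h y - y)) \<simeq> (1 / h) *\<^sub>R S s (S h y - y)"
        using elim s y by (intro contraction_scale contraction_S) auto
      also have "\<dots> \<simeq> (1 / h) *\<^sub>R (S s (S h y) - S s y)"
        using contraction_diff[OF contraction_S[OF s], of "S h y" y] elim s y
        by (simp add: weq_def ip_linear)
      finally show ?thesis .
    qed
    have "(1 / h) *\<^sub>R (S h (S s y) - S s y) \<simeq> S s ((1 / h) *\<^sub>R (S h y - y))"
      using comm lin elim s y by (simp add: weq_def ip_linear)
    then have "(1 / h) *\<^sub>R (S h (S s y) - S s y) - S s f \<simeq> S s ((1 / h) *\<^sub>R (S h y - y)) - S s f"
      using elim s y f by (intro weq_diff) auto
    then have "nrm ((1 / h) *\<^sub>R (S h (S s y) - S s y) - S s f) = nrm (S s ((1 / h) *\<^sub>R (S h y - y)) - S s f)"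
      using elim s y f by (intro weq_nrm) auto
    also have "\<dots> \<le> nrm ((1 / h) *\<^sub>R (S h y - y) - f)"
      using elim s y f by (intro contraction_dist contraction_S) auto
    finally show ?case
      using elim s y f by simp
  qed
qed

end

context semi_hilbert
begin

lemma ip_difference_quotient_tendsto:
  assumes S: "contraction_semigroup H ip S" and T: "contraction_semigroup H ip T"
    and y: "y \<in> H" "f \<in> H" "difference_quotient_limit S y f"
    and z: "z \<in> H" "g \<in> H" "difference_quotient_limit T z g"
  shows "((\<lambda>h. (ip (S h y) (T h z) - ip y z) / h) \<longlongrightarrow> ip f z + ip y g) (at_right 0)"
proof -
  interpret S: contraction_semigroup H ip S by fact
  interpret T: contraction_semigroup H ip T by fact
  have "((\<lambda>h. ip ((1 / h) *\<^sub>R (S h y - y)) (T h z)) \<longlongrightarrow> ip f z) (at_right 0)"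
    using y z T.S_continuous[OF z(1)]
    by (intro ip_tendsto) (auto simp: difference_quotient_limit_def intro!: eventually_mono[OF eventually_at_right_pos])
  moreover have "((\<lambda>h. ip y ((1 / h) *\<^sub>R (T h z - z))) \<longlongrightarrow> ip y g) (at_right 0)"
    using y z by (intro ip_tendsto)
      (auto simp: difference_quotient_limit_def nrm_def intro!: eventually_mono[OF eventually_at_right_pos])
  ultimately have "((\<lambda>h. ip ((1 / h) *\<^sub>R (S h y - y)) (T h z) + ip y ((1 / h) *\<^sub>R (T h z - z)))
      \<longlongrightarrow> ip f z + ip y g) (at_right 0)"
    by (rule tendsto_add)
  then show ?thesis
    by (rule Lim_transform_eventually)
      (use y z in \<open>auto intro!: eventually_mono[OF eventually_at_right_pos] simp: ip_linear field_simps\<close>)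
qed

text \<open>
  Energy balance for a damped semigroup \<open>S\<close> with generator \<open>A1 - B\<close>, compared with an isometric
  semigroup \<open>T\<close> with generator \<open>A1\<close>. Conservation of energy at \<open>u\<close> leaves no room for damping. The
  symmetry of \<open>B\<close> carries \<open>B y = 0\<close> from vectors \<open>y\<close> in the domain to their limits, since
  \<open>\<langle>B u, v\<rangle> = \<langle>u, B v\<rangle>\<close> depends continuously on \<open>u\<close>.
\<close>

theorem isometric_part_undamped:
  assumes S: "contraction_semigroup H ip S" and T: "contraction_semigroup H ip T"
    and T_isometric: "\<And>t x y. t \<ge> 0 \<Longrightarrow> x \<in> H \<Longrightarrow> y \<in> H \<Longrightarrow> ip (T t x) (T t y) = ip x y"
    and S_gen: "is_generator S A D" and T_gen: "is_generator T A1 D"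
    and A: "\<And>x. x \<in> D \<Longrightarrow> A x = A1 x - B x"
    and B_H: "\<And>x. x \<in> H \<Longrightarrow> B x \<in> H"
    and B_sym: "\<And>x y. x \<in> H \<Longrightarrow> y \<in> H \<Longrightarrow> ip (B x) y = ip x (B y)"
    and B_null: "\<And>x. x \<in> H \<Longrightarrow> ip (B x) x = 0 \<Longrightarrow> B x \<simeq> 0"
    and u: "u \<in> H" "\<And>t. t \<ge> 0 \<Longrightarrow> nrm (S t u) = nrm u"
  shows "t \<ge> 0 \<Longrightarrow> S t u \<simeq> T t u" and "B u \<simeq> 0"
proof -
  interpret S: contraction_semigroup H ip S by fact
  interpret T: contraction_semigroup H ip T by fact
  let ?F = "S.isometric_part"
  have D_iff: "x \<in> D \<longleftrightarrow> x \<in> H \<and> (\<exists>f\<in>H. difference_quotient_limit S x f)"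
    and DA: "x \<in> D \<Longrightarrow> A x \<in> H" "x \<in> D \<Longrightarrow> difference_quotient_limit S x (A x)" for x
    using S_gen unfolding is_generator_def by blast+
  have D_iff1: "x \<in> D \<longleftrightarrow> x \<in> H \<and> (\<exists>f\<in>H. difference_quotient_limit T x f)"
    and DA1: "x \<in> D \<Longrightarrow> A1 x \<in> H" "x \<in> D \<Longrightarrow> difference_quotient_limit T x (A1 x)" for x
    using T_gen unfolding is_generator_def by blast+
  have DH: "x \<in> D \<Longrightarrow> x \<in> H" for x
    using D_iff by blast
  have zero_limit: "l = 0" if "((\<lambda>h. c h / h) \<longlongrightarrow> l) (at_right 0)" "\<And>h. h > 0 \<Longrightarrow> c h = 0" for c and l :: real
    by (rule tendsto_unique[OF trivial_limit_at_right_real that(1)])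
      (use that(2) in \<open>auto intro!: tendsto_eventually eventually_mono[OF eventually_at_right_pos]\<close>)
  \<comment> \<open>Differentiate \<open>\<langle>T h x, T h y\<rangle> = \<langle>x, y\<rangle>\<close> at \<open>h = 0\<close>.\<close>
  have skew: "ip (A1 x) y + ip x (A1 y) = 0" if "x \<in> D" "y \<in> D" for x y
    by (rule zero_limit[OF ip_difference_quotient_tendsto[OF T T]])
      (use that DA1 DH T_isometric in auto)
  \<comment> \<open>Differentiate \<open>\<parallel>S h x\<parallel>\<^sup>2 = \<parallel>x\<parallel>\<^sup>2\<close> at \<open>h = 0\<close>; the skew part of the generator does not contribute.\<close>
  have B_zero: "B x \<simeq> 0" if x: "x \<in> ?F" "x \<in> D" for x
  proof -
    have xH: "x \<in> H"
      using x DH by blast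
    have "ip (A x) x + ip x (A x) = 0"
    proof (rule zero_limit[OF ip_difference_quotient_tendsto[OF S S]])
      fix h :: real assume "h > 0"
      then have "nrm (S h x) = nrm x"
        using x by (simp add: S.isometric_part_def)
      then show "ip (S h x) (S h x) - ip x x = 0"
        by (simp add: nrm_def)
    qed (use x DA DH in auto)
    then have "ip (A x) x = 0"
      using ip_commute[OF xH DA(1)[OF x(2)]] by simp
    moreover have "ip (A1 x) x = 0"
      using skew[OF x(2) x(2)] ip_commute[OF xH DA1(1)[OF x(2)]] by simp
    ultimately have "ip (B x) x = 0"
      using A[OF x(2)] x xH DA1 B_H by (simp add: ip_linear)
    then show ?thesis
      using B_null xH by blast
  qed
  have S_eq_T: "S t x \<simeq> T t x" if x: "x \<in> ?F" "x \<in> D" and t: "t \<ge> 0" for x t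
  proof -
    have xH: "x \<in> H"
      using x DH by blast
    have Sx: "S s x \<in> ?F" "S s x \<in> D" if "s \<ge> 0" for s
    proof -
      show "S s x \<in> ?F"
        using S.isometric_part_S[OF x(1) that] .
      have "S s x \<in> H" "S s (A x) \<in> H"
        using that xH DA(1)[OF x(2)] by auto
      then show "S s x \<in> D"
        using S.difference_quotient_limit_S[OF xH DA(1)[OF x(2)] DA(2)[OF x(2)] that] D_iff by blast
    qed
    have Tx: "T s x \<in> D" if "s \<ge> 0" for s
    proof -
      have "T s x \<in> H" "T s (A1 x) \<in> H"
        using that xH DA1(1)[OF x(2)] by auto
      then show ?thesis
        using T.difference_quotient_limit_S[OF xH DA1(1)[OF x(2)] DA1(2)[OF x(2)] that] D_iff1 by blast
    qed
    \<comment> \<open>Orbits in the domain stay there, so at each time \<open>A\<close> acts on \<open>S s x\<close> as the skew operator \<open>A1\<close>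
      does, and the two terms of the product rule cancel.\<close>
    have "ip (S t x) (T t x) = ip (S 0 x) (T 0 x)"
    proof (rule constant_if_right_derivative_zero[OF t])
      show "((\<lambda>h. (ip (S (s + h) x) (T (s + h) x) - ip (S s x) (T s x)) / h) \<longlongrightarrow> 0) (at_right 0)"
        if s: "0 \<le> s" for s
      proof -
        have H': "S s x \<in> H" "T s x \<in> H"
          using s xH by auto
        have "ip (A (S s x)) (T s x) = ip (A1 (S s x)) (T s x)"
          using A[OF Sx(2)[OF s]] weqD[OF B_zero[OF Sx[OF s]] H'(2)] DA1(1)[OF Sx(2)[OF s]] B_H[OF H'(1)] H'
          by (simp add: ip_linear)
        then have "ip (A (S s x)) (T s x) + ip (S s x) (A1 (T s x)) = 0"
          using skew[OF Sx(2)[OF s] Tx[OF s]] by simp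
        moreover have "((\<lambda>h. (ip (S h (S s x)) (T h (T s x)) - ip (S s x) (T s x)) / h)
            \<longlongrightarrow> ip (A (S s x)) (T s x) + ip (S s x) (A1 (T s x))) (at_right 0)"
          using H' DA[OF Sx(2)[OF s]] DA1[OF Tx[OF s]]
          by (intro ip_difference_quotient_tendsto[OF S T])
        ultimately have "((\<lambda>h. (ip (S h (S s x)) (T h (T s x)) - ip (S s x) (T s x)) / h) \<longlongrightarrow> 0) (at_right 0)"
          by simp
        then show ?thesis
        proof (rule Lim_transform_eventually)
          show "\<forall>\<^sub>F h in at_right 0. (ip (S h (S s x)) (T h (T s x)) - ip (S s x) (T s x)) / h =
              (ip (S (s + h) x) (T (s + h) x) - ip (S s x) (T s x)) / h"
            using eventually_at_right_pos
          proof eventually_elim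
            case (elim h)
            have "ip (S (s + h) x) (T (s + h) x) = ip (S h (S s x)) (T (s + h) x)"
              using S.S_add[of h s x] elim s xH by (simp add: weqD add.commute)
            also have "\<dots> = ip (S h (S s x)) (T h (T s x))"
              using T.S_add[of h s x] elim s xH by (intro weqD_right) (simp_all add: add.commute)
            finally show ?case
              by simp
          qed
        qed
      qed
      show "continuous_on {0..t} (\<lambda>s. ip (S s x) (T s x))"
        unfolding continuous_on_def
      proof
        fix s assume s: "s \<in> {0..t}"
        have lim: "((\<lambda>r. nrm (R r x - R s x)) \<longlongrightarrow> 0) (at s within {0..t})"
          if "contraction_semigroup H ip R" for R
        proof -
          interpret R: contraction_semigroup H ip R by fact
          show ?thesis
          proof (rule tendstoI)
            fix e :: real assume e: "e > 0"
            then obtain d where d: "d > 0"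
              "\<And>s t. s \<ge> 0 \<Longrightarrow> t \<ge> 0 \<Longrightarrow> \<bar>s - t\<bar> < d \<Longrightarrow> nrm (R s x - R t x) \<le> e / 2"
              using R.S_modulus[OF xH, of "e / 2"] by (metis half_gt_zero)
            show "\<forall>\<^sub>F r in at s within {0..t}. dist (nrm (R r x - R s x)) 0 < e"
              unfolding eventually_at
            proof (intro exI[of _ d] conjI ballI impI d(1))
              fix r assume r: "r \<in> {0..t}" "r \<noteq> s \<and> dist r s < d"
              then show "dist (nrm (R r x - R s x)) 0 < e"
                using d(2)[of r s] s e xH by (simp add: dist_real_def)
            qed
          qed
        qed
        show "((\<lambda>s. ip (S s x) (T s x)) \<longlongrightarrow> ip (S s x) (T s x)) (at s within {0..t})"
          by (rule ip_tendsto[OF _ _ lim[OF S] _ _ lim[OF T]])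
            (use s xH in \<open>auto simp: eventually_at_filter\<close>)
      qed
    qed
    also have "\<dots> = ip x x"
      using weqD[OF S.S_zero[OF xH], of "T 0 x"] weqD_right[OF T.S_zero[OF xH], of x] xH by simp
    finally have cross: "ip (S t x) (T t x) = ip x x" .
    have "nrm (S t x) = nrm x"
      using x t by (simp add: S.isometric_part_def)
    \<comment> \<open>Two vectors of equal norm whose inner product is the square of that norm coincide.\<close>
    then have "ip (S t x) (S t x) = ip x x"
      by (simp add: nrm_def)
    moreover have "ip (T t x) (T t x) = ip x x"
      using T_isometric t xH by simp
    ultimately have "ip (S t x - T t x) (S t x - T t x) = 0"
      using cross t xH by (simp add: ip_linear ip_commute[of "T t x" "S t x"])
    then show ?thesis
      using t xH by (simp add: weq_iff_nrm nrm_def)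
  qed
  have uF: "u \<in> ?F"
    using u by (simp add: S.isometric_part_def)
  have approx: "\<exists>y\<in>?F. y \<in> D \<and> nrm (y - u) \<le> e" if "e > 0" for e
    using S.isometric_part_approx[OF uF that] S.isometric_part_subset by (metis D_iff)
  show "S t u \<simeq> T t u" if t: "t \<ge> 0"
  proof (rule weq_if_arbitrarily_close)
    fix e :: real assume "e > 0"
    then obtain y where y: "y \<in> ?F" "y \<in> D" "nrm (y - u) \<le> e / 2"
      using approx[of "e / 2"] by auto
    have yH: "y \<in> H"
      using y DH by blast
    have "nrm (S t u - T t u) \<le> nrm (S t u - S t y) + nrm (S t y - T t u)"
      using t u yH by (intro nrm_triangle_diff) auto
    also have "nrm (S t y - T t u) = nrm (T t y - T t u)"
      using S_eq_T[OF y(1,2) t] t u yH by (intro weq_nrm weq_diff) auto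
    also have "\<dots> \<le> nrm (y - u)"
      using t u yH by (intro contraction_dist T.contraction_S) auto
    also have "nrm (S t u - S t y) \<le> nrm (u - y)"
      using t u yH by (intro contraction_dist S.contraction_S) auto
    finally show "nrm (S t u - T t u) \<le> e"
      using y(3) nrm_minus_commute[OF u(1) yH] by simp
  qed (use t u in auto)
  show "B u \<simeq> 0"
    unfolding weq_def
  proof
    fix v assume v: "v \<in> H"
    have "\<bar>ip u (B v)\<bar> \<le> 0 + e" if e: "e > 0" for e
    proof -
      define K where "K = nrm (B v) + 1"
      have K: "K > 0"
        using B_H[OF v] by (simp add: K_def add_nonneg_pos)
      then obtain y where y: "y \<in> ?F" "y \<in> D" "nrm (y - u) \<le> e / K"
        using approx[of "e / K"] e by auto
      have yH: "y \<in> H"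
        using y DH by blast
      have "ip y (B v) = 0"
        using weqD[OF B_zero[OF y(1,2)] v] B_sym[OF yH v] v by simp
      then have "\<bar>ip u (B v)\<bar> = \<bar>ip (y - u) (B v)\<bar>"
        using yH u B_H[OF v] by (simp add: ip_linear)
      also have "\<dots> \<le> nrm (y - u) * nrm (B v)"
        using yH u B_H[OF v] by (intro Cauchy_Schwarz) auto
      also have "\<dots> \<le> (e / K) * K"
        using y e K B_H[OF v] by (intro mult_mono) (auto simp: K_def)
      finally show ?thesis
        using K by simp
    qed
    then have "\<bar>ip u (B v)\<bar> \<le> 0"
      by (rule field_le_epsilon)
    then show "ip (B u) v = ip 0 v"
      using B_sym[OF u(1) v] v by simp
  qed
qed

end

section \<open>Square integrable functions\<close>

text \<open>
  Pointwise operations make functions a real vector space, so that states can serve as the vectors of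
  the abstract part.
\<close>

instantiation "fun" :: (type, real_vector) real_vector
begin

definition scaleR_fun :: "real \<Rightarrow> ('a \<Rightarrow> 'b) \<Rightarrow> 'a \<Rightarrow> 'b" where
  "scaleR_fun c f = (\<lambda>x. c *\<^sub>R f x)"

instance
  by standard (auto simp: scaleR_fun_def fun_eq_iff algebra_simps)

end

definition square_integrable :: "'x measure \<Rightarrow> ('x \<Rightarrow> 'b::euclidean_space) \<Rightarrow> bool" where
  "square_integrable M f \<longleftrightarrow> f \<in> borel_measurable M \<and> integrable M (\<lambda>x. (norm (f x))\<^sup>2)"

lemma square_integrable_bound:
  fixes g :: "'x \<Rightarrow> real"
  assumes f: "integrable M g" and h: "h \<in> borel_measurable M"
    and le: "\<And>x. x \<in> space M \<Longrightarrow> (norm (h x))\<^sup>2 \<le> g x"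
  shows "square_integrable M h"
  unfolding square_integrable_def
proof
  show "integrable M (\<lambda>x. (norm (h x))\<^sup>2)"
    using h by (intro Bochner_Integration.integrable_bound[OF f]) (auto intro!: AE_I2 order_trans[OF le])
qed (rule h)

lemma norm_add_squared_le:
  fixes a b :: "'b::real_normed_vector"
  shows "(norm (a + b))\<^sup>2 \<le> 2 * (norm a)\<^sup>2 + 2 * (norm b)\<^sup>2"
proof -
  have "(norm (a + b))\<^sup>2 \<le> (norm a + norm b)\<^sup>2"
    by (intro power_mono norm_triangle_ineq) auto
  also have "\<dots> \<le> 2 * (norm a)\<^sup>2 + 2 * (norm b)\<^sup>2"
    using sum_squares_bound[of "norm a" "norm b"] by (simp add: power2_sum)
  finally show ?thesis .
qed

lemma square_integrable_add:
  assumes "square_integrable M f" "square_integrable M g"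
  shows "square_integrable M (\<lambda>x. f x + g x)"
  using assms norm_add_squared_le
  by (intro square_integrable_bound[of M "\<lambda>x. 2 * (norm (f x))\<^sup>2 + 2 * (norm (g x))\<^sup>2"])
    (auto simp: square_integrable_def)

lemma square_integrable_scaleR:
  assumes "square_integrable M f"
  shows "square_integrable M (\<lambda>x. c *\<^sub>R f x)"
  using assms by (auto simp: square_integrable_def power_mult_distrib)

lemma square_integrable_diff:
  assumes "square_integrable M f" "square_integrable M g"
  shows "square_integrable M (\<lambda>x. f x - g x)"
  using square_integrable_add[OF assms(1) square_integrable_scaleR[OF assms(2), of "-1"]] by simp

text \<open>
  Along a subsequence with \<open>\<integral> d\<^sub>k\<^sup>2 < 4\<^sup>-\<^sup>k\<close>, where \<open>d\<^sub>k\<close> is the norm of the \<open>k\<close>-th increment, the series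
  of \<open>2\<^sup>k d\<^sub>k\<^sup>2\<close> converges almost everywhere, and \<open>d\<^sub>k \<le> 2\<^sup>-\<^sup>k + 2\<^sup>k d\<^sub>k\<^sup>2\<close> makes the subsequence converge
  absolutely. Fatou's lemma turns this into convergence in mean square. The limit is a pointwise limit
  or zero everywhere, not just almost everywhere, so that pointwise linear constraints on the sequence
  are inherited.
\<close>

lemma Riesz_Fischer:
  fixes X :: "nat \<Rightarrow> 'x \<Rightarrow> 'b::euclidean_space"
  assumes X: "\<And>n. square_integrable M (X n)"
    and cauchy: "\<And>e. e > 0 \<Longrightarrow> \<exists>N. \<forall>m\<ge>N. \<forall>n\<ge>N. (\<integral>x. (norm (X m x - X n x))\<^sup>2 \<partial>M) < e"
  obtains r L where "square_integrable M L" "\<And>x. L x = 0 \<or> (\<lambda>k. X (r k :: nat) x) \<longlonglongrightarrow> L x"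
    "(\<lambda>n. \<integral>x. (norm (X n x - L x))\<^sup>2 \<partial>M) \<longlonglongrightarrow> 0"
proof -
  have [measurable]: "X n \<in> borel_measurable M" for n
    using X by (simp add: square_integrable_def)
  have diff_integrable: "integrable M (\<lambda>x. (norm (X m x - X n x))\<^sup>2)" for m n
    using square_integrable_diff[OF X X, of m n] by (simp add: square_integrable_def)
  have "\<forall>k. \<exists>N. \<forall>m\<ge>N. \<forall>n\<ge>N. (\<integral>x. (norm (X m x - X n x))\<^sup>2 \<partial>M) < (1/4)^k"
    using cauchy by simp
  then obtain N where N: "\<And>k m n. m \<ge> N k \<Longrightarrow> n \<ge> N k \<Longrightarrow> (\<integral>x. (norm (X m x - X n x))\<^sup>2 \<partial>M) < (1/4)^k"
    by metis
  \<comment> \<open>Partial sums make the subsequence increasing and keep it above every threshold.\<close>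
  define r where "r k = (\<Sum>i\<le>k. Suc (N i))" for k
  have r_N: "r k \<ge> N k" "r (Suc k) \<ge> N k" "r k \<ge> k" for k
    by (auto simp: r_def lessThan_Suc_atMost[symmetric] intro: order_trans[OF _ sum_mono[of "{..k}" "\<lambda>_. 1"]])
      (induction k; simp)+
  define d where "d k x = norm (X (r (Suc k)) x - X (r k) x)" for k x
  define g where "g k x = (2::real)^k * (d k x)\<^sup>2" for k x
  have [measurable]: "d k \<in> borel_measurable M" for k
    unfolding d_def by measurable
  have [measurable]: "g k \<in> borel_measurable M" for k
    unfolding g_def by measurable
  have g_int: "(\<integral>\<^sup>+x. ennreal (g k x) \<partial>M) \<le> ennreal ((1/2)^k)" for k
  proof -
    have "(\<integral>\<^sup>+x. ennreal (g k x) \<partial>M) = ennreal (\<integral>x. g k x \<partial>M)"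
      unfolding g_def d_def by (intro nn_integral_eq_integral) (auto simp: diff_integrable)
    also have "(\<integral>x. g k x \<partial>M) = 2^k * (\<integral>x. (d k x)\<^sup>2 \<partial>M)"
      unfolding g_def by simp
    also have "\<dots> \<le> 2^k * (1/4)^k"
      unfolding d_def using less_imp_le[OF N[OF r_N(2,1)]] by (intro mult_left_mono) auto
    also have "\<dots> = (1/2)^k"
      by (simp flip: power_mult_distrib)
    finally show ?thesis
      by (simp add: ennreal_leI)
  qed
  have "(\<integral>\<^sup>+x. (\<Sum>k. ennreal (g k x)) \<partial>M) = (\<Sum>k. \<integral>\<^sup>+x. ennreal (g k x) \<partial>M)"
    unfolding g_def by (intro nn_integral_suminf) measurable
  also have "\<dots> \<le> (\<Sum>k. ennreal ((1/2)^k))"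
    by (intro suminf_le g_int) auto
  also have "\<dots> = ennreal (\<Sum>k. (1/2)^k)"
    by (intro suminf_ennreal2) auto
  finally have "(\<integral>\<^sup>+x. (\<Sum>k. ennreal (g k x)) \<partial>M) \<noteq> \<infinity>"
    by (auto simp: top_unique)
  then have "AE x in M. (\<Sum>k. ennreal (g k x)) \<noteq> \<infinity>"
    by (intro nn_integral_noteq_infinite) auto
  then have conv: "AE x in M. Cauchy (\<lambda>k. X (r k) x)"
  proof eventually_elim
    case (elim x)
    have "summable (\<lambda>k. g k x)"
      using elim by (intro summable_suminf_not_top) (auto simp: g_def)
    then have sum: "summable (\<lambda>k. (1/2)^k + g k x)"
      by (intro summable_add) auto
    have "summable (\<lambda>k. d k x)"
    proof (rule summable_comparison_test'[OF sum])
      fix k :: nat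
      have "d k x * 2^k \<le> ((1/2)^k + g k x) * 2^k"
        using sum_squares_bound[of 1 "2^k * d k x"] zero_le_power2[of "2^k * d k x"]
        by (simp add: g_def algebra_simps power2_eq_square power_one_over)
      then show "norm (d k x) \<le> (1/2)^k + g k x"
        by (simp add: d_def)
    qed
    then have "summable (\<lambda>k. X (r (Suc k)) x - X (r k) x)"
      unfolding d_def by (rule summable_norm_cancel)
    then have "convergent (\<lambda>n. X (r n) x - X (r 0) x)"
      by (simp add: summable_iff_convergent sum_lessThan_telescope[of "\<lambda>n. X (r n) x"])
    then have "convergent (\<lambda>n. (X (r n) x - X (r 0) x) + X (r 0) x)"
      by (intro convergent_add convergent_const)
    then show ?case
      by (simp add: Cauchy_convergent_iff)
  qed
  define L where "L x = (if Cauchy (\<lambda>k. X (r k) x) then lim (\<lambda>k. X (r k) x) else 0)" for x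
  have L_lim: "(\<lambda>k. X (r k) x) \<longlonglongrightarrow> L x" if "Cauchy (\<lambda>k. X (r k) x)" for x
    using that by (simp add: L_def Cauchy_convergent_iff convergent_LIMSEQ_iff)
  have [measurable]: "L \<in> borel_measurable M"
    unfolding L_def by measurable
  have small: "(\<integral>\<^sup>+x. ennreal ((norm (X n x - L x))\<^sup>2) \<partial>M) \<le> ennreal e"
    if n: "\<And>m. m \<ge> n \<Longrightarrow> (\<integral>x. (norm (X n x - X m x))\<^sup>2 \<partial>M) \<le> e" for n e
  proof -
    have "AE x in M. ennreal ((norm (X n x - L x))\<^sup>2) = liminf (\<lambda>k. ennreal ((norm (X n x - X (r k) x))\<^sup>2))"
      using conv
    proof eventually_elim
      case (elim x)
      have "(\<lambda>k. ennreal ((norm (X n x - X (r k) x))\<^sup>2)) \<longlonglongrightarrow> ennreal ((norm (X n x - L x))\<^sup>2)"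
        by (intro tendsto_ennrealI tendsto_intros L_lim elim)
      from lim_imp_Liminf[OF _ this] show ?case
        by simp
    qed
    then have "(\<integral>\<^sup>+x. ennreal ((norm (X n x - L x))\<^sup>2) \<partial>M) =
        (\<integral>\<^sup>+x. liminf (\<lambda>k. ennreal ((norm (X n x - X (r k) x))\<^sup>2)) \<partial>M)"
      by (rule nn_integral_cong_AE)
    also have "\<dots> \<le> liminf (\<lambda>k. \<integral>\<^sup>+x. ennreal ((norm (X n x - X (r k) x))\<^sup>2) \<partial>M)"
      by (intro nn_integral_liminf) measurable
    also have "\<dots> \<le> limsup (\<lambda>k. \<integral>\<^sup>+x. ennreal ((norm (X n x - X (r k) x))\<^sup>2) \<partial>M)"
      by (intro Liminf_le_Limsup) simp
    also have "\<dots> \<le> ennreal e"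
    proof (rule Limsup_bounded)
      show "\<forall>\<^sub>F k in sequentially. (\<integral>\<^sup>+x. ennreal ((norm (X n x - X (r k) x))\<^sup>2) \<partial>M) \<le> ennreal e"
        using eventually_ge_at_top[of n]
      proof eventually_elim
        case (elim k)
        have "(\<integral>\<^sup>+x. ennreal ((norm (X n x - X (r k) x))\<^sup>2) \<partial>M) =
            ennreal (\<integral>x. (norm (X n x - X (r k) x))\<^sup>2 \<partial>M)"
          by (intro nn_integral_eq_integral diff_integrable) auto
        then show ?case
          using n[of "r k"] r_N(3)[of k] elim by (simp add: ennreal_leI)
      qed
    qed
    finally show ?thesis .
  qed
  have small': "square_integrable M (\<lambda>x. X n x - L x) \<and> (\<integral>x. (norm (X n x - L x))\<^sup>2 \<partial>M) \<le> e"
    if n: "\<And>m. m \<ge> n \<Longrightarrow> (\<integral>x. (norm (X n x - X m x))\<^sup>2 \<partial>M) \<le> e" for n e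
  proof -
    have "0 \<le> (\<integral>x. (norm (X n x - X n x))\<^sup>2 \<partial>M)"
      by simp
    also have "\<dots> \<le> e"
      by (rule n) simp
    finally have e: "e \<ge> 0" .
    show ?thesis
      unfolding square_integrable_def
    proof (intro conjI)
      show "integrable M (\<lambda>x. (norm (X n x - L x))\<^sup>2)"
        using small[OF n] by (intro integrableI_nonneg) (auto intro: le_less_trans)
      show "(\<integral>x. (norm (X n x - L x))\<^sup>2 \<partial>M) \<le> e"
        using small[OF n] e by (intro integral_real_bounded)
    qed measurable
  qed
  show thesis
  proof (rule that)
    obtain n where n: "\<forall>m\<ge>n. \<forall>k\<ge>n. (\<integral>x. (norm (X m x - X k x))\<^sup>2 \<partial>M) < 1"
      using cauchy[of 1] by auto
    have "square_integrable M (\<lambda>x. X n x - L x)"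
      using n by (intro small'[THEN conjunct1, of n 1]) (simp add: less_imp_le)
    then have "square_integrable M (\<lambda>x. X n x - (X n x - L x))"
      by (rule square_integrable_diff[OF X])
    then show "square_integrable M L"
      by simp
    show "L x = 0 \<or> (\<lambda>k. X (r k) x) \<longlonglongrightarrow> L x" for x
      using L_lim[of x] by (auto simp: L_def)
    show "(\<lambda>n. \<integral>x. (norm (X n x - L x))\<^sup>2 \<partial>M) \<longlonglongrightarrow> 0"
    proof (rule LIMSEQ_I)
      fix e :: real assume e: "e > 0"
      then obtain n0 where n0: "\<And>m n. m \<ge> n0 \<Longrightarrow> n \<ge> n0 \<Longrightarrow> (\<integral>x. (norm (X m x - X n x))\<^sup>2 \<partial>M) < e / 2"
        using cauchy[of "e / 2"] by auto
      show "\<exists>n0. \<forall>n\<ge>n0. norm ((\<integral>x. (norm (X n x - L x))\<^sup>2 \<partial>M) - 0) < e"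
      proof (intro exI allI impI)
        fix n assume n: "n \<ge> n0"
        then have "(\<integral>x. (norm (X n x - L x))\<^sup>2 \<partial>M) \<le> e / 2"
          using n0 by (intro small'[THEN conjunct2] less_imp_le) auto
        then show "norm ((\<integral>x. (norm (X n x - L x))\<^sup>2 \<partial>M) - 0) < e"
          using e by simp
      qed
    qed
  qed
qed

section \<open>The energy space of linear elasticity\<close>

lemma sum4_swap:
  fixes f :: "'i::finite \<Rightarrow> 'i \<Rightarrow> 'i \<Rightarrow> 'i \<Rightarrow> real"
  shows "(\<Sum>i\<in>UNIV. \<Sum>j\<in>UNIV. \<Sum>k\<in>UNIV. \<Sum>l\<in>UNIV. f i j k l) =
    (\<Sum>i\<in>UNIV. \<Sum>j\<in>UNIV. \<Sum>k\<in>UNIV. \<Sum>l\<in>UNIV. f k l i j)"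
proof -
  have "(\<Sum>i\<in>UNIV. \<Sum>j\<in>UNIV. \<Sum>k\<in>UNIV. \<Sum>l\<in>UNIV. f i j k l) = (\<Sum>i\<in>UNIV. \<Sum>k\<in>UNIV. \<Sum>j\<in>UNIV. \<Sum>l\<in>UNIV. f i j k l)"
    by (intro sum.cong refl sum.swap)
  also have "\<dots> = (\<Sum>k\<in>UNIV. \<Sum>i\<in>UNIV. \<Sum>j\<in>UNIV. \<Sum>l\<in>UNIV. f i j k l)"
    by (rule sum.swap)
  also have "\<dots> = (\<Sum>k\<in>UNIV. \<Sum>i\<in>UNIV. \<Sum>l\<in>UNIV. \<Sum>j\<in>UNIV. f i j k l)"
    by (intro sum.cong refl sum.swap)
  also have "\<dots> = (\<Sum>k\<in>UNIV. \<Sum>l\<in>UNIV. \<Sum>i\<in>UNIV. \<Sum>j\<in>UNIV. f i j k l)"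
    by (intro sum.cong refl sum.swap)
  finally show ?thesis .
qed

lemma sum2_linear:
  fixes T :: "'s \<Rightarrow> 'k \<Rightarrow> 'l \<Rightarrow> real"
  shows "(\<Sum>k\<in>K. \<Sum>l\<in>L. (\<Sum>s\<in>S. T s k l) * e k l) = (\<Sum>s\<in>S. \<Sum>k\<in>K. \<Sum>l\<in>L. T s k l * e k l)"
proof -
  have "(\<Sum>k\<in>K. \<Sum>l\<in>L. (\<Sum>s\<in>S. T s k l) * e k l) = (\<Sum>k\<in>K. \<Sum>s\<in>S. \<Sum>l\<in>L. T s k l * e k l)"
    unfolding sum_distrib_right by (intro sum.cong refl sum.swap)
  also have "\<dots> = (\<Sum>s\<in>S. \<Sum>k\<in>K. \<Sum>l\<in>L. T s k l * e k l)"
    by (rule sum.swap)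
  finally show ?thesis .
qed

lemma norm_matrix_squared:
  fixes e :: "real^'n^'m"
  shows "(norm e)\<^sup>2 = (\<Sum>i\<in>UNIV. \<Sum>j\<in>UNIV. e $ i $ j * e $ i $ j)"
  by (simp add: power2_norm_eq_inner inner_vec_def)

lemma norm_prod_squared: "(norm p)\<^sup>2 = (norm (fst p))\<^sup>2 + (norm (snd p))\<^sup>2"
  by (simp add: norm_prod_def)

lemma component_le_norm_pair:
  fixes p :: "(real^'n^'m) \<times> (real^'k)"
  shows "\<bar>fst p $ i $ j\<bar> \<le> norm p" "\<bar>snd p $ l\<bar> \<le> norm p"
proof -
  have "\<bar>fst p $ i $ j\<bar> \<le> norm (fst p $ i)"
    by (rule component_le_norm_cart)
  also have "\<dots> \<le> norm (fst p)"
    by (rule Finite_Cartesian_Product.norm_nth_le)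
  also have "\<dots> \<le> norm p"
    by (simp add: norm_prod_def)
  finally show "\<bar>fst p $ i $ j\<bar> \<le> norm p" .
  have "\<bar>snd p $ l\<bar> \<le> norm (snd p)"
    by (rule component_le_norm_cart)
  also have "\<dots> \<le> norm p"
    by (simp add: norm_prod_def)
  finally show "\<bar>snd p $ l\<bar> \<le> norm p" .
qed

lemma bounded_coefficients:
  fixes f :: "'i::finite \<Rightarrow> 'x::euclidean_space \<Rightarrow> real"
  assumes "bounded \<Omega>" and cont: "\<And>i. continuous_on (closure \<Omega>) (f i)"
  obtains K where "K \<ge> 0" "\<And>x i. x \<in> \<Omega> \<Longrightarrow> \<bar>f i x\<bar> \<le> K"
proof -
  have "\<exists>K. \<forall>x\<in>closure \<Omega>. \<bar>f i x\<bar> \<le> K" for i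
    using compact_imp_bounded[OF compact_continuous_image[OF cont, of i]] \<open>bounded \<Omega>\<close>
    by (auto simp: compact_closure bounded_iff)
  then obtain K where K: "\<And>i x. x \<in> closure \<Omega> \<Longrightarrow> \<bar>f i x\<bar> \<le> K i"
    by metis
  show thesis
  proof (rule that[of "\<Sum>i\<in>UNIV. \<bar>K i\<bar>"])
    fix x i assume "x \<in> \<Omega>"
    then have "\<bar>f i x\<bar> \<le> \<bar>K i\<bar>"
      using K[of x i] closure_subset[of \<Omega>] by fastforce
    also have "\<dots> \<le> (\<Sum>i\<in>UNIV. \<bar>K i\<bar>)"
      by (rule member_le_sum) auto
    finally show "\<bar>f i x\<bar> \<le> (\<Sum>i\<in>UNIV. \<bar>K i\<bar>)" .
  qed (simp add: sum_nonneg)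
qed

lemma borel_measurable_matrix:
  fixes f :: "'x \<Rightarrow> real^'n^'m"
  assumes "\<And>i j. (\<lambda>x. f x $ i $ j) \<in> borel_measurable M"
  shows "f \<in> borel_measurable M"
  unfolding borel_measurable_euclidean_space[of f]
  using assms by (auto simp: Basis_vec_def inner_axis)

text \<open>
  Strain and velocity together form one square integrable function with values in a Euclidean space.
  The symmetry of the strain holds at every point of the domain, not merely almost everywhere.
\<close>

lemma H_iff: "U \<in> H \<Omega> \<longleftrightarrow>
    square_integrable (lebesgue_on \<Omega>) U \<and> (\<forall>x\<in>\<Omega>. transpose (fst (U x)) = fst (U x))"
proof -
  have "square_integrable (lebesgue_on \<Omega>) U"
    if "square_integrable (lebesgue_on \<Omega>) (\<lambda>x. fst (U x))" "square_integrable (lebesgue_on \<Omega>) (\<lambda>x. snd (U x))"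
  proof -
    have "(\<lambda>x. (fst (U x), snd (U x))) \<in> borel_measurable (lebesgue_on \<Omega>)"
      using that by (intro borel_measurable_Pair) (auto simp: square_integrable_def)
    then show ?thesis
      using that by (auto simp: square_integrable_def norm_prod_squared)
  qed
  moreover have "square_integrable (lebesgue_on \<Omega>) (\<lambda>x. fst (U x))"
      "square_integrable (lebesgue_on \<Omega>) (\<lambda>x. snd (U x))"
    if U: "square_integrable (lebesgue_on \<Omega>) U"
  proof -
    have meas: "(\<lambda>x. fst (U x)) \<in> borel_measurable (lebesgue_on \<Omega>)"
      "(\<lambda>x. snd (U x)) \<in> borel_measurable (lebesgue_on \<Omega>)"
      using U by (auto simp: square_integrable_def intro!: borel_measurable_continuous_on[where g = U] continuous_intros)
    show "square_integrable (lebesgue_on \<Omega>) (\<lambda>x. fst (U x))"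
      "square_integrable (lebesgue_on \<Omega>) (\<lambda>x. snd (U x))"
      using U meas
      by (intro square_integrable_bound[of "lebesgue_on \<Omega>" "\<lambda>x. (norm (U x))\<^sup>2"];
          simp add: square_integrable_def norm_prod_squared[of "U _"])+
  qed
  ultimately have iff: "square_integrable (lebesgue_on \<Omega>) U \<longleftrightarrow>
      square_integrable (lebesgue_on \<Omega>) (\<lambda>x. fst (U x)) \<and> square_integrable (lebesgue_on \<Omega>) (\<lambda>x. snd (U x))"
    by blast
  show ?thesis
    unfolding H_def H0_def iff by (simp add: L2_def square_integrable_def conj_ac)
qed

definition energy_form :: "real \<Rightarrow> tensor4 \<Rightarrow> real^3 \<Rightarrow> (real^3^3) \<times> (real^3) \<Rightarrow> (real^3^3) \<times> (real^3) \<Rightarrow> real" where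
  "energy_form \<rho> C x p q =
    (\<Sum>i\<in>UNIV. \<Sum>j\<in>UNIV. \<Sum>k\<in>UNIV. \<Sum>l\<in>UNIV. C x i j k l * fst p $ k $ l * fst q $ i $ j)
    + (\<Sum>i\<in>UNIV. \<rho> * snd p $ i * snd q $ i)"

lemma inner_H_energy_form: "inner_H \<Omega> \<rho> C U V = (\<integral>x. energy_form \<rho> C x (U x) (V x) \<partial>lebesgue_on \<Omega>)"
  by (simp add: inner_H_def energy_form_def)

lemma energy_form_add_left: "energy_form \<rho> C x (p + p') q = energy_form \<rho> C x p q + energy_form \<rho> C x p' q"
  by (simp add: energy_form_def sum.distrib algebra_simps)

lemma energy_form_scale_left: "energy_form \<rho> C x (c *\<^sub>R p) q = c * energy_form \<rho> C x p q"
  by (simp add: energy_form_def sum_distrib_left algebra_simps)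

text \<open>
  Openness makes the body a measurable set; boundedness makes its closure compact and hence the
  continuous coefficients bounded.
\<close>

locale elastic_body =
  fixes \<Omega> :: "(real^3) set" and \<rho> a0 :: real and C :: tensor4
  assumes open_\<Omega>: "open \<Omega>" and bounded_\<Omega>: "bounded \<Omega>"
    and rho: "\<rho> > 0" and a0: "a0 > 0" and elasticity: "elasticity_tensor \<Omega> a0 C"
begin

lemma C_continuous: "continuous_on (closure \<Omega>) (\<lambda>x. C x i j k l)"
  using elasticity by (simp add: elasticity_tensor_def)

lemma C_symmetric:
  assumes "x \<in> \<Omega>"
  shows "C x i j k l = C x j i k l" "C x i j k l = C x i j l k" "C x i j k l = C x k l i j"
proof -
  have "x \<in> closure \<Omega>"
    using assms closure_subset by blast
  then show "C x i j k l = C x j i k l" "C x i j k l = C x i j l k" "C x i j k l = C x k l i j"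
    using elasticity unfolding elasticity_tensor_def by metis+
qed

lemma measurable_coefficient:
  "continuous_on (closure \<Omega>) f \<Longrightarrow> f \<in> borel_measurable (lebesgue_on \<Omega>)"
  using open_\<Omega> by (intro continuous_imp_measurable_on_sets_lebesgue)
    (auto intro: continuous_on_subset[OF _ closure_subset])

lemma measurable_components:
  fixes U :: "real^3 \<Rightarrow> (real^3^3) \<times> (real^3)"
  assumes "U \<in> borel_measurable (lebesgue_on \<Omega>)"
  shows "(\<lambda>x. fst (U x) $ i $ j) \<in> borel_measurable (lebesgue_on \<Omega>)"
    "(\<lambda>x. snd (U x) $ i) \<in> borel_measurable (lebesgue_on \<Omega>)"
  by (rule borel_measurable_continuous_on[OF _ assms], intro continuous_intros)+

lemma energy_form_commute:
  assumes "x \<in> \<Omega>"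
  shows "energy_form \<rho> C x p q = energy_form \<rho> C x q p"
proof -
  have "(\<Sum>i\<in>UNIV. \<Sum>j\<in>UNIV. \<Sum>k\<in>UNIV. \<Sum>l\<in>UNIV. C x i j k l * fst p $ k $ l * fst q $ i $ j) =
      (\<Sum>i\<in>UNIV. \<Sum>j\<in>UNIV. \<Sum>k\<in>UNIV. \<Sum>l\<in>UNIV. C x k l i j * fst p $ i $ j * fst q $ k $ l)"
    by (rule sum4_swap)
  also have "\<dots> = (\<Sum>i\<in>UNIV. \<Sum>j\<in>UNIV. \<Sum>k\<in>UNIV. \<Sum>l\<in>UNIV. C x i j k l * fst q $ k $ l * fst p $ i $ j)"
  proof (intro sum.cong refl)
    fix i j k l
    show "C x k l i j * fst p $ i $ j * fst q $ k $ l = C x i j k l * fst q $ k $ l * fst p $ i $ j"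
      using C_symmetric(3)[OF assms, of k l i j] by simp
  qed
  finally have "(\<Sum>i\<in>UNIV. \<Sum>j\<in>UNIV. \<Sum>k\<in>UNIV. \<Sum>l\<in>UNIV. C x i j k l * fst p $ k $ l * fst q $ i $ j) =
      (\<Sum>i\<in>UNIV. \<Sum>j\<in>UNIV. \<Sum>k\<in>UNIV. \<Sum>l\<in>UNIV. C x i j k l * fst q $ k $ l * fst p $ i $ j)" .
  moreover have "(\<Sum>i\<in>UNIV. \<rho> * snd p $ i * snd q $ i) = (\<Sum>i\<in>UNIV. \<rho> * snd q $ i * snd p $ i)"
    by (intro sum.cong refl) simp
  ultimately show ?thesis
    by (simp only: energy_form_def)
qed

lemma energy_form_bound:
  obtains K where "K \<ge> 0" "\<And>x p q. x \<in> \<Omega> \<Longrightarrow> \<bar>energy_form \<rho> C x p q\<bar> \<le> K * (norm p * norm q)"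
proof -
  obtain K where K0: "K \<ge> 0" and K':
    "\<And>x a. x \<in> \<Omega> \<Longrightarrow> \<bar>C x (fst a) (fst (snd a)) (fst (snd (snd a))) (snd (snd (snd a)))\<bar> \<le> K"
    using bounded_coefficients[OF bounded_\<Omega>,
        of "\<lambda>a x. C x (fst a) (fst (snd a)) (fst (snd (snd a))) (snd (snd (snd a)))"] C_continuous
    by blast
  have K: "\<bar>C x i j k l\<bar> \<le> K" if "x \<in> \<Omega>" for x i j k l
    using K'[OF that, of "(i, j, k, l)"] by simp
  show thesis
  proof (rule that[of "81 * K + 3 * \<rho>"])
    fix x and p q :: "(real^3^3) \<times> (real^3)" assume x: "x \<in> \<Omega>"
    have *: "\<bar>C x i j k l * fst p $ k $ l * fst q $ i $ j\<bar> \<le> K * (norm p * norm q)" for i j k l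
      using K0 K[OF x, of i j k l] component_le_norm_pair(1)[of p k l] component_le_norm_pair(1)[of q i j]
      by (auto simp: abs_mult mult.assoc intro!: mult_mono)
    have **: "\<bar>\<rho> * snd p $ i * snd q $ i\<bar> \<le> \<rho> * (norm p * norm q)" for i
      using rho component_le_norm_pair(2)[of p i] component_le_norm_pair(2)[of q i]
      by (auto simp: abs_mult mult.assoc intro!: mult_mono)
    have "\<bar>energy_form \<rho> C x p q\<bar> \<le>
        (\<Sum>i\<in>(UNIV::3 set). \<Sum>j\<in>(UNIV::3 set). \<Sum>k\<in>(UNIV::3 set). \<Sum>l\<in>(UNIV::3 set). K * (norm p * norm q))
        + (\<Sum>i\<in>(UNIV::3 set). \<rho> * (norm p * norm q))"
      unfolding energy_form_def
      by (intro order_trans[OF abs_triangle_ineq] add_mono order_trans[OF sum_abs] sum_mono * **)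
    then show "\<bar>energy_form \<rho> C x p q\<bar> \<le> (81 * K + 3 * \<rho>) * (norm p * norm q)"
      by (simp add: algebra_simps)
  qed (use K0 rho in simp)
qed

text \<open>
  Positive definiteness of the elasticities is available for symmetric strains only.
\<close>

lemma energy_form_coercive:
  assumes x: "x \<in> \<Omega>" and sym: "transpose (fst p) = fst p"
  shows "min a0 \<rho> * (norm p)\<^sup>2 \<le> energy_form \<rho> C x p p"
proof -
  have "a0 * (norm (fst p))\<^sup>2 \<le>
      (\<Sum>i\<in>UNIV. \<Sum>j\<in>UNIV. \<Sum>k\<in>UNIV. \<Sum>l\<in>UNIV. C x i j k l * fst p $ i $ j * fst p $ k $ l)"
  proof -
    have "x \<in> closure \<Omega>"
      using x closure_subset by blast
    then show ?thesis
      using elasticity sym unfolding norm_matrix_squared elasticity_tensor_def by blast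
  qed
  also have "\<dots> = (\<Sum>i\<in>UNIV. \<Sum>j\<in>UNIV. \<Sum>k\<in>UNIV. \<Sum>l\<in>UNIV. C x i j k l * fst p $ k $ l * fst p $ i $ j)"
    by (simp add: mult_ac)
  finally have "a0 * (norm (fst p))\<^sup>2 + \<rho> * (norm (snd p))\<^sup>2 \<le> energy_form \<rho> C x p p"
    by (simp add: energy_form_def power2_norm_eq_inner inner_vec_def sum_distrib_left mult.assoc)
  moreover have "min a0 \<rho> * (norm (fst p))\<^sup>2 \<le> a0 * (norm (fst p))\<^sup>2"
    "min a0 \<rho> * (norm (snd p))\<^sup>2 \<le> \<rho> * (norm (snd p))\<^sup>2"
    by (intro mult_right_mono; simp)+
  ultimately show ?thesis
    by (simp add: norm_prod_squared distrib_left)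
qed

lemma energy_form_integrable:
  assumes U: "square_integrable (lebesgue_on \<Omega>) U" and V: "square_integrable (lebesgue_on \<Omega>) V"
  shows "integrable (lebesgue_on \<Omega>) (\<lambda>x. energy_form \<rho> C x (U x) (V x))"
proof -
  obtain K where K: "K \<ge> 0" "\<And>x p q. x \<in> \<Omega> \<Longrightarrow> \<bar>energy_form \<rho> C x p q\<bar> \<le> K * (norm p * norm q)"
    using energy_form_bound by metis
  show ?thesis
  proof (rule Bochner_Integration.integrable_bound)
    show "integrable (lebesgue_on \<Omega>) (\<lambda>x. K * ((norm (U x))\<^sup>2 + (norm (V x))\<^sup>2))"
      using U V by (auto simp: square_integrable_def)
    have meas: "U \<in> borel_measurable (lebesgue_on \<Omega>)" "V \<in> borel_measurable (lebesgue_on \<Omega>)"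
      using U V by (auto simp: square_integrable_def)
    show "(\<lambda>x. energy_form \<rho> C x (U x) (V x)) \<in> borel_measurable (lebesgue_on \<Omega>)"
      unfolding energy_form_def
      by (intro borel_measurable_add borel_measurable_sum borel_measurable_times borel_measurable_const
          measurable_components meas measurable_coefficient C_continuous)
    show "AE x in lebesgue_on \<Omega>. norm (energy_form \<rho> C x (U x) (V x)) \<le> norm (K * ((norm (U x))\<^sup>2 + (norm (V x))\<^sup>2))"
    proof (rule AE_I2)
      fix x assume "x \<in> space (lebesgue_on \<Omega>)"
      then have "\<bar>energy_form \<rho> C x (U x) (V x)\<bar> \<le> K * (norm (U x) * norm (V x))"
        using K(2) by simp
      also have "\<dots> \<le> K * ((norm (U x))\<^sup>2 + (norm (V x))\<^sup>2)"
      proof (rule mult_left_mono[OF _ K(1)])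
        have "0 \<le> norm (U x) * norm (V x)"
          by simp
        then show "norm (U x) * norm (V x) \<le> (norm (U x))\<^sup>2 + (norm (V x))\<^sup>2"
          using sum_squares_bound[of "norm (U x)" "norm (V x)"] by linarith
      qed
      finally show "norm (energy_form \<rho> C x (U x) (V x)) \<le> norm (K * ((norm (U x))\<^sup>2 + (norm (V x))\<^sup>2))"
        using K(1) by simp
    qed
  qed
qed

lemma H_squareD: "U \<in> H \<Omega> \<Longrightarrow> square_integrable (lebesgue_on \<Omega>) U"
  and H_symD: "U \<in> H \<Omega> \<Longrightarrow> x \<in> \<Omega> \<Longrightarrow> transpose (fst (U x)) = fst (U x)"
  by (auto simp: H_iff)

text \<open>
  The energy norm and the mean square norm are equivalent, so the former inherits completeness.
\<close>

lemma inner_H_self_bounds: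
  obtains c K where "c > 0" "K \<ge> 0"
    "\<And>U. U \<in> H \<Omega> \<Longrightarrow> c * (\<integral>x. (norm (U x))\<^sup>2 \<partial>lebesgue_on \<Omega>) \<le> inner_H \<Omega> \<rho> C U U"
    "\<And>U. U \<in> H \<Omega> \<Longrightarrow> inner_H \<Omega> \<rho> C U U \<le> K * (\<integral>x. (norm (U x))\<^sup>2 \<partial>lebesgue_on \<Omega>)"
proof -
  obtain K where K: "K \<ge> 0" "\<And>x p q. x \<in> \<Omega> \<Longrightarrow> \<bar>energy_form \<rho> C x p q\<bar> \<le> K * (norm p * norm q)"
    using energy_form_bound by metis
  have int: "integrable (lebesgue_on \<Omega>) (\<lambda>x. (norm (U x))\<^sup>2)"
      "integrable (lebesgue_on \<Omega>) (\<lambda>x. energy_form \<rho> C x (U x) (U x))" if "U \<in> H \<Omega>" for U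
    using H_squareD[OF that] energy_form_integrable by (auto simp: square_integrable_def)
  show thesis
  proof (rule that[of "min a0 \<rho>" K])
    fix U assume U: "U \<in> H \<Omega>"
    have "(\<integral>x. min a0 \<rho> * (norm (U x))\<^sup>2 \<partial>lebesgue_on \<Omega>) \<le> inner_H \<Omega> \<rho> C U U"
      unfolding inner_H_energy_form using int[OF U] energy_form_coercive H_symD[OF U]
      by (intro integral_mono) auto
    then show "min a0 \<rho> * (\<integral>x. (norm (U x))\<^sup>2 \<partial>lebesgue_on \<Omega>) \<le> inner_H \<Omega> \<rho> C U U"
      by simp
    have "inner_H \<Omega> \<rho> C U U \<le> (\<integral>x. K * (norm (U x))\<^sup>2 \<partial>lebesgue_on \<Omega>)"
      unfolding inner_H_energy_form using int[OF U] K(2)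
      by (intro integral_mono) (auto simp: power2_eq_square abs_le_iff)
    then show "inner_H \<Omega> \<rho> C U U \<le> K * (\<integral>x. (norm (U x))\<^sup>2 \<partial>lebesgue_on \<Omega>)"
      by simp
  qed (use K rho a0 in auto)
qed

lemma subspace_H: "subspace (H \<Omega>)"
proof -
  have "0 \<in> H \<Omega>"
    by (auto simp: H_iff square_integrable_def zero_fun_def transpose_def vec_eq_iff)
  moreover have "U + V \<in> H \<Omega>" if "U \<in> H \<Omega>" "V \<in> H \<Omega>" for U V
    using that square_integrable_add[of "lebesgue_on \<Omega>" U V]
    by (auto simp: H_iff plus_fun_def transpose_def vec_eq_iff)
  moreover have "c *\<^sub>R U \<in> H \<Omega>" if "U \<in> H \<Omega>" for c U
    using that square_integrable_scaleR[of "lebesgue_on \<Omega>" U c]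
    by (auto simp: H_iff scaleR_fun_def transpose_def vec_eq_iff)
  ultimately show ?thesis
    by (simp add: subspace_def)
qed

theorem semi_hilbert_H: "semi_hilbert (H \<Omega>) (inner_H \<Omega> \<rho> C)"
proof
  show "subspace (H \<Omega>)"
    by (rule subspace_H)
  obtain c K where c: "c > 0" and K: "K \<ge> 0"
    and lower: "\<And>U. U \<in> H \<Omega> \<Longrightarrow> c * (\<integral>x. (norm (U x))\<^sup>2 \<partial>lebesgue_on \<Omega>) \<le> inner_H \<Omega> \<rho> C U U"
    and upper: "\<And>U. U \<in> H \<Omega> \<Longrightarrow> inner_H \<Omega> \<rho> C U U \<le> K * (\<integral>x. (norm (U x))\<^sup>2 \<partial>lebesgue_on \<Omega>)"
    using inner_H_self_bounds by metis
  {
    fix U V assume "U \<in> H \<Omega>" "V \<in> H \<Omega>"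
    show "inner_H \<Omega> \<rho> C U V = inner_H \<Omega> \<rho> C V U"
      unfolding inner_H_energy_form
      by (intro Bochner_Integration.integral_cong refl energy_form_commute) simp
  next
    fix U V W assume "U \<in> H \<Omega>" "V \<in> H \<Omega>" "W \<in> H \<Omega>"
    then show "inner_H \<Omega> \<rho> C (U + V) W = inner_H \<Omega> \<rho> C U W + inner_H \<Omega> \<rho> C V W"
      unfolding inner_H_energy_form plus_fun_def energy_form_add_left
      by (intro Bochner_Integration.integral_add energy_form_integrable H_squareD)
  next
    fix c U V
    show "inner_H \<Omega> \<rho> C (c *\<^sub>R U) V = c * inner_H \<Omega> \<rho> C U V"
      unfolding inner_H_energy_form scaleR_fun_def energy_form_scale_left by simp
  next
    fix U assume "U \<in> H \<Omega>"
    then have "c * (\<integral>x. (norm (U x))\<^sup>2 \<partial>lebesgue_on \<Omega>) \<le> inner_H \<Omega> \<rho> C U U"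
      by (rule lower)
    moreover have "0 \<le> c * (\<integral>x. (norm (U x))\<^sup>2 \<partial>lebesgue_on \<Omega>)"
      using c by simp
    ultimately show "0 \<le> inner_H \<Omega> \<rho> C U U"
      by linarith
  next
    fix X :: "nat \<Rightarrow> state"
    assume X: "\<And>n. X n \<in> H \<Omega>"
      and cauchy: "\<And>e. e > 0 \<Longrightarrow> \<exists>N. \<forall>m\<ge>N. \<forall>n\<ge>N. inner_H \<Omega> \<rho> C (X m - X n) (X m - X n) < e"
    have diff: "U - V \<in> H \<Omega>" if "U \<in> H \<Omega>" "V \<in> H \<Omega>" for U V
      using subspace_diff[OF subspace_H that] .
    obtain r L where L: "square_integrable (lebesgue_on \<Omega>) L"
      "\<And>x. L x = 0 \<or> (\<lambda>k. X (r k :: nat) x) \<longlonglongrightarrow> L x"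
      and lim: "(\<lambda>n. \<integral>x. (norm (X n x - L x))\<^sup>2 \<partial>lebesgue_on \<Omega>) \<longlonglongrightarrow> 0"
    proof (rule Riesz_Fischer)
      show "square_integrable (lebesgue_on \<Omega>) (X n)" for n
        by (rule H_squareD[OF X])
      fix e :: real assume e: "e > 0"
      obtain N where N: "\<And>m n. m \<ge> N \<Longrightarrow> n \<ge> N \<Longrightarrow> inner_H \<Omega> \<rho> C (X m - X n) (X m - X n) < c * e"
        using cauchy[of "c * e"] c e by auto
      have "(\<integral>x. (norm (X m x - X n x))\<^sup>2 \<partial>lebesgue_on \<Omega>) < e" if "m \<ge> N" "n \<ge> N" for m n
      proof -
        have "c * (\<integral>x. (norm (X m x - X n x))\<^sup>2 \<partial>lebesgue_on \<Omega>) < c * e"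
          using le_less_trans[OF lower[OF diff[OF X X]] N[OF that]] by simp
        then show ?thesis
          using c by simp
      qed
      then show "\<exists>N. \<forall>m\<ge>N. \<forall>n\<ge>N. (\<integral>x. (norm (X m x - X n x))\<^sup>2 \<partial>lebesgue_on \<Omega>) < e"
        by blast
    qed blast
    have "transpose (fst (L x)) = fst (L x)" if x: "x \<in> \<Omega>" for x
      using L(2)[of x]
    proof
      assume "L x = 0"
      then show ?thesis
        by (simp add: transpose_def vec_eq_iff)
    next
      assume lim: "(\<lambda>k. X (r k) x) \<longlonglongrightarrow> L x"
      have "fst (L x) $ j $ i = fst (L x) $ i $ j" for i j
      proof (rule LIMSEQ_unique)
        show "(\<lambda>k. fst (X (r k) x) $ i $ j) \<longlonglongrightarrow> fst (L x) $ i $ j"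
          by (intro tendsto_intros lim)
        have "fst (X n x) $ i $ j = fst (X n x) $ j $ i" for n
          using arg_cong[OF H_symD[OF X x, of n], of "\<lambda>e. e $ j $ i"] by (simp add: transpose_def)
        then have "(\<lambda>k. fst (X (r k) x) $ i $ j) = (\<lambda>k. fst (X (r k) x) $ j $ i)"
          by (intro ext)
        moreover have "(\<lambda>k. fst (X (r k) x) $ j $ i) \<longlonglongrightarrow> fst (L x) $ j $ i"
          by (intro tendsto_intros lim)
        ultimately show "(\<lambda>k. fst (X (r k) x) $ i $ j) \<longlonglongrightarrow> fst (L x) $ j $ i"
          by metis
      qed
      then show ?thesis
        by (simp add: transpose_def vec_eq_iff)
    qed
    then have LH: "L \<in> H \<Omega>"
      using L(1) by (simp add: H_iff)
    have "(\<lambda>n. inner_H \<Omega> \<rho> C (X n - L) (X n - L)) \<longlonglongrightarrow> 0"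
    proof (rule Lim_null_comparison)
      show "(\<lambda>n. K * (\<integral>x. (norm (X n x - L x))\<^sup>2 \<partial>lebesgue_on \<Omega>)) \<longlonglongrightarrow> 0"
        by (rule tendsto_mult_right_zero[OF lim])
      have "norm (inner_H \<Omega> \<rho> C (X n - L) (X n - L)) \<le> K * (\<integral>x. (norm (X n x - L x))\<^sup>2 \<partial>lebesgue_on \<Omega>)" for n
      proof -
        have "0 \<le> c * (\<integral>x. (norm ((X n - L) x))\<^sup>2 \<partial>lebesgue_on \<Omega>)"
          using c by simp
        then show ?thesis
          using lower[OF diff[OF X[of n] LH]] upper[OF diff[OF X[of n] LH]] by simp
      qed
      then show "\<forall>\<^sub>F n in sequentially. norm (inner_H \<Omega> \<rho> C (X n - L) (X n - L))
          \<le> K * (\<integral>x. (norm (X n x - L x))\<^sup>2 \<partial>lebesgue_on \<Omega>)"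
        by simp
    qed
    then show "\<exists>L\<in>H \<Omega>. (\<lambda>n. inner_H \<Omega> \<rho> C (X n - L) (X n - L)) \<longlonglongrightarrow> 0"
      using LH by blast
  }
qed

end

section \<open>The damping operator\<close>

definition stress :: "tensor4 \<Rightarrow> real^3 \<Rightarrow> real^3^3 \<Rightarrow> 3 \<Rightarrow> 3 \<Rightarrow> real" where
  "stress C x e i j = (\<Sum>k\<in>UNIV. \<Sum>l\<in>UNIV. C x i j k l * e $ k $ l)"

text \<open>
  The pointwise value of the constraint operator, as a function of the strain alone.
\<close>

definition constraint_vector :: "tensor4 \<Rightarrow> (real^3 \<Rightarrow> real^3^3) \<Rightarrow> real^3 \<Rightarrow> real^3^3 \<Rightarrow> 3 \<Rightarrow> real" where
  "constraint_vector C \<alpha> x e s =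
    (\<Sum>m\<in>UNIV. \<Sum>n\<in>UNIV. \<Sum>p\<in>UNIV. perm_symbol s m n * \<alpha> x $ p $ n * stress C x e p m)"

text \<open>
  The zeroth order term by which the two generators differ.
\<close>

definition damping :: "tensor4 \<Rightarrow> (real^3 \<Rightarrow> real^3^3) \<Rightarrow> state \<Rightarrow> state" where
  "damping C \<alpha> U = (\<lambda>x. (ddot (sym_pairs (B_tensor \<alpha> C)) (\<lambda>x. fst (U x)) x, 0))"

lemma op_A_eq: "op_A \<Omega> \<rho> C \<alpha> U = op_A1 \<Omega> \<rho> C U - damping C \<alpha> U"
  by (auto simp: fun_eq_iff op_A_def op_A1_def damping_def)

lemma op_D_eq: "op_D C \<alpha> U x $ s = constraint_vector C \<alpha> x (fst (U x)) s"
  by (simp add: op_D_def constraint_vector_def stress_def sum_distrib_left mult.assoc)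

lemma B_tensor_contract:
  "(\<Sum>k\<in>UNIV. \<Sum>l\<in>UNIV. B_tensor \<alpha> C x i j k l * e $ k $ l) =
    (\<Sum>s\<in>UNIV. \<Sum>r\<in>UNIV. perm_symbol s j r * \<alpha> x $ i $ r * constraint_vector C \<alpha> x e s)"
  unfolding B_tensor_def constraint_vector_def stress_def sum2_linear[where e = "\<lambda>k l. e $ k $ l"]
  by (simp add: sum_distrib_left mult.assoc)

text \<open>
  Symmetrising in the second pair of indices has no effect on the contraction with a symmetric tensor.
\<close>

lemma sym_pairs_contract:
  assumes "transpose e = e"
  shows "(\<Sum>k\<in>UNIV. \<Sum>l\<in>UNIV. sym_pairs T x i j k l * e $ k $ l) =
    ((\<Sum>k\<in>UNIV. \<Sum>l\<in>UNIV. T x i j k l * e $ k $ l) + (\<Sum>k\<in>UNIV. \<Sum>l\<in>UNIV. T x j i k l * e $ k $ l)) / 2"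
proof -
  have sym: "e $ k $ l = e $ l $ k" for k l
    using arg_cong[OF assms, of "\<lambda>e. e $ l $ k"] by (simp add: transpose_def)
  have swap: "(\<Sum>k\<in>UNIV. \<Sum>l\<in>UNIV. T x a b l k * e $ k $ l) = (\<Sum>k\<in>UNIV. \<Sum>l\<in>UNIV. T x a b k l * e $ k $ l)" for a b
  proof -
    have "(\<Sum>k\<in>UNIV. \<Sum>l\<in>UNIV. T x a b l k * e $ k $ l) = (\<Sum>l\<in>UNIV. \<Sum>k\<in>UNIV. T x a b l k * e $ k $ l)"
      by (rule sum.swap)
    also have "\<dots> = (\<Sum>l\<in>UNIV. \<Sum>k\<in>UNIV. T x a b l k * e $ l $ k)"
      by (intro sum.cong refl arg_cong2[where f = "(*)"] sym)
    finally show ?thesis .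
  qed
  have "(\<Sum>k\<in>UNIV. \<Sum>l\<in>UNIV. sym_pairs T x i j k l * e $ k $ l) =
      ((\<Sum>k\<in>UNIV. \<Sum>l\<in>UNIV. T x i j k l * e $ k $ l) + (\<Sum>k\<in>UNIV. \<Sum>l\<in>UNIV. T x j i k l * e $ k $ l)
       + (\<Sum>k\<in>UNIV. \<Sum>l\<in>UNIV. T x i j l k * e $ k $ l) + (\<Sum>k\<in>UNIV. \<Sum>l\<in>UNIV. T x j i l k * e $ k $ l)) / 4"
    by (simp add: sym_pairs_def sum.distrib distrib_right add_divide_distrib sum_divide_distrib)
  then show ?thesis
    unfolding swap by simp
qed

context elastic_body
begin

lemma stress_symmetric: "x \<in> \<Omega> \<Longrightarrow> stress C x e i j = stress C x e j i"
  unfolding stress_def by (intro sum.cong refl arg_cong2[where f = "(*)"] C_symmetric(1))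

lemma energy_form_stress:
  assumes x: "x \<in> \<Omega>"
  shows "energy_form \<rho> C x (G, 0) q = (\<Sum>i\<in>UNIV. \<Sum>j\<in>UNIV. G $ i $ j * stress C x (fst q) i j)"
proof -
  have "energy_form \<rho> C x (G, 0) q = energy_form \<rho> C x q (G, 0)"
    by (rule energy_form_commute[OF x])
  then show ?thesis
    by (simp add: energy_form_def stress_def sum_distrib_left mult_ac)
qed

text \<open>
  The damping tensor sends a strain to the symmetric part of \<open>b i j = e\<^sub>s\<^sub>j\<^sub>r \<alpha>\<^sub>i\<^sub>r D\<^sub>s\<close>. Pairing this with the
  symmetric stress \<open>\<tau>\<close> of the other state, the symmetrisation drops out and the sum over \<open>i\<close>, \<open>j\<close>, \<open>r\<close>
  of \<open>e\<^sub>s\<^sub>j\<^sub>r \<alpha>\<^sub>i\<^sub>r \<tau>\<^sub>i\<^sub>j\<close> is again a component of the constraint vector.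
\<close>

lemma energy_form_damping:
  assumes x: "x \<in> \<Omega>" and sym: "transpose (fst (U x)) = fst (U x)"
  shows "energy_form \<rho> C x (damping C \<alpha> U x) q =
    (\<Sum>s\<in>UNIV. constraint_vector C \<alpha> x (fst (U x)) s * constraint_vector C \<alpha> x (fst q) s)"
proof -
  define D where "D s = constraint_vector C \<alpha> x (fst (U x)) s" for s
  define b where "b i j = (\<Sum>s\<in>UNIV. \<Sum>r\<in>UNIV. perm_symbol s j r * \<alpha> x $ i $ r * D s)" for i j
  define \<tau> where "\<tau> i j = stress C x (fst q) i j" for i j
  have \<tau>_sym: "\<tau> i j = \<tau> j i" for i j
    unfolding \<tau>_def by (rule stress_symmetric[OF x])
  have "energy_form \<rho> C x (damping C \<alpha> U x) q = (\<Sum>i\<in>UNIV. \<Sum>j\<in>UNIV. (b i j + b j i) / 2 * \<tau> i j)"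
    unfolding damping_def energy_form_stress[OF x] \<tau>_def b_def D_def
    by (simp add: ddot_def sym_pairs_contract[OF sym] B_tensor_contract)
  also have "\<dots> = ((\<Sum>i\<in>UNIV. \<Sum>j\<in>UNIV. b i j * \<tau> i j) + (\<Sum>i\<in>UNIV. \<Sum>j\<in>UNIV. b j i * \<tau> i j)) / 2"
    by (simp add: add_divide_distrib sum_divide_distrib sum.distrib distrib_right)
  also have "(\<Sum>i\<in>UNIV. \<Sum>j\<in>UNIV. b j i * \<tau> i j) = (\<Sum>j\<in>UNIV. \<Sum>i\<in>UNIV. b j i * \<tau> i j)"
    by (rule sum.swap)
  also have "\<dots> = (\<Sum>j\<in>UNIV. \<Sum>i\<in>UNIV. b j i * \<tau> j i)"
    by (intro sum.cong refl arg_cong2[where f = "(*)"] \<tau>_sym)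
  also have "((\<Sum>i\<in>UNIV. \<Sum>j\<in>UNIV. b i j * \<tau> i j) + (\<Sum>j\<in>UNIV. \<Sum>i\<in>UNIV. b j i * \<tau> j i)) / 2 =
      (\<Sum>i\<in>UNIV. \<Sum>j\<in>UNIV. b i j * \<tau> i j)"
    by simp
  also have "\<dots> = (\<Sum>i\<in>UNIV. \<Sum>j\<in>UNIV. \<Sum>s\<in>UNIV. \<Sum>r\<in>UNIV. D s * (perm_symbol s j r * \<alpha> x $ i $ r * \<tau> i j))"
    unfolding b_def sum_distrib_right by (intro sum.cong refl) simp
  also have "\<dots> = (\<Sum>s\<in>UNIV. \<Sum>r\<in>UNIV. \<Sum>i\<in>UNIV. \<Sum>j\<in>UNIV. D s * (perm_symbol s j r * \<alpha> x $ i $ r * \<tau> i j))"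
    by (rule sum4_swap)
  also have "\<dots> = (\<Sum>s\<in>UNIV. \<Sum>r\<in>UNIV. \<Sum>j\<in>UNIV. \<Sum>i\<in>UNIV. D s * (perm_symbol s j r * \<alpha> x $ i $ r * \<tau> i j))"
    by (intro sum.cong refl sum.swap)
  also have "\<dots> = (\<Sum>s\<in>UNIV. \<Sum>j\<in>UNIV. \<Sum>r\<in>UNIV. \<Sum>i\<in>UNIV. D s * (perm_symbol s j r * \<alpha> x $ i $ r * \<tau> i j))"
    by (intro sum.cong refl sum.swap)
  also have "\<dots> = (\<Sum>s\<in>UNIV. D s * constraint_vector C \<alpha> x (fst q) s)"
    unfolding constraint_vector_def \<tau>_def by (simp only: sum_distrib_left)
  finally show ?thesis
    unfolding D_def .
qed

lemma damping_in_H: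
  assumes \<alpha>: "continuous_on (closure \<Omega>) \<alpha>" and U: "U \<in> H \<Omega>"
  shows "damping C \<alpha> U \<in> H \<Omega>"
proof -
  define T where "T = sym_pairs (B_tensor \<alpha> C)"
  have T_cont: "continuous_on (closure \<Omega>) (\<lambda>x. T x i j k l)" for i j k l
    unfolding T_def sym_pairs_def B_tensor_def divide_inverse
    by (intro continuous_intros \<alpha> C_continuous)
  obtain K where K0: "K \<ge> 0" and K':
    "\<And>x a. x \<in> \<Omega> \<Longrightarrow> \<bar>T x (fst a) (fst (snd a)) (fst (snd (snd a))) (snd (snd (snd a)))\<bar> \<le> K"
    using bounded_coefficients[OF bounded_\<Omega>,
        of "\<lambda>a x. T x (fst a) (fst (snd a)) (fst (snd (snd a))) (snd (snd (snd a)))"] T_cont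
    by blast
  have K: "\<bar>T x i j k l\<bar> \<le> K" if "x \<in> \<Omega>" for x i j k l
    using K'[OF that, of "(i, j, k, l)"] by simp
  have U2: "U \<in> borel_measurable (lebesgue_on \<Omega>)" "integrable (lebesgue_on \<Omega>) (\<lambda>x. (norm (U x))\<^sup>2)"
    using H_squareD[OF U] by (auto simp: square_integrable_def)
  have comp: "ddot T (\<lambda>x. fst (U x)) x $ i $ j = (\<Sum>k\<in>UNIV. \<Sum>l\<in>UNIV. T x i j k l * fst (U x) $ k $ l)" for x i j
    by (simp add: ddot_def)
  have comp_bound: "\<bar>ddot T (\<lambda>x. fst (U x)) x $ i $ j\<bar> \<le> 9 * K * norm (U x)" if x: "x \<in> \<Omega>" for x i j
  proof -
    have "\<bar>T x i j k l * fst (U x) $ k $ l\<bar> \<le> K * norm (U x)" for k l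
      unfolding abs_mult using K0 by (intro mult_mono K x component_le_norm_pair) auto
    then have "\<bar>ddot T (\<lambda>x. fst (U x)) x $ i $ j\<bar> \<le> (\<Sum>k\<in>(UNIV::3 set). \<Sum>l\<in>(UNIV::3 set). K * norm (U x))"
      unfolding comp by (intro order_trans[OF sum_abs] sum_mono)
    then show ?thesis
      by simp
  qed
  have bound: "(norm (ddot T (\<lambda>x. fst (U x)) x))\<^sup>2 \<le> 9 * (9 * K)\<^sup>2 * (norm (U x))\<^sup>2" if x: "x \<in> \<Omega>" for x
  proof -
    have "ddot T (\<lambda>x. fst (U x)) x $ i $ j * ddot T (\<lambda>x. fst (U x)) x $ i $ j \<le> (9 * K * norm (U x))\<^sup>2" for i j
      using power_mono[OF comp_bound[OF x, of i j], of 2] by (simp add: power2_eq_square)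
    then have "(norm (ddot T (\<lambda>x. fst (U x)) x))\<^sup>2 \<le> (\<Sum>i\<in>(UNIV::3 set). \<Sum>j\<in>(UNIV::3 set). (9 * K * norm (U x))\<^sup>2)"
      unfolding norm_matrix_squared by (intro sum_mono)
    then show ?thesis
      by (simp add: power_mult_distrib)
  qed
  have meas: "(\<lambda>x. ddot T (\<lambda>x. fst (U x)) x) \<in> borel_measurable (lebesgue_on \<Omega>)"
    unfolding comp
    by (rule borel_measurable_matrix, unfold comp)
      (intro borel_measurable_sum borel_measurable_times measurable_coefficient T_cont measurable_components U2)
  have "square_integrable (lebesgue_on \<Omega>) (\<lambda>x. (ddot T (\<lambda>x. fst (U x)) x, 0::real^3))"
  proof (rule square_integrable_bound)
    show "integrable (lebesgue_on \<Omega>) (\<lambda>x. 9 * (9 * K)\<^sup>2 * (norm (U x))\<^sup>2)"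
      using U2(2) by simp
    show "(\<lambda>x. (ddot T (\<lambda>x. fst (U x)) x, 0::real^3)) \<in> borel_measurable (lebesgue_on \<Omega>)"
      using meas by (intro borel_measurable_Pair) auto
  qed (use bound in simp)
  moreover have "transpose (ddot T (\<lambda>x. fst (U x)) x) = ddot T (\<lambda>x. fst (U x)) x" for x
    by (simp add: transpose_def vec_eq_iff ddot_def T_def sym_pairs_def add_ac)
  ultimately show ?thesis
    by (simp add: H_iff damping_def T_def)
qed

lemma inner_H_damping:
  assumes U: "U \<in> H \<Omega>" and V: "V \<in> H \<Omega>"
  shows "inner_H \<Omega> \<rho> C (damping C \<alpha> U) V = (\<integral>x. op_D C \<alpha> U x \<bullet> op_D C \<alpha> V x \<partial>lebesgue_on \<Omega>)"
  unfolding inner_H_energy_form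
  by (intro Bochner_Integration.integral_cong refl)
    (simp add: energy_form_damping H_symD[OF U] inner_vec_def op_D_eq)

lemma op_D_eq_zero_AE:
  assumes \<alpha>: "continuous_on (closure \<Omega>) \<alpha>" and U: "U \<in> H \<Omega>"
    and zero: "inner_H \<Omega> \<rho> C (damping C \<alpha> U) U = 0"
  shows "AE x in lebesgue_on \<Omega>. op_D C \<alpha> U x = 0"
proof -
  have "integrable (lebesgue_on \<Omega>) (\<lambda>x. energy_form \<rho> C x (damping C \<alpha> U x) (U x))"
    using damping_in_H[OF \<alpha> U] U by (intro energy_form_integrable H_squareD)
  moreover have "integrable (lebesgue_on \<Omega>) (\<lambda>x. energy_form \<rho> C x (damping C \<alpha> U x) (U x)) \<longleftrightarrow>
      integrable (lebesgue_on \<Omega>) (\<lambda>x. op_D C \<alpha> U x \<bullet> op_D C \<alpha> U x)"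
    by (intro Bochner_Integration.integrable_cong refl)
      (simp add: energy_form_damping H_symD[OF U] inner_vec_def op_D_eq)
  ultimately have "integrable (lebesgue_on \<Omega>) (\<lambda>x. op_D C \<alpha> U x \<bullet> op_D C \<alpha> U x)"
    by simp
  then have "(\<integral>x. op_D C \<alpha> U x \<bullet> op_D C \<alpha> U x \<partial>lebesgue_on \<Omega>) = 0 \<longleftrightarrow>
      (AE x in lebesgue_on \<Omega>. op_D C \<alpha> U x \<bullet> op_D C \<alpha> U x = 0)"
    by (rule integral_nonneg_eq_0_iff_AE) simp
  then have "AE x in lebesgue_on \<Omega>. op_D C \<alpha> U x \<bullet> op_D C \<alpha> U x = 0"
    using zero inner_H_damping[OF U U] by simp
  then show ?thesis
    by simp
qed

lemma eq_H_imp_inner_eq: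
  assumes "eq_H \<Omega> U V" "U \<in> H \<Omega>" "V \<in> H \<Omega>" "W \<in> H \<Omega>"
  shows "inner_H \<Omega> \<rho> C U W = inner_H \<Omega> \<rho> C V W"
  unfolding inner_H_energy_form
proof (rule integral_cong_AE)
  show "AE x in lebesgue_on \<Omega>. energy_form \<rho> C x (U x) (W x) = energy_form \<rho> C x (V x) (W x)"
    using assms(1) unfolding eq_H_def by eventually_elim simp
qed (use assms in \<open>auto intro!: borel_measurable_integrable energy_form_integrable H_squareD\<close>)


section \<open>Approach to constrained linear elasticity\<close>

sublocale semi_hilbert "H \<Omega>" "inner_H \<Omega> \<rho> C"
  by (rule semi_hilbert_H)

lemma nrm_eq: "nrm = norm_H \<Omega> \<rho> C"
  by (simp add: fun_eq_iff nrm_def norm_H_def)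

lemma eq_H_imp_weq: "eq_H \<Omega> U V \<Longrightarrow> U \<in> H \<Omega> \<Longrightarrow> V \<in> H \<Omega> \<Longrightarrow> weq U V"
  by (simp add: weq_def eq_H_imp_inner_eq)

lemma fun_diff_eq: "(\<lambda>x. U x - V x) = U - (V :: state)"
  and fun_linear_combination_eq: "(\<lambda>x. a *\<^sub>R U x + b *\<^sub>R V x) = a *\<^sub>R U + b *\<^sub>R (V :: state)"
  by (auto simp: scaleR_fun_def)

lemma contraction_semigroup_if_C0_semigroup:
  assumes S: "C0_semigroup \<Omega> \<rho> C S" and contr: "\<And>t. t \<ge> 0 \<Longrightarrow> contraction_H \<Omega> \<rho> C (S t)"
  shows "contraction_semigroup (H \<Omega>) (inner_H \<Omega> \<rho> C) S"
proof
  have op: "bounded_operator_H \<Omega> \<rho> C (S t)" if "t \<ge> 0" for t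
    using S that by (simp add: C0_semigroup_def)
  then have S_H: "S t U \<in> H \<Omega>" if "t \<ge> 0" "U \<in> H \<Omega>" for t U
    using that by (simp add: bounded_operator_H_def)
  show "contraction (S t)" if t: "t \<ge> 0" for t
    unfolding contraction_def
  proof (intro conjI ballI allI)
    fix U assume "U \<in> H \<Omega>"
    then show "S t U \<in> H \<Omega>" "nrm (S t U) \<le> nrm U"
      using S_H contr t by (auto simp: contraction_H_def nrm_eq)
  next
    fix U V a b assume "U \<in> H \<Omega>" "V \<in> H \<Omega>"
    then show "weq (S t (a *\<^sub>R U + b *\<^sub>R V)) (a *\<^sub>R S t U + b *\<^sub>R S t V)"
      using op[OF t] S_H t by (intro eq_H_imp_weq) (auto simp: bounded_operator_H_def fun_linear_combination_eq)
  qed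
  show "weq (S 0 U) U" if "U \<in> H \<Omega>" for U
    using S S_H that by (intro eq_H_imp_weq) (auto simp: C0_semigroup_def)
  show "weq (S (s + t) U) (S s (S t U))" if "s \<ge> 0" "t \<ge> 0" "U \<in> H \<Omega>" for s t U
    using S S_H that by (intro eq_H_imp_weq) (auto simp: C0_semigroup_def)
  show "((\<lambda>t. nrm (S t U - U)) \<longlongrightarrow> 0) (at_right 0)" if "U \<in> H \<Omega>" for U
    using S that by (simp add: C0_semigroup_def fun_diff_eq nrm_eq)
qed

lemma is_generator_if_has_generator:
  assumes "has_generator \<Omega> \<rho> C S A D"
  shows "is_generator S A D"
proof -
  have "(\<lambda>x. c *\<^sub>R (U x - V x) - F x) = c *\<^sub>R (U - V) - F" for c and U V F :: state
    by (auto simp: scaleR_fun_def)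
  then show ?thesis
    using assms by (simp add: has_generator_def is_generator_def difference_quotient_limit_def nrm_eq)
qed

end

theorem theorem3p3:
  fixes \<Omega> \<Gamma>1 \<Gamma>2 :: "(real^3) set"
    and \<rho> a0 :: real
    and C :: tensor4
    and \<alpha> \<omega>0 :: "real^3 \<Rightarrow> real^3^3"
    and S S1 :: "real \<Rightarrow> state \<Rightarrow> state"
    and U0 U1 W0 :: state
  assumes domain: "domain_with_boundary_parts \<Omega> \<Gamma>1 \<Gamma>2"
    and rho: "\<rho> > 0"
    and a0: "a0 > 0"
    and elasticity: "elasticity_tensor \<Omega> a0 C"
    and base_state: "stress_free_base_state \<Omega> \<omega>0 \<alpha>"
    and S: "C0_semigroup \<Omega> \<rho> C S" "\<And>t. t \<ge> 0 \<Longrightarrow> contraction_H \<Omega> \<rho> C (S t)"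
      "has_generator \<Omega> \<rho> C S (op_A \<Omega> \<rho> C \<alpha>) (dom_A \<Omega> \<Gamma>1 C)"
    and S1: "C0_semigroup \<Omega> \<rho> C S1" "\<And>t. t \<ge> 0 \<Longrightarrow> unitary_H \<Omega> \<rho> C (S1 t)"
      "has_generator \<Omega> \<rho> C S1 (op_A1 \<Omega> \<rho> C) (dom_A \<Omega> \<Gamma>1 C)"
    and U0: "U0 \<in> H \<Omega>"
    and U1: "U1 \<in> isometric_subspace \<Omega> \<rho> C S"
    and W0: "W0 \<in> H \<Omega>" "\<And>V. V \<in> isometric_subspace \<Omega> \<rho> C S \<Longrightarrow> inner_H \<Omega> \<rho> C W0 V = 0"
    and decomposition: "eq_H \<Omega> U0 (\<lambda>x. U1 x + W0 x)"
  shows "(\<forall>t\<ge>0. AE x in lebesgue_on \<Omega>. op_D C \<alpha> (S1 t U1) x = 0) \<and>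
         weakly_to_zero_H \<Omega> \<rho> C (\<lambda>t x. S t U0 x - S1 t U1 x)"
proof -
  have \<alpha>: "continuous_on (closure \<Omega>) \<alpha>"
    using base_state by (simp add: stress_free_base_state_def)
  interpret elastic_body \<Omega> \<rho> a0 C
    using domain rho a0 elasticity by unfold_locales (auto simp: domain_with_boundary_parts_def)
  have isometric: "inner_H \<Omega> \<rho> C (S1 t U) (S1 t V) = inner_H \<Omega> \<rho> C U V"
    if "t \<ge> 0" "U \<in> H \<Omega>" "V \<in> H \<Omega>" for t U V
    using S1(2) that by (simp add: unitary_H_def)
  have semigroup_S: "contraction_semigroup (H \<Omega>) (inner_H \<Omega> \<rho> C) S"
    using S by (intro contraction_semigroup_if_C0_semigroup)
  have semigroup_S1: "contraction_semigroup (H \<Omega>) (inner_H \<Omega> \<rho> C) S1"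
    using S1(1) isometric by (intro contraction_semigroup_if_C0_semigroup) (auto simp: contraction_H_def norm_H_def)
  interpret S: contraction_semigroup "H \<Omega>" "inner_H \<Omega> \<rho> C" S
    by (rule semigroup_S)
  interpret S1: contraction_semigroup "H \<Omega>" "inner_H \<Omega> \<rho> C" S1
    by (rule semigroup_S1)
  have unitary_part: "isometric_subspace \<Omega> \<rho> C S = S.unitary_part"
    by (simp add: isometric_subspace_def S.unitary_part_def nrm_eq adjoint_H_def[abs_def] S.Sa_def[abs_def])
  have U1': "U1 \<in> H \<Omega>" "U1 \<in> S.isometric_part"
    using U1 by (auto simp: unitary_part S.unitary_part_def S.isometric_part_def)
  have damping_sym: "inner_H \<Omega> \<rho> C (damping C \<alpha> U) V = inner_H \<Omega> \<rho> C U (damping C \<alpha> V)"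
    if "U \<in> H \<Omega>" "V \<in> H \<Omega>" for U V
  proof -
    have "inner_H \<Omega> \<rho> C U (damping C \<alpha> V) = inner_H \<Omega> \<rho> C (damping C \<alpha> V) U"
      using that by (intro ip_commute damping_in_H[OF \<alpha>])
    then show ?thesis
      using that by (simp add: inner_H_damping inner_commute)
  qed
  have damping_null: "weq (damping C \<alpha> U) 0"
    if U: "U \<in> H \<Omega>" and zero: "inner_H \<Omega> \<rho> C (damping C \<alpha> U) U = 0" for U
    unfolding weq_def
  proof
    fix V assume V: "V \<in> H \<Omega>"
    have "(\<integral>x. op_D C \<alpha> U x \<bullet> op_D C \<alpha> V x \<partial>lebesgue_on \<Omega>) = 0"
      using op_D_eq_zero_AE[OF \<alpha> U zero] by (intro integral_eq_zero_AE) auto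
    then show "inner_H \<Omega> \<rho> C (damping C \<alpha> U) V = inner_H \<Omega> \<rho> C 0 V"
      using U V by (simp add: inner_H_damping)
  qed
  note undamped = isometric_part_undamped[OF semigroup_S semigroup_S1 isometric
      is_generator_if_has_generator[OF S(3)] is_generator_if_has_generator[OF S1(3)]
      op_A_eq damping_in_H[OF \<alpha>] damping_sym damping_null]
  have S_eq_S1: "weq (S t U1) (S1 t U1)" if "t \<ge> 0" for t
    by (rule undamped(1)) (use U1' that in \<open>simp_all add: S.isometric_part_def\<close>)
  have "AE x in lebesgue_on \<Omega>. op_D C \<alpha> (S1 t U1) x = 0" if t: "t \<ge> 0" for t
  proof (rule op_D_eq_zero_AE[OF \<alpha>])
    have H': "S t U1 \<in> H \<Omega>" "S1 t U1 \<in> H \<Omega>" "damping C \<alpha> (S1 t U1) \<in> H \<Omega>"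
      using t U1' damping_in_H[OF \<alpha>] by auto
    show "S1 t U1 \<in> H \<Omega>"
      by fact
    \<comment> \<open>The damping vanishes on \<open>S t U1\<close>, which is again isometric; by symmetry of the damping this carries
      over to \<open>S1 t U1\<close>, which is only almost everywhere equal to it.\<close>
    have damping_S: "weq (damping C \<alpha> (S t U1)) 0"
      by (rule undamped(2)) (use S.isometric_part_S[OF U1'(2) t] in \<open>simp_all add: S.isometric_part_def\<close>)
    have "inner_H \<Omega> \<rho> C (damping C \<alpha> (S1 t U1)) (S1 t U1) = inner_H \<Omega> \<rho> C (S1 t U1) (damping C \<alpha> (S1 t U1))"
      by (rule damping_sym) fact+
    also have "\<dots> = inner_H \<Omega> \<rho> C (S t U1) (damping C \<alpha> (S1 t U1))"
      using weqD[OF S_eq_S1[OF t] H'(3)] by simp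
    also have "\<dots> = inner_H \<Omega> \<rho> C (damping C \<alpha> (S t U1)) (S1 t U1)"
      by (rule damping_sym[symmetric]) fact+
    also have "\<dots> = 0"
      using weqD[OF damping_S H'(2)] H'(2) by simp
    finally show "inner_H \<Omega> \<rho> C (damping C \<alpha> (S1 t U1)) (S1 t U1) = 0" .
  qed
  moreover have "weakly_to_zero_H \<Omega> \<rho> C (\<lambda>t x. S t U0 x - S1 t U1 x)"
    unfolding weakly_to_zero_H_def
  proof
    fix V assume V: "V \<in> H \<Omega>"
    have "((\<lambda>t. inner_H \<Omega> \<rho> C (S t W0) V) \<longlongrightarrow> 0) at_top"
      using W0 V by (intro S.weakly_to_zero_orthogonal_to_unitary_part) (simp_all add: unitary_part)
    then show "((\<lambda>t. inner_H \<Omega> \<rho> C (\<lambda>x. S t U0 x - S1 t U1 x) V) \<longlongrightarrow> 0) at_top"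
    proof (rule Lim_transform_eventually)
      show "\<forall>\<^sub>F t in at_top. inner_H \<Omega> \<rho> C (S t W0) V = inner_H \<Omega> \<rho> C (\<lambda>x. S t U0 x - S1 t U1 x) V"
        using eventually_ge_at_top[of 0]
      proof eventually_elim
        case (elim t)
        have "(\<lambda>x. U1 x + W0 x) = U1 + W0"
          by auto
        then have "weq U0 (U1 + W0)"
          using eq_H_imp_weq[OF decomposition U0] U1' W0(1) by simp
        then have "weq (S t U0) (S t (U1 + W0))"
          using U0 U1' W0(1) elim by (intro contraction_cong[OF S.contraction_S]) auto
        also have "weq (S t (U1 + W0)) (S t U1 + S t W0)"
          using U1' W0(1) elim by (intro contraction_add[OF S.contraction_S])
        finally have "inner_H \<Omega> \<rho> C (S t U0) V = inner_H \<Omega> \<rho> C (S t U1 + S t W0) V"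
          by (rule weqD) (rule V)
        then show ?case
          using weqD[OF S_eq_S1[OF elim] V] U0 U1' W0(1) V elim
          by (simp add: fun_diff_eq ip_linear)
      qed
    qed
  qed
  ultimately show ?thesis
    by blast
qed

end
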